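(* Let $0<p_-\le p_0<p_+\le \infty$. Let $\mathcal F$ be a collection of pairs $(f,g)$ of nonnegative measurable functions on $\mathbb{R}^n$. Assume that for every $(f,g)\in \mathcal F$ and every $w\in A_{\frac{p_0}{p_-}}\cap RH_{\left(\frac{p_+}{p_0}\right)'}$ we have $$\|g\|_{L^{p_0}(w)}\le C \|f\|_{L^{p_0}(w)},$$ where $C$ does not depend on the pair $(f,g)$ and it depends on $w$ only in terms of the $A_{\frac{p_0}{p_-}}$ and $RH_{\left(\frac{p_+}{p_0}\right)'}$ constants of $w$. Let $p_-<p<p_+$, let $w\in A_{\frac{p}{p_-}}$ with $\sigma_w> {\left(\frac{p_+}{p}\right)'}$, and let $\lambda=(\lambda_1,\lambda_2)$ with $0\le\lambda_2\le n$, $0<\lambda_1 {\sigma_w'}+ \lambda_2$ and $${\lambda_1}\sigma'_w+{\lambda_2}<n\left(1-\frac{p}{p_+}{\sigma'_w}\right).$$ Let $\theta\ge0$ be such that $\lambda_1+\lambda_2\theta>0$ and, for some constant $c$, $\frac{w(B(0, r))}{ w(B(0, R)) }\le c \left(\frac rR\right)^{n\theta}$ for all $0<r<R$; and let $\alpha$ satisfy $0\le\alpha<\frac{n}{n-\lambda_2 }\left(\lambda_1+ \lambda_2 \theta\right)$ if $\lambda_2<n$, and $0\le\alpha<\infty$ if $\lambda_2= n$. Then for all $(f,g)\in\mathcal F$ $$\|g\|_{\mathcal L^{p,\lambda}(|x|^\alpha w)}\le C \|f\|_{\mathcal L^{p,\lambda}(|x|^\alpha w)},$$ with $C$ independent of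 the pair $(f,g)$. Moreover, if the hypothesis holds for $p_0=p_-$, then the result is also valid for $p=p_-$.
   Context: For a weight (locally integrable, a.e. positive function) $v$ on $\mathbb{R}^n$, $v(E)=\int_E v$; $|E|$ is Lebesgue measure and $B(x,r)$ the Euclidean ball; $\|f\|_{L^p(v)}=(\int|f|^pv)^{1/p}$. For $0<p<\infty$ and $\lambda=(\lambda_1,\lambda_2)\in\mathbb{R}^2$, $$\|f\|_{\mathcal L^{p,\lambda}(v)} := \sup_{x\in \mathbb{R}^n,\, r>0}\left(\frac 1{r^{\lambda_1}\, v(B(x,r))^{\lambda_2/n}}\int_{B(x,r)}|f|^p v\right)^{1/p}.$$ $|x|^\alpha w$ denotes the weight $x\mapsto|x|^\alpha w(x)$. $w\in A_q$ ($1<q<\infty$) means $[w]_{A_q}:=\sup_B \frac{w(B)}{|B|}\left(\frac{w^{1-q'}(B)}{|B|}\right)^{q-1}<\infty$ over all balls (this is the $A_q$ constant); $w\in A_1$ means $w(B)/|B|\le c\,w(x)$ for a.e. $x\in B$, for all balls $B$, and the $A_1$ constant is the smallest such $c$. For $1<\sigma<\infty$, $w\in RH_\sigma$ means $\left(\frac{1}{|B|}\int_{B} w^\sigma \right)^{1/\sigma}\le \frac{C}{|B|} \int_{B} w$ with $C$ independent of the ball $B$; the smallest such $C$ is the $RH_\sigma$ constant. Every $A_q$ weight is in some $RH_\sigma$. Define $\sigma_w=\sup\{\sigma: w\in RH_\sigma\}\in(1,\infty]$. A prime denotes the conjugate exponent, $q'=q/(q-1)$, with $\infty'=1$. If $p_+=\infty$,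 then $(p_+/p)'=1$, $p/p_+=0$, and the condition of belonging to $RH_1$ is void. *)

theory Defs
  imports "HOL-Analysis.Analysis"
begin

text \<open>Powers with a real exponent on [0,\<open>\<infinity>\<close>].  The infinite base is meant for positive exponents
  only; below, an exponent zero occurs only with a finite base.\<close>

definition epowr :: "ennreal \<Rightarrow> real \<Rightarrow> ennreal" where
  "epowr x a = (if x = top then top else ennreal (enn2real x powr a))"

text \<open>The convention \<open>\<infinity>' = 1\<close> is built in; only arguments above 1 are meaningful
  (at 1 the value is a division by zero).\<close>

definition conj_exp :: "ereal \<Rightarrow> real" where
  "conj_exp q = (if q = \<infinity> then 1 else real_of_ereal q / (real_of_ereal q - 1))"

definition weight :: "(real^'n \<Rightarrow> real) \<Rightarrow> bool" where
  "weight w \<longleftrightarrow> (\<forall>K. compact K \<longrightarrow> set_integrable lebesgue K w) \<and> (AE x in lebesgue. 0 < w x)"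

definition wmeas :: "(real^'n \<Rightarrow> real) \<Rightarrow> (real^'n) set \<Rightarrow> ennreal" where
  "wmeas w E = (\<integral>\<^sup>+x\<in>E. ennreal (w x) \<partial>lebesgue)"

definition Lp_norm :: "real \<Rightarrow> (real^'n \<Rightarrow> real) \<Rightarrow> (real^'n \<Rightarrow> real) \<Rightarrow> ennreal" where
  "Lp_norm p w f = epowr (\<integral>\<^sup>+x. ennreal (\<bar>f x\<bar> powr p * w x) \<partial>lebesgue) (1 / p)"

definition morrey_norm ::
  "real \<Rightarrow> real \<times> real \<Rightarrow> (real^'n \<Rightarrow> real) \<Rightarrow> (real^'n \<Rightarrow> real) \<Rightarrow> ennreal" where
  "morrey_norm p l v f =
    (SUP (x, r) \<in> UNIV \<times> {0<..}.
      epowr ((\<integral>\<^sup>+y\<in>ball x r. ennreal (\<bar>f y\<bar> powr p * v y) \<partial>lebesgue) /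
             (ennreal (r powr fst l) * epowr (wmeas v (ball x r)) (snd l / real CARD('n))))
            (1 / p))"

text \<open>The \<open>A\<^sub>q\<close> constant for \<open>1 \<le> q\<close>, with value \<open>top\<close> if \<open>w\<close> is not in \<open>A\<^sub>q\<close>.\<close>

definition A_const :: "real \<Rightarrow> (real^'n \<Rightarrow> real) \<Rightarrow> ennreal" where
  "A_const q w =
    (if q = 1 then
       Inf {c. \<forall>x r. 0 < r \<longrightarrow>
         (AE y in lebesgue. y \<in> ball x r \<longrightarrow>
            wmeas w (ball x r) / emeasure lebesgue (ball x r) \<le> c * ennreal (w y))}
     else
       (SUP (x, r) \<in> UNIV \<times> {0<..}.
          wmeas w (ball x r) / emeasure lebesgue (ball x r) *
          epowr (wmeas (\<lambda>y. w y powr (1 - conj_exp (ereal q))) (ball x r)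
                   / emeasure lebesgue (ball x r)) (q - 1)))"

definition A_class :: "real \<Rightarrow> (real^'n \<Rightarrow> real) set" where
  "A_class q = {w. weight w \<and> A_const q w < top}"

definition RH_const :: "real \<Rightarrow> (real^'n \<Rightarrow> real) \<Rightarrow> ennreal" where
  "RH_const s w =
    Inf {C. \<forall>x r. 0 < r \<longrightarrow>
      epowr (wmeas (\<lambda>y. w y powr s) (ball x r) / emeasure lebesgue (ball x r)) (1 / s)
        \<le> C * (wmeas w (ball x r) / emeasure lebesgue (ball x r))}"

definition RH_class :: "real \<Rightarrow> (real^'n \<Rightarrow> real) set" where
  "RH_class s = {w. weight w \<and> RH_const s w < top}"

definition RH_sup :: "(real^'n \<Rightarrow> real) \<Rightarrow> ereal" where
  "RH_sup w = Sup (ereal ` {s. 1 < s \<and> w \<in> RH_class s})"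

text \<open>For exponent 1 the reverse Hoelder condition is void, and its constant carries no
  information about the weight.\<close>

lemma weight_average:
  fixes w :: "real^'n \<Rightarrow> real"
  assumes "weight w" "0 < r"
  shows "0 < wmeas w (ball x r) / emeasure lebesgue (ball x r)"
    and "wmeas w (ball x r) / emeasure lebesgue (ball x r) < top"
proof -
  have int: "set_integrable lebesgue (ball x r) w"
    using assms(1) unfolding weight_def
    by (meson ball_subset_cball compact_cball lmeasurable_ball fmeasurableD set_integrable_subset)
  have pos: "AE y in lebesgue. 0 < w y"
    using assms(1) by (simp add: weight_def)
  have fin: "wmeas w (ball x r) < top"
  proof -
    have "wmeas w (ball x r) = (\<integral>\<^sup>+y. ennreal (indicator (ball x r) y *\<^sub>R w y) \<partial>lebesgue)"
      unfolding wmeas_def by (intro nn_integral_cong) (auto simp: indicator_def)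
    also have "\<dots> \<le> (\<integral>\<^sup>+y. ennreal (norm (indicator (ball x r) y *\<^sub>R w y)) \<partial>lebesgue)"
      by (intro nn_integral_mono ennreal_leI) auto
    also have "\<dots> < top"
      using int unfolding set_integrable_def integrable_iff_bounded by simp
    finally show ?thesis .
  qed
  have B: "emeasure lebesgue (ball x r) < top" "0 < emeasure lebesgue (ball x r)"
    using assms(2) emeasure_lborel_ball_finite[of x r]
    by (auto simp: less_top emeasure_lborel_cball_finite content_ball_pos
        emeasure_eq_ennreal_measure top_unique)
  have "wmeas w (ball x r) \<noteq> 0"
  proof
    assume "wmeas w (ball x r) = 0"
    moreover have m: "(\<lambda>y. indicator (ball x r) y *\<^sub>R w y) \<in> borel_measurable lebesgue"
      using int unfolding set_integrable_def by (rule borel_measurable_integrable)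
    moreover have "wmeas w (ball x r) = (\<integral>\<^sup>+y. ennreal (indicator (ball x r) y *\<^sub>R w y) \<partial>lebesgue)"
      unfolding wmeas_def by (intro nn_integral_cong) (auto simp: indicator_def)
    ultimately have "AE y in lebesgue. ennreal (indicator (ball x r) y *\<^sub>R w y) = 0"
      using nn_integral_0_iff_AE[of "\<lambda>y. ennreal (indicator (ball x r) y *\<^sub>R w y)" lebesgue]
      by simp
    with pos have "AE y in lebesgue. y \<notin> ball x r"
      by eventually_elim (auto simp: indicator_def split: if_splits)
    then have "emeasure lebesgue (ball x r) = 0"
      by (subst (asm) AE_iff_measurable[of "ball x r"]) auto
    with B show False by simp
  qed
  then show "0 < wmeas w (ball x r) / emeasure lebesgue (ball x r)"
    using B by (auto simp: zero_less_iff_neq_zero ennreal_divide_eq_0_iff)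
  show "wmeas w (ball x r) / emeasure lebesgue (ball x r) < top"
    using B fin by (metis ennreal_divide_eq_top_iff less_irrefl less_top)
qed

lemma RH_const_one:
  fixes w :: "real^'n \<Rightarrow> real"
  assumes "weight w"
  shows "RH_const 1 w = 1"
proof -
  let ?a = "\<lambda>x r. wmeas w (ball x r) / emeasure lebesgue (ball x r)"
  have powr_1: "wmeas (\<lambda>y. w y powr 1) E = wmeas w E" for E
    unfolding wmeas_def
    using assms by (intro nn_integral_cong_AE) (auto simp: weight_def elim!: eventually_mono)
  have "epowr t 1 = t" for t
    by (cases t) (auto simp: epowr_def)
  with powr_1 have "RH_const 1 w = Inf {C. \<forall>x r. 0 < r \<longrightarrow> ?a x r \<le> C * ?a x r}"
    by (simp add: RH_const_def)
  also have "\<dots> = 1"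
  proof (intro antisym Inf_lower Inf_greatest)
    fix C assume "C \<in> {C. \<forall>x r. 0 < r \<longrightarrow> ?a x r \<le> C * ?a x r}"
    then have "1 * ?a 0 1 \<le> C * ?a 0 1" by simp
    then show "1 \<le> C"
      using ennreal_mult_strict_right_mono[of C 1 "?a 0 1"] weight_average[OF assms, of 1 0]
      by (meson linorder_not_le zero_less_one)
  qed auto
  finally show ?thesis .
qed

lemma RH_class_one: "RH_class 1 = {w. weight w}"
  by (auto simp: RH_class_def RH_const_one)

end

theory Submission
  imports Defs
begin

text \<open>
  Only finiteness of the constant for each individual weight is used: no monotonicity of \<open>\<Phi>\<close> is assumed, so
  constants cannot be tracked through a family of weights.  Instead, if an estimate fails, one picks a
  sequence of pairs violating it by factors growing geometrically, and builds a single weight that is good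
  for all of them.

  Replacing \<open>f\<close> by \<open>f^p\<^sub>-\<close> one may take \<open>p\<^sub>- = 1\<close>.  Limited range extrapolation, through the Rubio de Francia
  algorithm, yields \<open>L\<^sup>q(u)\<close> estimates for all \<open>u \<in> A\<^sub>q \<inter> RH\<^sub>s\<close>.  For a ball \<open>B = B(x,r)\<close> the weight
  \<open>u(y) = w(y) \<Theta>(x,\<rho>)^-1 (r/\<rho>)^\<epsilon>\<close>, \<open>\<rho> = \<bar>x-y\<bar> + r\<close>, where \<open>\<Theta>(x,\<rho>)\<close> is the growth of \<open>\<integral> f^p w\<close> over \<open>B(x,\<rho>)\<close>
  permitted by the Morrey norm, belongs to this class: \<open>\<Theta>\<close> is essentially increasing in \<open>\<rho>\<close>, but by the upper
  bound on \<open>\<lambda>\<^sub>1 \<sigma>' + \<lambda>\<^sub>2\<close> it grows more slowly than the \<open>w^s\<close>-measure allows.  Applied to sums of such weights,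
  the \<open>L\<^sup>q(u)\<close> estimate becomes the Morrey estimate.
\<close>

section \<open>Powers, Hoelder's inequality and averages over balls\<close>

text \<open>A weight built from a sequence dominates its j-th datum only up to a loss such as
  \<kappa>^j or 4^j. The j-th violation is therefore taken larger than this loss by a further factor
  j + 1: the hypothesis supplies one fixed number for the combined weight, and j + 1 outgrows it.
  After scaling by p_- the exponents are q = p/p_- and q0 = p0/p_-. With \<eta> = p_-/p_+, read as 0
  if p_+ is infinite, the reverse Hoelder exponents become s = 1/(1 - \<eta> q) and s0 = 1/(1 -
  \<eta> q0). Hence \<eta> q s = s - 1, so that t = s(q-1) + 1 equals q(1-\<eta>)s, and likewise for
  t0; the powers in the extrapolation balance because the factor 1 - \<eta> is common to both. Three
  strict inequalities carry the Morrey part. The lower condition on \<lambda> makes \<Theta> grow up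
  to radius |x|, the condition on \<alpha> makes it grow beyond, and the upper condition on
  \<lambda> gives a geometric gain when w^s \<Theta>^-s is integrated over shrinking balls. As
  \<sigma>_w need not be attained, they are used for a \<sigma> with w in RH_\<sigma> whose
  conjugate is close to that of \<sigma>_w.\<close>

lemma epowr_ennreal: "0 \<le> x \<Longrightarrow> epowr (ennreal x) a = ennreal (x powr a)"
  by (simp add: epowr_def)

lemma epowr_top [simp]: "epowr top a = top"
  by (simp add: epowr_def)

lemma epowr_zero [simp]: "epowr 0 a = 0"
  by (simp add: epowr_def)

lemma epowr_1 [simp]: "epowr x 1 = x"
  by (cases x) (auto simp: epowr_def)

lemma epowr_one_base [simp]: "epowr 1 a = 1"
  by (simp add: epowr_def)

lemma epowr_less_top_iff [simp]: "epowr x a < top \<longleftrightarrow> x < top"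
  by (auto simp: epowr_def less_top[symmetric])

lemma epowr_mono: "0 \<le> a \<Longrightarrow> x \<le> y \<Longrightarrow> epowr x a \<le> epowr y a"
  by (cases x; cases y)
    (auto simp: epowr_ennreal top_unique intro!: ennreal_leI powr_mono2)

lemma epowr_mult: "0 < a \<Longrightarrow> epowr (x * y) a = epowr x a * epowr y a"
  by (cases x; cases y; cases "x = 0"; cases "y = 0")
    (auto simp: epowr_ennreal powr_mult ennreal_mult_top ennreal_top_mult ennreal_eq_0_iff
       simp flip: ennreal_mult)

lemma epowr_epowr: "epowr (epowr x a) b = epowr x (a * b)"
  by (cases x) (auto simp: epowr_ennreal powr_powr)

text \<open>Valid for infinite values as well; roots are moved across inequalities in this way
  without case distinctions.\<close>

lemma epowr_le_iff: "0 < a \<Longrightarrow> epowr x a \<le> y \<longleftrightarrow> x \<le> epowr y (1 / a)"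
  using epowr_mono[of "1 / a" "epowr x a" y] epowr_mono[of a x "epowr y (1 / a)"]
  by (auto simp: epowr_epowr)

lemma epowr_measurable [measurable]:
  "f \<in> borel_measurable M \<Longrightarrow> (\<lambda>x. epowr (f x) a) \<in> borel_measurable M"
  unfolding epowr_def by (intro measurable_If) auto

lemma epowr_SUP_le: "0 < a \<Longrightarrow> (\<And>i. i \<in> I \<Longrightarrow> epowr (f i) a \<le> y) \<Longrightarrow> epowr (SUP i\<in>I. f i) a \<le> y"
  by (simp add: epowr_le_iff SUP_least)

text \<open>Young's inequality for f/A and g/B, integrated. Positive majorants A and B stand in for
  the integrals, so that no integral that is zero or infinite has to be divided by. The endpoints a
  = 0 and b = 0 are included.\<close>

lemma nn_integral_Holder_le:
  fixes f g :: "'b \<Rightarrow> real"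
  assumes [measurable]: "f \<in> borel_measurable M" "g \<in> borel_measurable M"
    and nonneg: "\<And>x. 0 \<le> f x" "\<And>x. 0 \<le> g x"
    and ab: "0 \<le> a" "0 \<le> b" "a + b = 1" and AB: "0 < A" "0 < B"
    and le: "(\<integral>\<^sup>+x. ennreal (f x) \<partial>M) \<le> ennreal A" "(\<integral>\<^sup>+x. ennreal (g x) \<partial>M) \<le> ennreal B"
  shows "(\<integral>\<^sup>+x. ennreal (f x powr a * g x powr b) \<partial>M) \<le> ennreal (A powr a * B powr b)"
proof -
  let ?c = "A powr a * B powr b"
  have pt: "f x powr a * g x powr b \<le> ?c * (a / A) * f x + ?c * (b / B) * g x" for x
  proof -
    have "(f x / A) powr a * (g x / B) powr b \<le> a * (f x / A) + b * (g x / B)"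
      using Youngs_inequality_0[of a b "f x / A" "g x / B"] ab nonneg[of x] AB
      by (cases "f x = 0"; cases "g x = 0") (auto simp: less_le)
    then have "?c * ((f x / A) powr a * (g x / B) powr b) \<le> ?c * (a * (f x / A) + b * (g x / B))"
      by (intro mult_left_mono) auto
    then show ?thesis using AB nonneg[of x] by (simp add: powr_divide distrib_left)
  qed
  have "(\<integral>\<^sup>+x. ennreal (f x powr a * g x powr b) \<partial>M)
      \<le> (\<integral>\<^sup>+x. ennreal (?c * (a / A)) * ennreal (f x) + ennreal (?c * (b / B)) * ennreal (g x) \<partial>M)"
  proof (rule nn_integral_mono)
    fix x
    show "ennreal (f x powr a * g x powr b)
        \<le> ennreal (?c * (a / A)) * ennreal (f x) + ennreal (?c * (b / B)) * ennreal (g x)"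
      using ennreal_leI[OF pt[of x]] ab AB nonneg[of x]
      by (simp flip: ennreal_plus ennreal_mult del: times_divide_eq_right)
  qed
  also have "\<dots> = ennreal (?c * (a / A)) * (\<integral>\<^sup>+x. ennreal (f x) \<partial>M)
      + ennreal (?c * (b / B)) * (\<integral>\<^sup>+x. ennreal (g x) \<partial>M)"
    by (subst nn_integral_add) (auto simp: nn_integral_cmult)
  also have "\<dots> \<le> ennreal (?c * (a / A)) * ennreal A + ennreal (?c * (b / B)) * ennreal B"
    by (intro add_mono mult_left_mono le) auto
  also have "\<dots> = ennreal (?c * (a + b))"
    using ab AB by (simp flip: ennreal_mult ennreal_plus) (metis distrib_right mult.commute mult_1)
  finally show ?thesis using ab by simp
qed

section \<open>Volumes, masses and averages over balls\<close>

lemma ball_sets_lebesgue [measurable]: "ball x r \<in> sets lebesgue"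
  by simp

definition vol :: "real^'n \<Rightarrow> real \<Rightarrow> real" where
  "vol x r = measure lebesgue (ball x r)"

text \<open>Positivity everywhere, instead of almost everywhere, makes all real powers of the weight
  positive, so the laws of \<open>powr\<close> apply without exceptional null sets.
  \<open>pos_version\<close> supplies such a representative.\<close>

definition pos_locint :: "(real^'n \<Rightarrow> real) \<Rightarrow> bool" where
  "pos_locint h \<longleftrightarrow> h \<in> borel_measurable lebesgue \<and> (\<forall>x. 0 < h x) \<and> (\<forall>x r. wmeas h (ball x r) < top)"

definition mass :: "(real^'n \<Rightarrow> real) \<Rightarrow> real^'n \<Rightarrow> real \<Rightarrow> real" where
  "mass h x r = enn2real (wmeas h (ball x r))"

definition avg :: "(real^'n \<Rightarrow> real) \<Rightarrow> real^'n \<Rightarrow> real \<Rightarrow> real" where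
  "avg h x r = mass h x r / vol x r"

lemma vol_pos [simp]: "0 < r \<Longrightarrow> 0 < vol x r"
  by (simp add: vol_def)

lemma emeasure_ball_vol: "emeasure lebesgue (ball x r) = ennreal (vol x r)"
  unfolding vol_def using emeasure_lborel_ball_finite[of x r] by (intro emeasure_eq_ennreal_measure) auto

lemma vol_scale:
  fixes x y :: "real^'n"
  shows "0 < r \<Longrightarrow> 0 < R \<Longrightarrow> vol x R = (R / r) ^ CARD('n) * vol y r"
  unfolding vol_def
  using content_ball_conv_unit_ball[of R x] content_ball_conv_unit_ball[of r y]
  by (simp add: field_simps power_divide)

lemma pos_locintD:
  assumes "pos_locint h"
  shows "h \<in> borel_measurable lebesgue" "0 < h x" "wmeas h (ball x r) < top"
    "wmeas h (ball x r) = ennreal (mass h x r)"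
  using assms by (auto simp: pos_locint_def mass_def)

lemma pos_locint_nonneg: "pos_locint h \<Longrightarrow> 0 \<le> h x"
  using pos_locintD(2)[of h x] by simp

lemma pos_locintI:
  assumes "h \<in> borel_measurable lebesgue" "\<And>x. 0 < h x"
    and fin: "\<And>x r. 0 < r \<Longrightarrow> \<exists>A. wmeas h (ball x r) \<le> ennreal A"
  shows "pos_locint h"
  unfolding pos_locint_def
proof (intro conjI allI assms)
  fix x r
  show "wmeas h (ball x r) < top"
  proof (cases "0 < r")
    case True
    then show ?thesis using fin[of r x] by (auto intro: le_less_trans)
  next
    case False
    then have *: "ball x r = {}" by simp
    show ?thesis unfolding wmeas_def * by simp
  qed
qed

lemma wmeas_mono: "A \<subseteq> B \<Longrightarrow> wmeas h A \<le> wmeas h B"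
  unfolding wmeas_def by (intro nn_integral_mono) (auto simp: indicator_def)

lemma wmeas_mono_AE:
  assumes "AE y in lebesgue. y \<in> E \<longrightarrow> f y \<le> c * g y" "0 \<le> c" and [measurable]: "g \<in> borel_measurable lebesgue"
    "E \<in> sets lebesgue" and "\<And>y. 0 \<le> g y"
  shows "wmeas f E \<le> ennreal c * wmeas g E"
proof -
  have "wmeas f E \<le> (\<integral>\<^sup>+y. ennreal c * (ennreal (g y) * indicator E y) \<partial>lebesgue)"
    unfolding wmeas_def
  proof (rule nn_integral_mono_AE, use assms(1) in eventually_elim)
    case (elim y)
    then show ?case using assms by (auto simp: indicator_def simp flip: ennreal_mult intro: ennreal_leI)
  qed
  also have "\<dots> = ennreal c * wmeas g E"
    unfolding wmeas_def by (rule nn_integral_cmult) measurable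
  finally show ?thesis .
qed

lemma mass_nonneg [simp]: "0 \<le> mass h x r"
  by (simp add: mass_def)

lemma mass_pos:
  assumes "pos_locint h" "0 < r"
  shows "0 < mass h x r"
proof -
  have [measurable]: "h \<in> borel_measurable lebesgue" using assms by (simp add: pos_locintD)
  have "wmeas h (ball x r) \<noteq> 0"
  proof
    assume "wmeas h (ball x r) = 0"
    then have "AE y in lebesgue. ennreal (h y) * indicator (ball x r) y = 0"
      unfolding wmeas_def by (subst (asm) nn_integral_0_iff_AE) measurable
    then have "AE y in lebesgue. y \<notin> ball x r"
    proof eventually_elim
      case (elim y)
      then show ?case using pos_locintD(2)[OF assms(1), of y]
        by (auto simp: indicator_def ennreal_eq_0_iff split: if_splits)
    qed
    then have "emeasure lebesgue (ball x r) = 0"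
      by (subst (asm) AE_iff_measurable[of "ball x r"]) auto
    then show False using assms vol_pos[of r x] by (simp add: emeasure_ball_vol del: vol_pos)
  qed
  then show ?thesis using pos_locintD(4)[OF assms(1), of x r] by (auto simp: zero_less_iff_neq_zero less_le)
qed

lemma avg_nonneg [simp]: "0 \<le> avg h x r"
  by (simp add: avg_def vol_def)

lemma avg_pos: "pos_locint h \<Longrightarrow> 0 < r \<Longrightarrow> 0 < avg h x r"
  by (simp add: avg_def mass_pos)

lemma mass_avg: "0 < r \<Longrightarrow> mass h x r = avg h x r * vol x r"
  using vol_pos[of r x] by (simp add: avg_def del: vol_pos)

lemma mass_le: "wmeas h (ball x r) \<le> ennreal A \<Longrightarrow> 0 \<le> A \<Longrightarrow> mass h x r \<le> A"
  unfolding mass_def by (rule enn2real_leI)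

lemma avg_le: "wmeas h (ball x r) \<le> ennreal (A * vol x r) \<Longrightarrow> 0 \<le> A \<Longrightarrow> 0 < r \<Longrightarrow> avg h x r \<le> A"
  unfolding avg_def using mass_le[of h x r "A * vol x r"] vol_pos[of r x] by (simp add: divide_simps
      del: vol_pos)

lemma mass_mono: "pos_locint h \<Longrightarrow> ball x r \<subseteq> ball y R \<Longrightarrow> mass h x r \<le> mass h y R"
  unfolding mass_def by (intro enn2real_mono wmeas_mono) (auto simp: pos_locintD)

lemma avg_subset:
  fixes x y :: "real^'n"
  assumes "pos_locint h" "ball x r \<subseteq> ball y R" "0 < r" "0 < R"
  shows "avg h x r \<le> (R / r) ^ CARD('n) * avg h y R"
  using mass_mono[OF assms(1,2)] vol_scale[of r R y x] assms vol_pos[of r x]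
  by (simp add: avg_def field_simps del: vol_pos)

text \<open>The volume factors recombine because a + b = 1, so Hoelder's inequality holds for
  averages with constant 1.\<close>

lemma wmeas_powr_Holder:
  assumes f: "pos_locint f" and g: "pos_locint g" and ab: "0 \<le> a" "0 \<le> b" "a + b = 1" and r: "0 < r"
  shows "wmeas (\<lambda>x. f x powr a * g x powr b) (ball x r) \<le> ennreal (avg f x r powr a * avg g x r powr b *
      vol x r)"
proof -
  have [measurable]: "f \<in> borel_measurable lebesgue" "g \<in> borel_measurable lebesgue"
    using f g by (auto simp: pos_locintD)
  let ?i = "indicator (ball x r) :: _ \<Rightarrow> real"
  have E: "ennreal (h y) * indicator (ball x r) y = ennreal (h y * ?i y)" for h y
    by (auto simp: indicator_def)
  have fb: "wmeas f (ball x r) = ennreal (mass f x r)" "wmeas g (ball x r) = ennreal (mass g x r)"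
    using f g by (auto simp: pos_locintD(4))
  have "wmeas (\<lambda>x. f x powr a * g x powr b) (ball x r)
      = (\<integral>\<^sup>+y. ennreal ((f y * ?i y) powr a * (g y * ?i y) powr b) \<partial>lebesgue)"
    unfolding wmeas_def by (intro nn_integral_cong) (auto simp: indicator_def)
  also have "\<dots> \<le> ennreal (mass f x r powr a * mass g x r powr b)"
    using fb pos_locint_nonneg[OF f] pos_locint_nonneg[OF g] mass_pos[OF f r] mass_pos[OF g r] ab
    by (intro nn_integral_Holder_le borel_measurable_times borel_measurable_indicator) (auto simp: wmeas_def E)
  also have "mass f x r powr a * mass g x r powr b = avg f x r powr a * avg g x r powr b * vol x r"
    using mass_pos[OF f r, of x] mass_pos[OF g r, of x] avg_pos[OF f r, of x] avg_pos[OF g r, of x]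
        vol_pos[OF r, of x] ab
    by (simp add: mass_avg[OF r] powr_mult powr_add[symmetric] mult_ac less_imp_le del: vol_pos)
  finally show ?thesis .
qed

lemma pos_locint_powr_mult:
  assumes f: "pos_locint f" and g: "pos_locint g" and ab: "0 \<le> a" "0 \<le> b" "a + b = 1"
  shows "pos_locint (\<lambda>x. f x powr a * g x powr b)"
  using wmeas_powr_Holder[OF assms] pos_locintD(1)[OF f] pos_locintD(1)[OF g] pos_locintD(2)[OF f]
      pos_locintD(2)[OF g]
  by (intro pos_locintI) (auto simp: less_le intro!: mult_pos_pos)

lemma avg_powr_Holder:
  assumes f: "pos_locint f" and g: "pos_locint g" and ab: "0 \<le> a" "0 \<le> b" "a + b = 1" and r: "0 < r"
  shows "avg (\<lambda>x. f x powr a * g x powr b) x r \<le> avg f x r powr a * avg g x r powr b"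
  by (rule avg_le[OF wmeas_powr_Holder[OF assms]]) (use r in auto)

lemma pos_locint_one: "pos_locint (\<lambda>_. 1)"
  by (rule pos_locintI) (auto simp: wmeas_def emeasure_ball_vol intro!: exI[of _ "vol _ _"])

lemma avg_one: "0 < r \<Longrightarrow> avg (\<lambda>_. 1) x r = 1"
  using vol_pos[of r x] by (simp add: avg_def mass_def wmeas_def emeasure_ball_vol del: vol_pos)

lemma pos_locint_powr_le:
  assumes "pos_locint f" "0 \<le> a" "a \<le> 1"
  shows "pos_locint (\<lambda>x. f x powr a)"
  using pos_locint_powr_mult[OF assms(1) pos_locint_one, of a "1 - a"] assms by simp

lemma avg_powr_le:
  assumes "pos_locint f" "0 \<le> a" "a \<le> 1" "0 < r"
  shows "avg (\<lambda>x. f x powr a) x r \<le> avg f x r powr a"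
  using avg_powr_Holder[OF assms(1) pos_locint_one, of a "1 - a" r x] assms by (simp add: avg_one)

text \<open>The constant may depend on the ball, as it does when a negative power of an A_1 weight
  is bounded through its average.\<close>

lemma pos_locint_cong_bound:
  assumes g: "pos_locint g" and f: "f \<in> borel_measurable lebesgue" "\<And>x. 0 < f x"
    and le: "\<And>x r. 0 < r \<Longrightarrow> \<exists>c\<ge>0. AE y in lebesgue. y \<in> ball x r \<longrightarrow> f y \<le> c * g y"
  shows "pos_locint f"
proof (rule pos_locintI[OF f])
  fix x :: "real^'a" and r :: real assume "0 < r"
  from le[OF this] obtain c where "0 \<le> c" "AE y in lebesgue. y \<in> ball x r \<longrightarrow> f y \<le> c * g y" by blast
  then have "wmeas f (ball x r) \<le> ennreal c * wmeas g (ball x r)"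
    by (intro wmeas_mono_AE) (use g in \<open>auto simp: pos_locintD pos_locint_nonneg\<close>)
  also have "\<dots> = ennreal (c * mass g x r)" using \<open>0 \<le> c\<close> by (simp add: pos_locintD[OF g] ennreal_mult)
  finally show "\<exists>A. wmeas f (ball x r) \<le> ennreal A" by blast
qed

lemma avg_mono_AE:
  assumes g: "pos_locint g"
    and le: "AE y in lebesgue. y \<in> ball x r \<longrightarrow> f y \<le> c * g y" and c: "0 \<le> c" and r: "0 < r"
  shows "avg f x r \<le> c * avg g x r"
proof (rule avg_le[OF _ _ r])
  have "wmeas f (ball x r) \<le> ennreal c * wmeas g (ball x r)"
    by (intro wmeas_mono_AE le c) (use g in \<open>auto simp: pos_locintD pos_locint_nonneg\<close>)
  then show "wmeas f (ball x r) \<le> ennreal (c * avg g x r * vol x r)"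
    using c by (simp add: pos_locintD[OF g] mass_avg[OF r] mult.assoc flip: ennreal_mult')
qed (use c avg_pos[OF g r, of x] in auto)

section \<open>The maximal operator of a doubling measure\<close>

text \<open>The dilation by 5 is the one of the Vitali covering lemma.\<close>

definition doubling :: "'a::euclidean_space measure \<Rightarrow> real \<Rightarrow> bool" where
  "doubling M D \<longleftrightarrow> sets M = sets lebesgue \<and> 0 < D \<and>
    (\<forall>x r. 0 < r \<longrightarrow> 0 < emeasure M (ball x r) \<and> emeasure M (ball x r) < top \<and>
       emeasure M (ball x (5 * r)) \<le> ennreal D * emeasure M (ball x r))"

definition measure_avg :: "'a::euclidean_space measure \<Rightarrow> ('a \<Rightarrow> ennreal) \<Rightarrow> 'a \<Rightarrow> real \<Rightarrow> ennreal" where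
  "measure_avg M f y r = (\<integral>\<^sup>+z\<in>ball y r. f z \<partial>M) / emeasure M (ball y r)"

text \<open>The uncentered maximal function: its superlevel sets are unions of balls, hence open,
  for every M and f.\<close>

definition maxop :: "'a::euclidean_space measure \<Rightarrow> ('a \<Rightarrow> ennreal) \<Rightarrow> 'a \<Rightarrow> ennreal" where
  "maxop M f x = (SUP (y, r) \<in> {(y, r). 0 < r \<and> x \<in> ball y r}. measure_avg M f y r)"

lemma doublingD:
  assumes "doubling M D"
  shows "sets M = sets lebesgue" "0 < D" "0 < r \<Longrightarrow> 0 < emeasure M (ball x r)"
    "0 < r \<Longrightarrow> emeasure M (ball x r) < top"
    "0 < r \<Longrightarrow> emeasure M (ball x (5 * r)) \<le> ennreal D * emeasure M (ball x r)"
  using assms by (auto simp: doubling_def)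

lemma measure_avg_le_maxop: "0 < r \<Longrightarrow> x \<in> ball y r \<Longrightarrow> measure_avg M f y r \<le> maxop M f x"
  unfolding maxop_def by (rule SUP_upper2[of "(y, r)"]) auto

lemma maxop_least: "(\<And>y r. 0 < r \<Longrightarrow> x \<in> ball y r \<Longrightarrow> measure_avg M f y r \<le> c) \<Longrightarrow> maxop M f x \<le> c"
  unfolding maxop_def by (rule SUP_least) auto

lemma maxop_superlevel:
  "{x. t < maxop M f x} = (\<Union>(y, r) \<in> {(y, r). 0 < r \<and> t < measure_avg M f y r}. ball y r)"
proof (rule set_eqI)
  fix x
  have "t < maxop M f x \<longleftrightarrow> (\<exists>i\<in>{(y, r). 0 < r \<and> x \<in> ball y r}. t < (case i of (y, r) \<Rightarrow> measure_avg M f y r))"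
    unfolding maxop_def less_SUP_iff ..
  also have "\<dots> \<longleftrightarrow> (\<exists>i\<in>{(y, r). 0 < r \<and> t < measure_avg M f y r}. x \<in> (case i of (y, r) \<Rightarrow> ball y r))"
    unfolding Bex_def split_paired_Ex mem_Collect_eq prod.case by blast
  finally show "x \<in> {x. t < maxop M f x} \<longleftrightarrow> x \<in> (\<Union>(y, r) \<in> {(y, r). 0 < r \<and> t < measure_avg M f y r}. ball y r)"
    unfolding UN_iff mem_Collect_eq .
qed

lemma open_maxop_superlevel: "open {x. t < maxop M f x}"
  unfolding maxop_superlevel by auto

lemma maxop_measurable: "sets M = sets lebesgue \<Longrightarrow> maxop N f \<in> borel_measurable M"
proof (rule borel_measurableI_greater)
  fix t assume "sets M = sets (lebesgue :: 'a measure)"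
  then have "space M = UNIV" using sets_eq_imp_space_eq[of M lebesgue] by simp
  moreover have "{x. t < maxop N f x} \<in> sets M"
    using borel_open[OF open_maxop_superlevel[of t N f]] \<open>sets M = _\<close> by (metis sets_completionI_sets
        sets_lborel)
  ultimately show "{x \<in> space M. t < maxop N f x} \<in> sets M" by simp
qed

text \<open>By Vitali, disjoint balls on which the average exceeds t have dilates that cover the
  superlevel set. The covering lemma requires bounded radii, so \<open>K n\<close> caps them at n;
  continuity of the measure from below removes the cap.\<close>

lemma maxop_weak_type:
  assumes M: "doubling M D" and [measurable]: "f \<in> borel_measurable M"
  shows "t * emeasure M {x. t < maxop M f x} \<le> ennreal D * (\<integral>\<^sup>+x. f x \<partial>M)"
proof -
  define K where "K n = {(y, r). 0 < r \<and> r \<le> real n \<and> t < measure_avg M f y r}" for n :: nat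
  define S where "S n = (\<Union>(y, r) \<in> K n. ball y r)" for n
  have sets_ball [measurable]: "ball y r \<in> sets M" for y r
    using doublingD(1)[OF M] by simp
  have [measurable]: "S n \<in> sets M" for n
  proof -
    have "open (S n)" by (auto simp: S_def)
    then show ?thesis using doublingD(1)[OF M] by (metis borel_open sets_completionI_sets sets_lborel)
  qed
  have bound: "t * emeasure M (S n) \<le> ennreal D * (\<integral>\<^sup>+x. f x \<partial>M)" for n
  proof -
    have K: "\<And>i. i \<in> K n \<Longrightarrow> 0 < snd i \<and> snd i \<le> real n" by (auto simp: K_def)
    have "S n \<subseteq> (\<Union>i\<in>K n. ball (fst i) (snd i))" by (auto simp: S_def)
    from Vitali_covering_lemma_balls[OF this K] obtain C where C: "countable C" "C \<subseteq> K n"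
      "pairwise (\<lambda>i j. disjnt (ball (fst i) (snd i)) (ball (fst j) (snd j))) C"
      "S n \<subseteq> (\<Union>i\<in>C. ball (fst i) (5 * snd i))" by blast
    let ?B = "\<lambda>i. ball (fst i) (snd i)"
    have disj: "disjoint_family_on ?B C"
      using C(3) by (auto simp: disjoint_family_on_def pairwise_def disjnt_def)
    have "emeasure M (S n) \<le> emeasure M (\<Union>i\<in>C. ball (fst i) (5 * snd i))"
      using C(1,4) by (intro emeasure_mono sets.countable_UN') auto
    also have "\<dots> = (\<integral>\<^sup>+x. indicator (\<Union>i\<in>C. ball (fst i) (5 * snd i)) x \<partial>M)"
      using C(1) by (intro nn_integral_indicator[symmetric] sets.countable_UN') auto
    also have "\<dots> \<le> (\<integral>\<^sup>+x. (\<integral>\<^sup>+i. indicator (ball (fst i) (5 * snd i)) x \<partial>count_space C) \<partial>M)"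
    proof (rule nn_integral_mono)
      fix x
      show "indicator (\<Union>i\<in>C. ball (fst i) (5 * snd i)) x
          \<le> (\<integral>\<^sup>+i. indicator (ball (fst i) (5 * snd i)) x \<partial>count_space C)"
      proof (cases "x \<in> (\<Union>i\<in>C. ball (fst i) (5 * snd i))")
        case True
        then obtain i where i: "i \<in> C" "x \<in> ball (fst i) (5 * snd i)" by blast
        have "indicator (\<Union>i\<in>C. ball (fst i) (5 * snd i)) x \<le> (1 :: ennreal)"
          by (simp add: indicator_def)
        also have "1 = indicator (ball (fst i) (5 * snd i)) x" using i by (simp only: indicator_simps)
        also have "\<dots> \<le> (\<integral>\<^sup>+i. indicator (ball (fst i) (5 * snd i)) x \<partial>count_space C)"
          by (rule nn_integral_ge_point[OF i(1)])
        finally show ?thesis .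
      qed simp
    qed
    also have "\<dots> = (\<integral>\<^sup>+i. (\<integral>\<^sup>+x. indicator (ball (fst i) (5 * snd i)) x \<partial>M) \<partial>count_space C)"
      using C(1) by (intro nn_integral_count_space_nn_integral) auto
    also have "\<dots> = (\<integral>\<^sup>+i. emeasure M (ball (fst i) (5 * snd i)) \<partial>count_space C)"
      by (intro nn_integral_cong nn_integral_indicator) auto
    also have "\<dots> \<le> (\<integral>\<^sup>+i. ennreal D * emeasure M (?B i) \<partial>count_space C)"
      using C(2) K by (intro nn_integral_mono doublingD(5)[OF M]) auto
    also have "\<dots> = ennreal D * (\<integral>\<^sup>+i. emeasure M (?B i) \<partial>count_space C)"
      by (rule nn_integral_cmult) auto
    finally have "t * emeasure M (S n) \<le> t * (ennreal D * (\<integral>\<^sup>+i. emeasure M (?B i) \<partial>count_space C))"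
      by (rule mult_left_mono) simp
    also have "\<dots> = ennreal D * (\<integral>\<^sup>+i. t * emeasure M (?B i) \<partial>count_space C)"
      by (subst nn_integral_cmult) (auto simp: mult_ac)
    also have "\<dots> \<le> ennreal D * (\<integral>\<^sup>+i. emeasure (density M f) (?B i) \<partial>count_space C)"
    proof (intro mult_left_mono nn_integral_mono)
      fix i assume "i \<in> space (count_space C)"
      with C(2) have i: "0 < snd i" "t < measure_avg M f (fst i) (snd i)" by (auto simp: K_def)
      have "t * emeasure M (?B i) \<le> measure_avg M f (fst i) (snd i) * emeasure M (?B i)"
        using i by (intro mult_right_mono) auto
      also have "\<dots> = (\<integral>\<^sup>+z\<in>?B i. f z \<partial>M)"
        using doublingD(3,4)[OF M i(1), of "fst i"] by (simp add: measure_avg_def ennreal_divide_times)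
      also have "\<dots> = emeasure (density M f) (?B i)" by (simp add: emeasure_density)
      finally show "t * emeasure M (?B i) \<le> emeasure (density M f) (?B i)" .
    qed simp
    also have "\<dots> = ennreal D * emeasure (density M f) (\<Union>i\<in>C. ?B i)"
      using C(1) disj by (subst emeasure_UN_countable) auto
    also have "\<dots> \<le> ennreal D * (\<integral>\<^sup>+x. f x \<partial>M)"
    proof (rule mult_left_mono)
      have "emeasure (density M f) (\<Union>i\<in>C. ?B i) \<le> emeasure (density M f) (space M)"
        using emeasure_space[of "density M f" "\<Union>i\<in>C. ?B i"] by (simp only: space_density)
      then show "emeasure (density M f) (\<Union>i\<in>C. ?B i) \<le> (\<integral>\<^sup>+x. f x \<partial>M)"
        by (simp add: emeasure_density)
    qed simp
    finally show ?thesis .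
  qed
  have "{x. t < maxop M f x} = (\<Union>n. S n)"
  proof -
    have "{(y, r). 0 < r \<and> t < measure_avg M f y r} = (\<Union>n. K n)"
      using real_arch_simple by (auto simp: K_def)
    then show ?thesis unfolding maxop_superlevel S_def by blast
  qed
  moreover have "incseq S"
  proof (rule incseq_SucI)
    fix n
    have "K n \<subseteq> K (Suc n)" by (auto simp: K_def)
    then show "S n \<subseteq> S (Suc n)" unfolding S_def by blast
  qed
  ultimately have "emeasure M {x. t < maxop M f x} = (SUP n. emeasure M (S n))"
    by (simp add: SUP_emeasure_incseq image_subset_iff)
  then show ?thesis
    using bound by (auto simp: SUP_mult_left_ennreal intro!: SUP_least)
qed

text \<open>The part of f below height t contributes at most t to any average, so a maximal function
  above 2t forces that of the remaining part above t. This localisation to large values of f is what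
  lets the sum over levels converge.\<close>

lemma maxop_weak_type_truncated:
  assumes M: "doubling M D" and f [measurable]: "f \<in> borel_measurable M"
  shows "t * emeasure M {x. 2 * t < maxop M f x} \<le> ennreal D * (\<integral>\<^sup>+x. f x * indicator {x. t < f x} x \<partial>M)"
proof -
  let ?g = "\<lambda>x. f x * indicator {x. t < f x} x"
  have spM: "space M = UNIV" using sets_eq_imp_space_eq[OF doublingD(1)[OF M]] by simp
  have [measurable]: "?g \<in> borel_measurable M"
    using spM by (intro borel_measurable_times_ennreal f borel_measurable_indicator)
      (use borel_measurable_less[of "\<lambda>_. t" M f] in auto)
  have sets_ball [measurable]: "ball y r \<in> sets M" for y r
    using doublingD(1)[OF M] by simp
  have "measure_avg M f y r \<le> t + measure_avg M ?g y r" if r: "0 < r" for y r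
  proof -
    have "(\<integral>\<^sup>+z\<in>ball y r. f z \<partial>M) \<le> (\<integral>\<^sup>+z. t * indicator (ball y r) z + ?g z * indicator (ball y r) z \<partial>M)"
      by (intro nn_integral_mono) (auto simp: indicator_def)
    also have "\<dots> = t * emeasure M (ball y r) + (\<integral>\<^sup>+z\<in>ball y r. ?g z \<partial>M)"
      by (subst nn_integral_add) (auto simp: nn_integral_cmult_indicator)
    finally have "measure_avg M f y r \<le> (t * emeasure M (ball y r) + (\<integral>\<^sup>+z\<in>ball y r. ?g z \<partial>M)) /
        emeasure M (ball y r)"
      unfolding measure_avg_def by (rule divide_right_mono_ennreal)
    also have "\<dots> = t + measure_avg M ?g y r"
      using doublingD(3,4)[OF M r, of y] by (simp add: measure_avg_def add_divide_distrib_ennreal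
          ennreal_mult_divide_eq)
    finally show ?thesis .
  qed
  then have "maxop M f x \<le> t + maxop M ?g x" for x
    by (intro maxop_least) (meson add_left_mono measure_avg_le_maxop order_trans)
  then have "{x. 2 * t < maxop M f x} \<subseteq> {x. t < maxop M ?g x}"
    by (auto simp: mult_2) (metis (no_types, lifting) ennreal_add_left_cancel_less order_less_le_trans)
  moreover have "{x. t < maxop M ?g x} \<in> sets M"
    using borel_measurable_less[of "\<lambda>_. t" M "maxop M ?g"] maxop_measurable[OF doublingD(1)[OF M]] spM by auto
  ultimately have "t * emeasure M {x. 2 * t < maxop M f x} \<le> t * emeasure M {x. t < maxop M ?g x}"
    by (intro mult_left_mono emeasure_mono) auto
  also have "\<dots> \<le> ennreal D * (\<integral>\<^sup>+x. ?g x \<partial>M)"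
    by (rule maxop_weak_type[OF M]) simp
  finally show ?thesis .
qed

section \<open>Dyadic levels and the strong type inequality\<close>

text \<open>A discrete substitute for the layer cake formula. For finite y the index m with 2 a 2^m
  < y \<le> 4 a 2^m gives a single sufficient term; for y = \<open>top\<close> every term occurs and
  the terms are unbounded.\<close>

lemma dyadic_lower:
  assumes a: "0 < a" and p: "0 < p"
  shows "epowr y p * indicator {y. ennreal (2 * a) < y} y
    \<le> (\<Sum>i. ennreal ((4 * (a * 2 ^ i)) powr p) * indicator {y. ennreal (2 * (a * 2 ^ i)) < y} y)"
    (is "_ \<le> ?S")
proof (cases "ennreal (2 * a) < y")
  case True
  have term_le: "ennreal ((4 * (a * 2 ^ i)) powr p) \<le> ?S" if "ennreal (2 * (a * 2 ^ i)) < y" for i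
    using that ennreal_suminf_lessD[of _ _ i] sum_le_suminf[of "\<lambda>i. ennreal ((4 * (a * 2 ^ i)) powr p) *
        indicator {y. ennreal (2 * (a * 2 ^ i)) < y} y" "{i}"]
    by auto
  show ?thesis
  proof (cases y)
    case top
    have "\<exists>i. x \<le> (4 * (a * 2 ^ i)) powr p" for x :: real
    proof -
      obtain i where i: "max x 1 powr (1 / p) / a < 2 ^ i" using real_arch_pow[of 2] by auto
      then have "max x 1 powr (1 / p) < a * 2 ^ i" using a by (simp add: field_simps)
      moreover have "0 < a * 2 ^ i" using a by simp
      ultimately have "max x 1 powr (1 / p) \<le> 4 * (a * 2 ^ i)" by linarith
      then have "(max x 1 powr (1 / p)) powr p \<le> (4 * (a * 2 ^ i)) powr p" using p by (intro powr_mono2) auto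
      then have "max x 1 \<le> (4 * (a * 2 ^ i)) powr p" using p by (simp add: powr_powr)
      then show ?thesis by auto
    qed
    then have "ennreal x \<le> ?S" for x
      using term_le top by (meson ennreal_leI ennreal_less_top order_trans)
    then have "?S = top"
    proof (cases ?S)
      case (real s)
      with \<open>\<And>x. ennreal x \<le> ?S\<close>[of "s + 1"] show ?thesis by simp
    qed simp
    then show ?thesis by simp
  next
    case (real x)
    define n where "n = (LEAST n. x \<le> 2 * (a * 2 ^ n))"
    obtain i where "x / (2 * a) < 2 ^ i" using real_arch_pow[of 2] by auto
    then have "x \<le> 2 * (a * 2 ^ i)" using a by (simp add: field_simps)
    then have n: "x \<le> 2 * (a * 2 ^ n)" unfolding n_def by (rule LeastI)
    have "n \<noteq> 0"
    proof
      assume "n = 0"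
      then show False using n True real a by (simp add: ennreal_less_iff)
    qed
    then obtain m where m: "n = Suc m" by (cases n) auto
    then have "2 * (a * 2 ^ m) < x" using not_less_Least[of m "\<lambda>n. x \<le> 2 * (a * 2 ^ n)"] by (auto simp: n_def)
    then have "ennreal ((4 * (a * 2 ^ m)) powr p) \<le> ?S" using real a by (intro term_le) (auto simp:
        ennreal_less_iff)
    moreover have "x powr p \<le> (4 * (a * 2 ^ m)) powr p" using n m real p a by (intro powr_mono2) auto
    ultimately have "ennreal (x powr p) \<le> ?S" by (meson ennreal_leI order_trans)
    then show ?thesis using real by (simp add: epowr_ennreal indicator_def)
  qed
qed simp

text \<open>The powers of the levels below y form a geometric progression, so their sum is at most a
  multiple of the last one, which is at most y^p.\<close>

lemma dyadic_upper:
  assumes a: "0 < a" and p: "0 < p"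
  shows "(\<Sum>i. ennreal ((a * 2 ^ i) powr p) * indicator {y. ennreal (a * 2 ^ i) < y} y)
     \<le> ennreal (2 powr p / (2 powr p - 1)) * epowr y p"
proof (rule suminf_le_const)
  fix N
  have pp: "1 < 2 powr p" using p by (simp add: gr_one_powr)
  show "(\<Sum>i<N. ennreal ((a * 2 ^ i) powr p) * indicator {y. ennreal (a * 2 ^ i) < y} y)
      \<le> ennreal (2 powr p / (2 powr p - 1)) * epowr y p"
  proof (cases y)
    case top
    then show ?thesis using pp by (simp add: ennreal_mult_top ennreal_eq_0_iff divide_le_0_iff)
  next
    case (real x)
    show ?thesis
    proof (induction N)
      case (Suc N)
      show ?case
      proof (cases "a * 2 ^ N < x")
        case False
        then show ?thesis using Suc real a by (auto simp: indicator_def ennreal_less_iff)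
      next
        case True
        have power_weight: "(a * 2 ^ i) powr p = a powr p * (2 powr p) ^ i" for i
        proof -
          have "(2 ^ i :: real) powr p = (2 powr real i) powr p" by (simp only: powr_realpow zero_less_numeral)
          also have "\<dots> = (2 powr p) powr real i" by (simp only: powr_powr mult.commute)
          also have "\<dots> = (2 powr p) ^ i" by (rule powr_realpow) simp
          finally show ?thesis using a by (simp add: powr_mult)
        qed
        have "(\<Sum>i<Suc N. ennreal ((a * 2 ^ i) powr p) * indicator {y. ennreal (a * 2 ^ i) < y} y)
           \<le> (\<Sum>i<Suc N. ennreal ((a * 2 ^ i) powr p))"
          by (intro sum_mono) (auto simp: indicator_def)
        also have "\<dots> = ennreal (\<Sum>i<Suc N. (a * 2 ^ i) powr p)" by (subst sum_ennreal) auto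
        also have "(\<Sum>i<Suc N. (a * 2 ^ i) powr p) = a powr p * (\<Sum>i<Suc N. (2 powr p) ^ i)"
          by (simp only: power_weight sum_distrib_left)
        also have "(\<Sum>i<Suc N. (2 powr p) ^ i) = ((2 powr p) ^ Suc N - 1) / (2 powr p - 1)"
          using pp by (intro geometric_sum) auto
        also have "a powr p * \<dots> \<le> 2 powr p / (2 powr p - 1) * (a powr p * (2 powr p) ^ N)"
        proof -
          have "((2 powr p) ^ Suc N - 1) / (2 powr p - 1) \<le> (2 powr p * (2 powr p) ^ N) / (2 powr p - 1)"
            using pp by (intro divide_right_mono) auto
          then have "a powr p * (((2 powr p) ^ Suc N - 1) / (2 powr p - 1))
              \<le> a powr p * ((2 powr p * (2 powr p) ^ N) / (2 powr p - 1))"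
            by (rule mult_left_mono) simp
          also have "\<dots> = 2 powr p / (2 powr p - 1) * (a powr p * (2 powr p) ^ N)" by (simp add: ac_simps)
          finally show ?thesis .
        qed
        also have "\<dots> \<le> 2 powr p / (2 powr p - 1) * x powr p"
        proof (rule mult_left_mono)
          show "a powr p * (2 powr p) ^ N \<le> x powr p"
            unfolding power_weight[symmetric] using True a p by (intro powr_mono2) auto
          show "0 \<le> 2 powr p / (2 powr p - 1)"
            by (rule divide_nonneg_pos) (use pp in linarith)+
        qed
        finally show ?thesis using pp real
          by (simp add: epowr_ennreal ennreal_leI flip: ennreal_mult')
      qed
    qed simp
  qed
qed simp

text \<open>The factor 4^p comes from the dyadic levels, D from the weak type inequality, and the
  quotient from a geometric series with exponent p - 1; the latter is where p > 1 enters.\<close>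

definition maxop_const :: "real \<Rightarrow> real \<Rightarrow> real" where
  "maxop_const D p = 4 powr p * D * (2 powr (p - 1) / (2 powr (p - 1) - 1))"

lemma maxop_const_nonneg: "0 < D \<Longrightarrow> 1 < p \<Longrightarrow> 0 \<le> maxop_const D p"
  using gr_one_powr[of 2 "p - 1"] unfolding maxop_const_def
  by (intro mult_nonneg_nonneg divide_nonneg_pos) (simp, linarith, simp, linarith)

text \<open>Marcinkiewicz interpolation between weak type (1,1) and the trivial bound on
  L^\<infinity>, carried out on dyadic levels above 2a. The estimate is uniform in a, so a = 2^-n
  and monotone convergence reach all levels.\<close>

theorem maxop_strong_type:
  assumes M: "doubling M D" and f [measurable]: "f \<in> borel_measurable M" and p: "1 < p"
  shows "(\<integral>\<^sup>+x. epowr (maxop M f x) p \<partial>M) \<le> ennreal (maxop_const D p) * (\<integral>\<^sup>+x. epowr (f x) p \<partial>M)"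
proof -
  let ?C = "2 powr (p - 1) / (2 powr (p - 1) - 1)"
  have spM: "space M = UNIV" using sets_eq_imp_space_eq[OF doublingD(1)[OF M]] by simp
  have [measurable]: "maxop M f \<in> borel_measurable M"
    by (rule maxop_measurable[OF doublingD(1)[OF M]])
  have [measurable]: "{x. t < g x} \<in> sets M" if "g \<in> borel_measurable M" for t and g :: "'a \<Rightarrow> ennreal"
    using borel_measurable_less[OF _ that, of "\<lambda>_. t"] spM by simp
  have bound: "(\<integral>\<^sup>+x. epowr (maxop M f x) p * indicator {y. ennreal (2 * a) < y} (maxop M f x) \<partial>M)
      \<le> ennreal (maxop_const D p) * (\<integral>\<^sup>+x. epowr (f x) p \<partial>M)" if a: "0 < a" for a
  proof -
    define t where "t i = a * 2 ^ i" for i :: nat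
    have t: "0 < t i" for i using a by (simp add: t_def)
    have "(\<integral>\<^sup>+x. epowr (maxop M f x) p * indicator {y. ennreal (2 * a) < y} (maxop M f x) \<partial>M)
        \<le> (\<integral>\<^sup>+x. (\<Sum>i. ennreal ((4 * t i) powr p) * indicator {x. ennreal (2 * t i) < maxop M f x} x) \<partial>M)"
      using dyadic_lower[OF a, of p "maxop M f _"] p
      by (intro nn_integral_mono) (simp add: t_def indicator_def)
    also have "\<dots> = (\<Sum>i. ennreal ((4 * t i) powr p) * emeasure M {x. ennreal (2 * t i) < maxop M f x})"
      by (subst nn_integral_suminf) (auto simp: nn_integral_cmult_indicator)
    also have "\<dots> \<le> (\<Sum>i. ennreal (4 powr p * D) * (\<integral>\<^sup>+x. ennreal (t i powr (p - 1)) * (f x * indicator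
        {x. ennreal (t i) < f x} x) \<partial>M))"
    proof (intro suminf_le)
      fix i
      have "(4 * t i) powr p = 4 powr p * t i powr (p - 1) * t i"
        using t[of i] by (simp add: powr_mult powr_diff)
      then have "ennreal ((4 * t i) powr p) * emeasure M {x. ennreal (2 * t i) < maxop M f x}
        = ennreal (4 powr p * t i powr (p - 1)) * (ennreal (t i) * emeasure M {x. 2 * ennreal (t i) <
            maxop M f x})"
        using t[of i] by (simp add: ennreal_mult mult.assoc)
      also have "\<dots> \<le> ennreal (4 powr p * t i powr (p - 1)) * (ennreal D * (\<integral>\<^sup>+x. f x * indicator {x.
          ennreal (t i) < f x} x \<partial>M))"
        by (intro mult_left_mono maxop_weak_type_truncated[OF M]) auto
      also have "\<dots> = ennreal (4 powr p * D) * (\<integral>\<^sup>+x. ennreal (t i powr (p - 1)) * (f x * indicator {x.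
          ennreal (t i) < f x} x) \<partial>M)"
        using doublingD(2)[OF M] by (subst nn_integral_cmult) (auto simp: ennreal_mult mult_ac)
      finally show "ennreal ((4 * t i) powr p) * emeasure M {x. ennreal (2 * t i) < maxop M f x} \<le> \<dots>" .
    qed auto
    also have "\<dots> = ennreal (4 powr p * D) * (\<integral>\<^sup>+x. (\<Sum>i. ennreal (t i powr (p - 1)) * (f x * indicator
        {x. ennreal (t i) < f x} x)) \<partial>M)"
      by (subst nn_integral_suminf) (auto simp: ennreal_suminf_cmult)
    also have "\<dots> \<le> ennreal (4 powr p * D) * (\<integral>\<^sup>+x. ennreal ?C * epowr (f x) p \<partial>M)"
    proof (intro mult_left_mono nn_integral_mono)
      fix x
      have "(\<Sum>i. ennreal (t i powr (p - 1)) * (f x * indicator {x. ennreal (t i) < f x} x))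
          = (\<Sum>i. f x * (ennreal (t i powr (p - 1)) * indicator {y. ennreal (t i) < y} (f x)))"
        by (intro arg_cong[where f=suminf] ext) (auto simp: indicator_def mult_ac)
      also have "\<dots> = f x * (\<Sum>i. ennreal (t i powr (p - 1)) * indicator {y. ennreal (t i) < y} (f x))"
        by simp
      also have "\<dots> \<le> f x * (ennreal ?C * epowr (f x) (p - 1))"
        using dyadic_upper[OF a, of "p - 1" "f x"] p by (intro mult_left_mono) (auto simp: t_def)
      also have "f x * (ennreal ?C * epowr (f x) (p - 1)) = ennreal ?C * epowr (f x) p"
      proof -
        have "f x * epowr (f x) (p - 1) = epowr (f x) p"
          using p by (cases "f x") (auto simp: epowr_ennreal ennreal_top_mult powr_diff simp flip: ennreal_mult)
        then show ?thesis by (metis mult.left_commute)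
      qed
      finally show "(\<Sum>i. ennreal (t i powr (p - 1)) * (f x * indicator {x. ennreal (t i) < f x} x))
        \<le> ennreal ?C * epowr (f x) p" .
    qed simp
    also have "\<dots> = ennreal (maxop_const D p) * (\<integral>\<^sup>+x. epowr (f x) p \<partial>M)"
    proof -
      have "1 < 2 powr (p - 1)" using p by (intro gr_one_powr) auto
      then have "0 \<le> ?C" by simp
      then show ?thesis using doublingD(2)[OF M]
        by (subst nn_integral_cmult)
          (simp_all add: maxop_const_def ennreal_mult mult.assoc del: times_divide_eq_right
              times_divide_eq_left)
    qed
    finally show ?thesis .
  qed
  define g where "g n x = epowr (maxop M f x) p * indicator {y. ennreal (2 * (1 / 2 ^ n)) < y} (maxop M
      f x)" for n :: nat and x
  have "epowr (maxop M f x) p = (SUP n. g n x)" for x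
  proof (rule antisym)
    show "epowr (maxop M f x) p \<le> (SUP n. g n x)"
    proof (cases "maxop M f x = 0")
      case False
      have "\<exists>n. ennreal (2 * (1 / 2 ^ n)) < maxop M f x"
      proof (cases "maxop M f x")
        case (real y)
        then have "0 < y" using False by (auto simp: less_le)
        then obtain n where "(1/2) ^ n < y / 2" using real_arch_pow_inv[of "y / 2" "1 / 2"] by auto
        then have "2 * (1 / 2 ^ n) < y" by (simp add: field_simps)
        then show ?thesis using real by (auto simp: ennreal_less_iff)
      qed auto
      then obtain n where "ennreal (2 * (1 / 2 ^ n)) < maxop M f x" ..
      then have "epowr (maxop M f x) p = g n x" by (simp add: g_def)
      then show ?thesis by (auto intro: SUP_upper2[of n])
    qed simp
    show "(SUP n. g n x) \<le> epowr (maxop M f x) p"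
      by (intro SUP_least) (auto simp: g_def indicator_def)
  qed
  then have "(\<integral>\<^sup>+x. epowr (maxop M f x) p \<partial>M) = (\<integral>\<^sup>+x. (SUP n. g n x) \<partial>M)" by simp
  also have "\<dots> = (SUP n. \<integral>\<^sup>+x. g n x \<partial>M)"
  proof (rule nn_integral_monotone_convergence_SUP)
    show "incseq g"
    proof (intro incseq_SucI le_funI)
      fix n x
      have "ennreal (2 * (1 / 2 ^ Suc n)) \<le> ennreal (2 * (1 / 2 ^ n))" by (intro ennreal_leI) (simp add:
          field_simps)
      note le = this
      show "g n x \<le> g (Suc n) x"
      proof (cases "ennreal (2 * (1 / 2 ^ n)) < maxop M f x")
        case True
        have "maxop M f x \<in> {y. ennreal (2 * (1 / 2 ^ Suc n)) < y}"
          unfolding mem_Collect_eq by (rule order.strict_trans1[OF le True])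
        then have "g (Suc n) x = epowr (maxop M f x) p" unfolding g_def by (simp only: indicator_simps
            mult_1_right)
        then show ?thesis using True by (simp add: g_def)
      qed (simp add: g_def)
    qed
    show "g n \<in> borel_measurable M" for n
      unfolding g_def by (intro borel_measurable_times_ennreal measurable_compose[OF \<open>maxop M f \<in> _\<close>]) auto
  qed
  also have "\<dots> \<le> ennreal (maxop_const D p) * (\<integral>\<^sup>+x. epowr (f x) p \<partial>M)"
    unfolding g_def by (intro SUP_least bound) simp
  finally show ?thesis .
qed

section \<open>Muckenhoupt weights\<close>

abbreviation dual_weight :: "real \<Rightarrow> (real^'n \<Rightarrow> real) \<Rightarrow> real^'n \<Rightarrow> real" where
  "dual_weight q w \<equiv> \<lambda>x. w x powr (- 1 / (q - 1))"

definition Aq :: "real \<Rightarrow> (real^'n \<Rightarrow> real) \<Rightarrow> real \<Rightarrow> bool" where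
  "Aq q w C \<longleftrightarrow> 1 < q \<and> pos_locint w \<and> pos_locint (dual_weight q w) \<and>
     (\<forall>x r. 0 < r \<longrightarrow> avg w x r * avg (dual_weight q w) x r powr (q - 1) \<le> C)"

definition A1 :: "(real^'n \<Rightarrow> real) \<Rightarrow> real \<Rightarrow> bool" where
  "A1 w C \<longleftrightarrow> pos_locint w \<and> 0 < C \<and>
     (\<forall>x r. 0 < r \<longrightarrow> (AE y in lebesgue. y \<in> ball x r \<longrightarrow> avg w x r \<le> C * w y))"

lemma AqD:
  assumes "Aq q w C"
  shows "1 < q" "pos_locint w" "pos_locint (dual_weight q w)"
    "0 < r \<Longrightarrow> avg w x r * avg (dual_weight q w) x r powr (q - 1) \<le> C"
  using assms by (auto simp: Aq_def)

lemma A1D: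
  assumes "A1 w C"
  shows "pos_locint w" "0 < C" "0 < r \<Longrightarrow> AE y in lebesgue. y \<in> ball x r \<longrightarrow> avg w x r \<le> C * w y"
  using assms by (auto simp: A1_def)

lemma Aq_const_pos:
  assumes "Aq q w C"
  shows "0 < C"
proof -
  have "0 < avg w 0 1 * avg (dual_weight q w) 0 1 powr (q - 1)"
    using avg_pos[OF AqD(2)[OF assms], of 1 0] avg_pos[OF AqD(3)[OF assms], of 1 0] by simp
  also have "\<dots> \<le> C" by (rule AqD(4)[OF assms]) simp
  finally show ?thesis .
qed

text \<open>Hoelder's inequality for 1 = w^(1/q) \<sigma>^(1 - 1/q), where \<sigma> is the dual
  weight.\<close>

lemma avg_dual_weight_ge:
  assumes w: "pos_locint w" "pos_locint (dual_weight q w)" and q: "1 < q" and r: "0 < r"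
  shows "1 \<le> avg w x r * avg (dual_weight q w) x r powr (q - 1)"
proof -
  have *: "w x powr (1 / q) * dual_weight q w x powr (1 - 1 / q) = 1" for x
  proof -
    have "1 / q + - 1 / (q - 1) * (1 - 1 / q) = 0" using q by (simp add: field_simps)
    then show ?thesis using pos_locintD(2)[OF w(1), of x] by (simp add: powr_powr flip: powr_add)
  qed
  let ?s = "avg (dual_weight q w) x r"
  have pos: "0 < avg w x r" "0 < ?s" using avg_pos[OF w(1) r] avg_pos[OF w(2) r] by auto
  have "1 \<le> avg w x r powr (1 / q) * ?s powr (1 - 1 / q)"
    using avg_powr_Holder[OF w, of "1 / q" "1 - 1 / q" r x] q r unfolding * by (simp add: avg_one)
  then have "1 powr q \<le> (avg w x r powr (1 / q) * ?s powr (1 - 1 / q)) powr q"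
    using q by (intro powr_mono2) auto
  also have "\<dots> = avg w x r * ?s powr (q - 1)"
    using pos q by (simp add: powr_mult powr_powr algebra_simps)
  finally show ?thesis by simp
qed

text \<open>On the small ball the A_q product is at least 1. Its dual average is at most (R/r)^n
  times the one on the large ball, where the bound C applies.\<close>

lemma Aq_doubling:
  fixes w :: "real^'n \<Rightarrow> real" and q :: real
  assumes A: "Aq q w C" and sub: "ball x r \<subseteq> ball y R" and r: "0 < r" "0 < R"
  shows "avg w y R \<le> C * (R / r) powr (real CARD('n) * (q - 1)) * avg w x r"
proof -
  note w = AqD(2,3)[OF A] and q = AqD(1)[OF A]
  let ?s = "avg (dual_weight q w)"
  have pos: "0 < ?s x r" "0 < ?s y R" "0 < avg w x r" using avg_pos[OF w(2)] avg_pos[OF w(1)] r by auto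
  have "1 \<le> avg w x r * ?s x r powr (q - 1)" by (rule avg_dual_weight_ge[OF w q r(1)])
  also have "\<dots> \<le> avg w x r * ((R / r) ^ CARD('n) * ?s y R) powr (q - 1)"
    using pos q by (intro mult_left_mono powr_mono2 avg_subset[OF w(2) sub r]) auto
  also have "\<dots> = avg w x r * (R / r) powr (real CARD('n) * (q - 1)) * ?s y R powr (q - 1)"
    using r pos by (simp add: powr_mult powr_powr flip: powr_realpow)
  finally have "avg w y R * 1 \<le> avg w y R * (avg w x r * (R / r) powr (real CARD('n) * (q - 1)) * ?s y R
      powr (q - 1))"
    using avg_pos[OF w(1) r(2), of y] by (intro mult_left_mono) auto
  also have "\<dots> = (avg w y R * ?s y R powr (q - 1)) * ((R / r) powr (real CARD('n) * (q - 1)) * avg w x r)"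
    by (simp only: mult_ac)
  also have "\<dots> \<le> C * ((R / r) powr (real CARD('n) * (q - 1)) * avg w x r)"
    using pos by (intro mult_right_mono AqD(4)[OF A r(2)]) auto
  finally show ?thesis by (simp add: mult.assoc)
qed

lemma Aq_doubling_mass:
  fixes w :: "real^'n \<Rightarrow> real" and q :: real
  assumes A: "Aq q w C" and sub: "ball x r \<subseteq> ball y R" and r: "0 < r" "0 < R"
  shows "mass w y R \<le> C * (R / r) powr (real CARD('n) * q) * mass w x r"
proof -
  have v: "vol y R = (R / r) powr real CARD('n) * vol x r"
    using vol_scale[OF r, of y x] r by (simp add: powr_realpow)
  have "mass w y R \<le> C * (R / r) powr (real CARD('n) * (q - 1)) * avg w x r * vol y R"
    unfolding mass_avg[OF r(2)] by (intro mult_right_mono Aq_doubling[OF A sub r]) (use vol_pos[OF r(2),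
        of y] in simp)
  also have "\<dots> = C * ((R / r) powr (real CARD('n) * (q - 1)) * (R / r) powr real CARD('n)) * (avg w x r
      * vol x r)"
    unfolding v by (simp only: mult_ac)
  also have "(R / r) powr (real CARD('n) * (q - 1)) * (R / r) powr real CARD('n) = (R / r) powr (real
      CARD('n) * q)"
    by (simp add: algebra_simps flip: powr_add)
  finally show ?thesis by (simp add: mass_avg[OF r(1)])
qed

lemma emeasure_density_ball:
  "pos_locint w \<Longrightarrow> emeasure (density lebesgue (\<lambda>x. ennreal (w x))) (ball x r) = ennreal (mass w x r)"
  using pos_locintD(1)[of w] by (subst emeasure_density) (auto simp: wmeas_def simp flip: pos_locintD(4))

lemma Aq_doubling_density:
  fixes w :: "real^'n \<Rightarrow> real" and q :: real
  assumes A: "Aq q w C"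
  shows "doubling (density lebesgue (\<lambda>x. ennreal (w x))) (C * 5 powr (real CARD('n) * q))"
  unfolding doubling_def
proof (intro conjI allI impI)
  note w = AqD(2)[OF A]
  show "0 < C * 5 powr (real CARD('n) * q)" using Aq_const_pos[OF A] by simp
  fix x :: "real^'n" and r :: real assume r: "0 < r"
  have C0: "0 \<le> C * 5 powr (real CARD('n) * q)" using Aq_const_pos[OF A] by simp
  show "emeasure (density lebesgue (\<lambda>x. ennreal (w x))) (ball x (5 * r))
    \<le> ennreal (C * 5 powr (real CARD('n) * q)) * emeasure (density lebesgue (\<lambda>x. ennreal (w x))) (ball x r)"
    using Aq_doubling_mass[OF A, of x r x "5 * r"] r C0
    by (simp add: emeasure_density_ball[OF w] subset_ball ennreal_leI flip: ennreal_mult')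
  show "0 < emeasure (density lebesgue (\<lambda>x. ennreal (w x))) (ball x r)"
    using mass_pos[OF w r] by (simp add: emeasure_density_ball[OF w])
qed (auto simp: emeasure_density_ball[OF AqD(2)[OF A]])

text \<open>The A_q condition raised to the power 1/(q-1), with the two averages exchanged.\<close>

lemma Aq_dual:
  assumes A: "Aq q w C"
  shows "Aq (q / (q - 1)) (dual_weight q w) (C powr (1 / (q - 1)))"
    and "dual_weight (q / (q - 1)) (dual_weight q w) = w"
proof -
  note w = AqD(2,3)[OF A] and q = AqD(1)[OF A]
  have q': "q / (q - 1) - 1 = 1 / (q - 1)" using q by (simp add: field_simps)
  show eq: "dual_weight (q / (q - 1)) (dual_weight q w) = w"
  proof
    fix x
    have "- 1 / (q - 1) * (- 1 / (1 / (q - 1))) = 1" using q by (simp add: field_simps)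
    then show "dual_weight (q / (q - 1)) (dual_weight q w) x = w x"
      unfolding q' powr_powr using pos_locintD(2)[OF w(1), of x] by simp
  qed
  show "Aq (q / (q - 1)) (dual_weight q w) (C powr (1 / (q - 1)))"
    unfolding Aq_def eq unfolding q'
  proof (intro conjI allI impI w)
    show "1 < q / (q - 1)" using q by (simp add: field_simps)
    fix x r assume r: "0 < (r::real)"
    let ?s = "avg (dual_weight q w) x r"
    have pos: "0 < avg w x r" "0 < ?s" using avg_pos[OF w(1) r] avg_pos[OF w(2) r] by auto
    have "(avg w x r * ?s powr (q - 1)) powr (1 / (q - 1)) \<le> C powr (1 / (q - 1))"
      using q pos by (intro powr_mono2 AqD(4)[OF A r]) auto
    then show "?s * avg w x r powr (1 / (q - 1)) \<le> C powr (1 / (q - 1))"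
      using q pos by (simp add: powr_mult powr_powr mult_ac)
  qed
qed

text \<open>Lerner's argument: with \<open>\<sigma> = w powr (-1/(q-1))\<close>, the maximal function of \<open>f\<close> to the power
  \<open>q-1\<close> is pointwise at most a constant times \<open>M\<^sub>w ((M\<^sub>\<sigma> (f/\<sigma>))^(q-1) / w)\<close>, where \<open>M\<^sub>w\<close> and \<open>M\<^sub>\<sigma>\<close>
  are the maximal operators of the doubling measures \<open>w dx\<close> and \<open>\<sigma> dx\<close>.\<close>

theorem Aq_maxop_bounded:
  assumes A: "Aq q w C"
  shows "\<exists>N\<ge>0. \<forall>f \<in> borel_measurable lebesgue.
    (\<integral>\<^sup>+x. epowr (maxop lebesgue f x) q * ennreal (w x) \<partial>lebesgue)
      \<le> ennreal N * (\<integral>\<^sup>+x. epowr (f x) q * ennreal (w x) \<partial>lebesgue)"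
proof -
  note w = AqD(2,3)[OF A] and q = AqD(1)[OF A]
  define s where "s = dual_weight q w"
  define q' where "q' = q / (q - 1)"
  define D where "D = C * 5 powr (real CARD('a) * q)"
  define D' where "D' = C powr (1 / (q - 1)) * 5 powr (real CARD('a) * q')"
  define M where "M = density lebesgue (\<lambda>x. ennreal (w x))"
  define N where "N = density lebesgue (\<lambda>x. ennreal (s x))"
  have M: "doubling M D" unfolding M_def D_def by (rule Aq_doubling_density[OF A])
  have N: "doubling N D'" unfolding N_def D'_def s_def q'_def by (rule Aq_doubling_density[OF Aq_dual(1)[OF A]])
  have C: "0 < C" by (rule Aq_const_pos[OF A])
  have q': "1 < q'" using q by (simp add: q'_def field_simps)
  have s: "pos_locint s" using w(2) by (simp add: s_def)
  have [measurable]: "w \<in> borel_measurable lebesgue" "s \<in> borel_measurable lebesgue"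
    using w s by (auto simp: pos_locintD)
  have w_pos: "0 < w x" and sp: "0 < s x" for x using w s by (auto simp: pos_locintD)
  have sets [simp]: "sets M = sets lebesgue" "sets N = sets lebesgue" by (auto simp: M_def N_def)
  have mb: "borel_measurable M = borel_measurable lebesgue" "borel_measurable N = borel_measurable lebesgue"
    by (auto intro!: measurable_cong_sets)
  have "(\<integral>\<^sup>+x. epowr (maxop lebesgue f x) q * ennreal (w x) \<partial>lebesgue)
      \<le> ennreal (C powr q' * maxop_const D q' * maxop_const D' q) * (\<integral>\<^sup>+x. epowr (f x) q * ennreal (w x)
          \<partial>lebesgue)"
    if [measurable]: "f \<in> borel_measurable lebesgue" for f
  proof -
    define fs where "fs x = f x * ennreal (1 / s x)" for x
    define g where "g = maxop N fs"
    have int_M: "(\<integral>\<^sup>+x. k x \<partial>M) = (\<integral>\<^sup>+x. ennreal (w x) * k x \<partial>lebesgue)"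
      if "k \<in> borel_measurable lebesgue" for k
      unfolding M_def using that by (subst nn_integral_density) auto
    define h where "h x = epowr (g x) (q - 1) * ennreal (1 / w x)" for x
    have [measurable]: "fs \<in> borel_measurable lebesgue" unfolding fs_def by measurable
    have [measurable]: "g \<in> borel_measurable lebesgue" unfolding g_def by (rule maxop_measurable) simp
    have [measurable]: "h \<in> borel_measurable lebesgue" unfolding h_def by measurable
    have [measurable]: "maxop lebesgue f \<in> borel_measurable lebesgue" "maxop M h \<in> borel_measurable lebesgue"
      by (auto intro: maxop_measurable)
    \<comment> \<open>The average of f factors as the \<sigma>-average of f/\<sigma> times the
      Lebesgue average of \<sigma>. The A_q condition trades the power q - 1 of the latter for C
      over the average of w.\<close>
    have ball: "measure_avg lebesgue f y r \<le> epowr (ennreal C * maxop M h x) (1 / (q - 1))"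
      if r: "0 < r" and x: "x \<in> ball y r" for x y r
    proof -
      let ?a = "measure_avg N fs y r"
      have vp: "0 < vol y r" and sr: "0 < mass s y r" and w_r: "0 < mass w y r"
        using r mass_pos[OF s r] mass_pos[OF w(1) r] by auto
      have eN: "emeasure N (ball y r) = ennreal (mass s y r)" unfolding N_def by (rule
          emeasure_density_ball[OF s])
      have eM: "emeasure M (ball y r) = ennreal (mass w y r)" unfolding M_def by (rule
          emeasure_density_ball[OF w(1)])
      have "(\<integral>\<^sup>+z\<in>ball y r. fs z \<partial>N) = (\<integral>\<^sup>+z. ennreal (s z) * (fs z * indicator (ball y r) z) \<partial>lebesgue)"
        unfolding N_def by (subst nn_integral_density) auto
      also have "\<dots> = (\<integral>\<^sup>+z\<in>ball y r. f z \<partial>lebesgue)"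
      proof (rule nn_integral_cong)
        fix z
        have "ennreal (s z) * ennreal (1 / s z) = 1" using sp[of z] by (simp flip: ennreal_mult)
        then show "ennreal (s z) * (fs z * indicator (ball y r) z) = f z * indicator (ball y r) z"
          by (simp add: fs_def mult_ac) (metis mult.commute mult.left_commute mult_1)
      qed
      finally have If: "(\<integral>\<^sup>+z\<in>ball y r. f z \<partial>lebesgue) = ?a * ennreal (mass s y r)"
        using sr by (simp add: measure_avg_def eN ennreal_divide_times ennreal_mult_divide_eq)
      have "measure_avg lebesgue f y r = ?a * ennreal (avg s y r)"
        unfolding measure_avg_def[of lebesgue] If emeasure_ball_vol avg_def
        using sr vp by (simp add: divide_ennreal[symmetric] ennreal_times_divide)
      then have "epowr (measure_avg lebesgue f y r) (q - 1) = epowr ?a (q - 1) * ennreal (avg s y r powr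
          (q - 1))"
        using q avg_pos[OF s r, of y] by (simp add: epowr_mult epowr_ennreal)
      also have "\<dots> \<le> epowr ?a (q - 1) * ennreal (C * (1 / avg w y r))"
        using AqD(4)[OF A r, of y] avg_pos[OF w(1) r, of y]
        by (intro mult_left_mono ennreal_leI) (auto simp: s_def field_simps)
      also have "\<dots> = ennreal C * (epowr ?a (q - 1) * ennreal (1 / avg w y r))"
        using C avg_pos[OF w(1) r, of y] by (subst ennreal_mult) (auto simp: mult_ac)
      also have "\<dots> \<le> ennreal C * measure_avg M h y r"
      proof (rule mult_left_mono)
        \<comment> \<open>On the whole ball \<open>g\<close> is at least the single average
          \<open>?a\<close>, so the Lebesgue integral of a constant is bounded by the w-integral of
          \<open>h\<close>.\<close>
        have "epowr ?a (q - 1) * ennreal (vol y r) = (\<integral>\<^sup>+z. epowr ?a (q - 1) * indicator (ball y r) z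
            \<partial>lebesgue)"
          by (simp add: nn_integral_cmult_indicator emeasure_ball_vol)
        also have "\<dots> \<le> (\<integral>\<^sup>+z. epowr (g z) (q - 1) * indicator (ball y r) z \<partial>lebesgue)"
          using q r by (intro nn_integral_mono) (auto simp: indicator_def g_def intro!: epowr_mono
              measure_avg_le_maxop)
        also have "\<dots> = (\<integral>\<^sup>+z. ennreal (w z) * (h z * indicator (ball y r) z) \<partial>lebesgue)"
        proof (rule nn_integral_cong)
          fix z
          have "ennreal (w z) * ennreal (1 / w z) = 1" using w_pos[of z] by (simp flip: ennreal_mult)
          then show "epowr (g z) (q - 1) * indicator (ball y r) z = ennreal (w z) * (h z * indicator
              (ball y r) z)"
            unfolding h_def by (metis mult.commute mult.left_commute mult_1)
        qed
        also have "\<dots> = (\<integral>\<^sup>+z\<in>ball y r. h z \<partial>M)"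
          unfolding M_def by (subst nn_integral_density) auto
        finally have "epowr ?a (q - 1) * ennreal (vol y r) / ennreal (mass w y r) \<le> measure_avg M h y r"
          unfolding measure_avg_def[of M] eM by (rule divide_right_mono_ennreal)
        moreover have "ennreal (1 / avg w y r) = ennreal (vol y r) / ennreal (mass w y r)"
          using vp w_r by (simp add: divide_ennreal avg_def)
        ultimately show "epowr ?a (q - 1) * ennreal (1 / avg w y r) \<le> measure_avg M h y r"
          by (simp add: ennreal_times_divide)
      qed simp
      also have "\<dots> \<le> ennreal C * maxop M h x"
        by (intro mult_left_mono measure_avg_le_maxop r x) simp
      finally show ?thesis using q by (simp add: epowr_le_iff)
    qed
    have pt: "epowr (maxop lebesgue f x) q \<le> ennreal (C powr q') * epowr (maxop M h x) q'" for x
    proof -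
      have "maxop lebesgue f x \<le> epowr (ennreal C * maxop M h x) (1 / (q - 1))"
        by (rule maxop_least) (rule ball)
      then have "epowr (maxop lebesgue f x) q \<le> epowr (epowr (ennreal C * maxop M h x) (1 / (q - 1))) q"
        using q by (intro epowr_mono) auto
      also have "\<dots> = epowr (ennreal C * maxop M h x) q'" by (simp add: epowr_epowr q'_def)
      also have "\<dots> = ennreal (C powr q') * epowr (maxop M h x) q'"
        using q' C by (simp add: epowr_mult epowr_ennreal)
      finally show ?thesis .
    qed
    have "(\<integral>\<^sup>+x. epowr (maxop lebesgue f x) q * ennreal (w x) \<partial>lebesgue)
        \<le> (\<integral>\<^sup>+x. ennreal (C powr q') * (ennreal (w x) * epowr (maxop M h x) q') \<partial>lebesgue)"
      using mult_right_mono[OF pt] by (intro nn_integral_mono) (simp add: mult_ac)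
    also have "\<dots> = ennreal (C powr q') * (\<integral>\<^sup>+x. epowr (maxop M h x) q' \<partial>M)"
      unfolding M_def[symmetric] by (subst nn_integral_cmult) (auto simp: int_M)
    also have "\<dots> \<le> ennreal (C powr q') * (ennreal (maxop_const D q') * (\<integral>\<^sup>+x. epowr (h x) q' \<partial>M))"
      by (intro mult_left_mono maxop_strong_type[OF M _ q']) (auto simp: mb)
    also have "(\<integral>\<^sup>+x. epowr (h x) q' \<partial>M) = (\<integral>\<^sup>+x. ennreal (w x) * epowr (h x) q' \<partial>lebesgue)"
      unfolding M_def by (subst nn_integral_density) auto
    also have "\<dots> = (\<integral>\<^sup>+x. ennreal (s x) * epowr (g x) q \<partial>lebesgue)"
    proof (rule nn_integral_cong)
      fix x
      \<comment> \<open>The exponents match: w^(1-q') is the dual weight, and h^q' carries g to the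
        power q.\<close>
      have e: "1 + (-1) * q' = - 1 / (q - 1)" "(q - 1) * q' = q" using q by (auto simp: q'_def field_simps)
      have "w x * (1 / w x) powr q' = w x powr 1 * w x powr ((-1) * q')"
        using w_pos[of x] by (simp add: powr_divide powr_minus_divide)
      also have "\<dots> = s x" by (simp only: s_def e(1) flip: powr_add)
      finally have "ennreal (w x) * ennreal ((1 / w x) powr q') = ennreal (s x)"
        using w_pos[of x] by (metis ennreal_mult' less_imp_le)
      moreover have "epowr (h x) q' = epowr (g x) q * ennreal ((1 / w x) powr q')"
        using q' w_pos[of x] by (simp add: h_def epowr_mult epowr_epowr e(2) epowr_ennreal)
      ultimately show "ennreal (w x) * epowr (h x) q' = ennreal (s x) * epowr (g x) q"
        by (metis mult.commute mult.left_commute)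
    qed
    also have "\<dots> = (\<integral>\<^sup>+x. epowr (g x) q \<partial>N)"
      unfolding N_def by (subst nn_integral_density) auto
    also have "ennreal (C powr q') * (ennreal (maxop_const D q') * \<dots>)
        \<le> ennreal (C powr q') * (ennreal (maxop_const D q') * (ennreal (maxop_const D' q) * (\<integral>\<^sup>+x. epowr
            (fs x) q \<partial>N)))"
      unfolding g_def by (intro mult_left_mono maxop_strong_type[OF N _ q]) (auto simp: mb)
    also have "(\<integral>\<^sup>+x. epowr (fs x) q \<partial>N) = (\<integral>\<^sup>+x. ennreal (s x) * epowr (fs x) q \<partial>lebesgue)"
      unfolding N_def by (subst nn_integral_density) auto
    also have "\<dots> = (\<integral>\<^sup>+x. epowr (f x) q * ennreal (w x) \<partial>lebesgue)"
    proof (rule nn_integral_cong)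
      fix x
      have e: "- 1 / (q - 1) * (1 + - q) = 1" using q by (simp add: field_simps)
      have "s x * (1 / s x) powr q = s x powr 1 * s x powr (- q)"
        using sp[of x] by (simp add: powr_divide powr_minus_divide)
      also have "\<dots> = s x powr (1 + - q)" by (simp only: powr_add)
      also have "\<dots> = w x" unfolding s_def using w_pos[of x] by (simp only: powr_powr e) simp
      finally have "ennreal (s x) * ennreal ((1 / s x) powr q) = ennreal (w x)"
        using sp[of x] by (metis ennreal_mult' less_imp_le)
      moreover have "epowr (fs x) q = epowr (f x) q * ennreal ((1 / s x) powr q)"
        using q sp[of x] by (simp add: fs_def epowr_mult epowr_ennreal)
      ultimately show "ennreal (s x) * epowr (fs x) q = epowr (f x) q * ennreal (w x)"
        by (metis mult.commute mult.left_commute)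
    qed
    finally show ?thesis
      using doublingD(2)[OF M] doublingD(2)[OF N] maxop_const_nonneg[of D q'] maxop_const_nonneg[of D' q] q q'
      by (simp add: ennreal_mult mult.assoc)
  qed
  moreover have "0 \<le> C powr q' * maxop_const D q' * maxop_const D' q"
    using doublingD(2)[OF M] doublingD(2)[OF N] maxop_const_nonneg[of D q'] maxop_const_nonneg[of D' q]
        q q' by simp
  ultimately show ?thesis by blast
qed

section \<open>Majorants by the Rubio de Francia algorithm\<close>

lemma suminf_half_powers: "(\<Sum>i. ennreal ((1 / 2) ^ i)) = 2"
  by (subst suminf_ennreal2) (auto simp: suminf_geometric summable_geometric)

text \<open>Replaces Minkowski's inequality for infinite sums: \<open>\<Sum> c^i a\<^sub>i \<le> 2 sup (2c)^i a\<^sub>i\<close>, and a supremum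
  commutes with powers.\<close>

lemma epowr_suminf_le:
  assumes q: "0 < q" and c: "0 < c"
  shows "epowr (\<Sum>i. ennreal (c ^ i) * a i) q \<le> ennreal (2 powr q) * (\<Sum>i. ennreal (((2 * c) powr q) ^ i)
      * epowr (a i) q)"
proof -
  let ?t = "\<lambda>i. ennreal ((2 * c) ^ i) * a i"
  have "(\<Sum>i. ennreal (c ^ i) * a i) = (\<Sum>i. ennreal ((1 / 2) ^ i) * ?t i)"
  proof (intro arg_cong[where f=suminf] ext)
    fix i
    have "c ^ i = ((1 / 2) * (2 * c)) ^ i" by simp
    also have "\<dots> = (1 / 2) ^ i * (2 * c) ^ i" by (rule power_mult_distrib)
    finally have "c ^ i = (1 / 2) ^ i * (2 * c) ^ i" .
    then show "ennreal (c ^ i) * a i = ennreal ((1 / 2) ^ i) * ?t i"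
      using c ennreal_mult'[of "(1 / 2) ^ i" "(2 * c) ^ i"] by (metis mult.assoc divide_nonneg_nonneg
          zero_le_numeral zero_le_one zero_le_power)
  qed
  also have "\<dots> \<le> (\<Sum>i. ennreal ((1 / 2) ^ i) * (SUP i. ?t i))"
    by (intro suminf_le mult_left_mono SUP_upper) auto
  also have "\<dots> = 2 * (SUP i. ?t i)"
    by (simp only: ennreal_suminf_multc suminf_half_powers)
  finally have "epowr (\<Sum>i. ennreal (c ^ i) * a i) q \<le> epowr (2 * (SUP i. ?t i)) q"
    using q by (intro epowr_mono) auto
  also have "\<dots> = ennreal (2 powr q) * epowr (SUP i. ?t i) q"
    using q epowr_ennreal[of 2 q] by (simp add: epowr_mult)
  also have "\<dots> \<le> ennreal (2 powr q) * (\<Sum>i. ennreal (((2 * c) powr q) ^ i) * epowr (a i) q)"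
  proof (intro mult_left_mono epowr_SUP_le[OF q])
    fix i
    have "((2 * c) ^ i) powr q = ((2 * c) powr q) ^ i"
      using c powr_powr[of "2 * c" "real i" q] powr_powr[of "2 * c" q "real i"]
      by (simp add: powr_realpow mult.commute[of q])
    then have "epowr (?t i) q = ennreal (((2 * c) powr q) ^ i) * epowr (a i) q"
      using q c by (simp add: epowr_mult epowr_ennreal)
    also have "\<dots> \<le> (\<Sum>i. ennreal (((2 * c) powr q) ^ i) * epowr (a i) q)"
      using sum_le_suminf[of "\<lambda>i. ennreal (((2 * c) powr q) ^ i) * epowr (a i) q" "{i}"] by auto
    finally show "epowr (?t i) q \<le> (\<Sum>i. ennreal (((2 * c) powr q) ^ i) * epowr (a i) q)" .
  qed simp
  finally show ?thesis .
qed

text \<open>A ball has positive measure. The lemma extracts one good point from a bound that holds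
  almost everywhere, which suffices for finiteness of an integral over the ball.\<close>

lemma AE_ball_ex:
  fixes y :: "real^'n"
  assumes "AE x in lebesgue. x \<in> ball y r \<longrightarrow> P x" "0 < r"
  shows "\<exists>x\<in>ball y r. P x"
proof (rule ccontr)
  assume "\<not> (\<exists>x\<in>ball y r. P x)"
  with assms(1) have "AE x in lebesgue. x \<notin> ball y r" by (auto elim: eventually_mono)
  then have "emeasure lebesgue (ball y r) = 0"
    by (subst (asm) AE_iff_measurable[of "ball y r"]) auto
  then show False using assms(2) vol_pos[of r y] by (simp add: emeasure_ball_vol del: vol_pos)
qed

text \<open>The majorant starts from \<open>(\<Sum> 2^-j k\<^sub>j^q)^(1/q)\<close>, so that one weight serves a whole sequence;
  the unit ball is added to it to make the majorant positive everywhere.\<close>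

theorem rubio_de_francia:
  fixes k :: "nat \<Rightarrow> real^'n \<Rightarrow> real"
  assumes A: "Aq q w C" and k_meas: "\<And>j. k j \<in> borel_measurable lebesgue" and k_nonneg: "\<And>j x. 0 \<le> k j x"
    and k_int: "\<And>j. (\<integral>\<^sup>+x. ennreal (k j x powr q * w x) \<partial>lebesgue) \<le> 1"
  shows "\<exists>K C' D. A1 K C' \<and> 0 < D \<and> (\<integral>\<^sup>+x. ennreal (K x powr q * w x) \<partial>lebesgue) \<le> ennreal D
    \<and> (\<forall>j. AE x in lebesgue. k j x \<le> 2 ^ j * K x)"
proof -
  note k_meas [measurable]
  note w = AqD(2)[OF A] and q = AqD(1)[OF A]
  have [measurable]: "w \<in> borel_measurable lebesgue" using w by (simp add: pos_locintD)
  have w_pos: "0 < w x" for x using w by (simp add: pos_locintD)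
  obtain N' where "N' \<ge> 0" and N': "\<And>f. f \<in> borel_measurable lebesgue \<Longrightarrow>
    (\<integral>\<^sup>+x. epowr (maxop lebesgue f x) q * ennreal (w x) \<partial>lebesgue)
      \<le> ennreal N' * (\<integral>\<^sup>+x. epowr (f x) q * ennreal (w x) \<partial>lebesgue)"
    using Aq_maxop_bounded[OF A] by blast
  \<comment> \<open>\<open>N'\<close> may be 0, and 1/N enters the definition of c.\<close>
  define N where "N = max N' 1"
  have N1: "1 \<le> N" by (simp add: N_def)
  have N: "(\<integral>\<^sup>+x. epowr (maxop lebesgue f x) q * ennreal (w x) \<partial>lebesgue)
      \<le> ennreal N * (\<integral>\<^sup>+x. epowr (f x) q * ennreal (w x) \<partial>lebesgue)"
    if "f \<in> borel_measurable lebesgue" for f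
    using N'[OF that] by (rule order_trans) (auto simp: N_def intro!: mult_right_mono ennreal_leI)
  \<comment> \<open>Chosen so that (2c)^q = 1/(2N). The inner 2 is the loss in
    \<open>epowr_suminf_le\<close>; since i applications of the maximal operator cost N^i, a factor
    2^-i remains.\<close>
  define c where "c = 1 / 2 * (1 / (2 * N)) powr (1 / q)"
  have c: "0 < c" "(2 * c) powr q = 1 / (2 * N)" using N1 q by (auto simp: c_def powr_powr)
  define s where "s x = (\<Sum>j. ennreal ((1 / 2) ^ j) * ennreal (k j x powr q)) + indicator (ball 0 1) x"
      for x :: "real^'n"
  define k0 where "k0 x = epowr (s x) (1 / q)" for x
  define m where "m i = (maxop lebesgue ^^ i) k0" for i
  define K' where "K' x = (\<Sum>i. ennreal (c ^ i) * m i x)" for x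
  define A where "A = 2 + mass w 0 1"
  have A0: "0 < A" by (simp add: A_def add_pos_nonneg)
  have [measurable]: "s \<in> borel_measurable lebesgue" unfolding s_def by measurable
  have [measurable]: "k0 \<in> borel_measurable lebesgue" unfolding k0_def by measurable
  have m_Suc: "m (Suc i) = maxop lebesgue (m i)" for i by (simp add: m_def)
  have [measurable]: "m i \<in> borel_measurable lebesgue" for i
    by (induction i) (auto simp: m_def intro: maxop_measurable)
  have [measurable]: "K' \<in> borel_measurable lebesgue" unfolding K'_def by measurable
  have m0: "(\<integral>\<^sup>+x. epowr (m 0 x) q * ennreal (w x) \<partial>lebesgue) \<le> ennreal A"
  proof -
    have "(\<integral>\<^sup>+x. epowr (m 0 x) q * ennreal (w x) \<partial>lebesgue)
        = (\<integral>\<^sup>+x. (\<Sum>j. ennreal ((1 / 2) ^ j) * ennreal (k j x powr q * w x)) + ennreal (w x) * indicator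
            (ball 0 1) x \<partial>lebesgue)"
    proof (rule nn_integral_cong)
      fix x
      have "epowr (m 0 x) q = s x" using q by (simp add: m_def k0_def epowr_epowr)
      then show "epowr (m 0 x) q * ennreal (w x)
        = (\<Sum>j. ennreal ((1 / 2) ^ j) * ennreal (k j x powr q * w x)) + ennreal (w x) * indicator (ball 0 1) x"
        by (simp add: s_def distrib_right ennreal_mult'' less_imp_le[OF w_pos] mult.commute[of "indicator _ _"]
            flip: ennreal_suminf_multc mult.assoc)
    qed
    also have "\<dots> = (\<Sum>j. ennreal ((1 / 2) ^ j) * (\<integral>\<^sup>+x. ennreal (k j x powr q * w x) \<partial>lebesgue)) + wmeas
        w (ball 0 1)"
      by (simp add: nn_integral_add nn_integral_suminf nn_integral_cmult wmeas_def)
    also have "\<dots> \<le> (\<Sum>j. ennreal ((1 / 2) ^ j) * 1) + ennreal (mass w 0 1)"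
      unfolding pos_locintD(4)[OF w] by (intro add_right_mono suminf_le mult_left_mono k_int) auto
    also have "\<dots> = ennreal A" by (simp add: suminf_half_powers A_def)
    finally show ?thesis .
  qed
  have m_int: "(\<integral>\<^sup>+x. epowr (m i x) q * ennreal (w x) \<partial>lebesgue) \<le> ennreal (N ^ i * A)" for i
  proof (induction i)
    case 0
    then show ?case using m0 by simp
  next
    case (Suc i)
    have "(\<integral>\<^sup>+x. epowr (m (Suc i) x) q * ennreal (w x) \<partial>lebesgue)
      \<le> ennreal N * (\<integral>\<^sup>+x. epowr (m i x) q * ennreal (w x) \<partial>lebesgue)"
      unfolding m_Suc by (rule N) simp
    also have "\<dots> \<le> ennreal N * ennreal (N ^ i * A)" by (rule mult_left_mono[OF Suc]) simp
    also have "\<dots> = ennreal (N ^ Suc i * A)" using N1 by (simp add: mult_ac flip: ennreal_mult')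
    finally show ?case .
  qed
  define D where "D = 2 powr q * (2 * A)"
  have D: "0 < D" using A0 by (simp add: D_def)
  have K'_int: "(\<integral>\<^sup>+x. epowr (K' x) q * ennreal (w x) \<partial>lebesgue) \<le> ennreal D"
  proof -
    have "(\<integral>\<^sup>+x. epowr (K' x) q * ennreal (w x) \<partial>lebesgue)
      \<le> (\<integral>\<^sup>+x. (ennreal (2 powr q) * (\<Sum>i. ennreal ((1 / (2 * N)) ^ i) * epowr (m i x) q)) * ennreal (w
          x) \<partial>lebesgue)"
      using epowr_suminf_le[of q c] q c unfolding K'_def by (intro nn_integral_mono mult_right_mono) auto
    also have "\<dots> = (\<integral>\<^sup>+x. ennreal (2 powr q) * (\<Sum>i. ennreal ((1 / (2 * N)) ^ i) * (epowr (m i x) q *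
        ennreal (w x))) \<partial>lebesgue)"
      by (simp only: mult.assoc ennreal_suminf_multc[symmetric])
    also have "\<dots> = ennreal (2 powr q) * (\<Sum>i. ennreal ((1 / (2 * N)) ^ i) * (\<integral>\<^sup>+x. epowr (m i x) q *
        ennreal (w x) \<partial>lebesgue))"
      by (simp add: nn_integral_suminf nn_integral_cmult)
    also have "\<dots> \<le> ennreal (2 powr q) * (\<Sum>i. ennreal ((1 / (2 * N)) ^ i) * ennreal (N ^ i * A))"
      by (intro suminf_le mult_left_mono m_int) auto
    also have "\<dots> = ennreal (2 powr q) * (\<Sum>i. ennreal ((1 / 2) ^ i) * ennreal A)"
    proof -
      have "ennreal ((1 / (2 * N)) ^ i) * ennreal (N ^ i * A) = ennreal ((1 / 2) ^ i) * ennreal A" for i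
      proof -
        have e: "(1 / (2 * N)) ^ i * (N ^ i * A) = (1 / 2) ^ i * A"
          using N1 by (simp add: power_divide power_mult_distrib)
        have "ennreal ((1 / (2 * N)) ^ i) * ennreal (N ^ i * A) = ennreal ((1 / (2 * N)) ^ i * (N ^ i * A))"
          using N1 by (intro ennreal_mult'[symmetric]) simp
        also have "\<dots> = ennreal ((1 / 2) ^ i) * ennreal A"
          unfolding e by (rule ennreal_mult') simp
        finally show ?thesis .
      qed
      then show ?thesis by presburger
    qed
    also have "\<dots> = ennreal D"
      using A0 by (simp add: suminf_half_powers D_def ennreal_mult ennreal_suminf_multc)
    finally show ?thesis .
  qed
  have K'_fin: "AE x in lebesgue. K' x < top"
  proof -
    have "(\<integral>\<^sup>+x. epowr (K' x) q * ennreal (w x) \<partial>lebesgue) \<noteq> \<infinity>"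
      using K'_int by (auto simp: top_unique)
    then have "AE x in lebesgue. epowr (K' x) q * ennreal (w x) \<noteq> \<infinity>"
      by (intro nn_integral_PInf_AE) auto
    then show ?thesis
    proof eventually_elim
      case (elim x)
      show ?case
      proof (rule ccontr)
        assume "\<not> K' x < top"
        then have "K' x = top" by (simp add: less_top[symmetric])
        then show False using elim w_pos[of x] by (simp add: ennreal_top_mult ennreal_eq_0_iff)
      qed
    qed
  qed
  \<comment> \<open>Averaging replaces each iterate of the maximal operator by at most the next one.
    This shift of the series by one index costs a factor 1/c and is the A_1 property.\<close>
  have K'_measure_avg: "measure_avg lebesgue K' y r \<le> ennreal (1 / c) * K' x" if "0 < r" "x \<in> ball y r"
      for x y r
  proof -
    have "measure_avg lebesgue K' y r = (\<Sum>i. ennreal (c ^ i) * measure_avg lebesgue (m i) y r)"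
    proof -
      have "(\<integral>\<^sup>+z\<in>ball y r. K' z \<partial>lebesgue) = (\<integral>\<^sup>+z. (\<Sum>i. ennreal (c ^ i) * (m i z * indicator (ball y
          r) z)) \<partial>lebesgue)"
        unfolding K'_def by (simp only: mult.assoc ennreal_suminf_multc[symmetric])
      also have "\<dots> = (\<Sum>i. ennreal (c ^ i) * (\<integral>\<^sup>+z\<in>ball y r. m i z \<partial>lebesgue))"
        by (simp add: nn_integral_suminf nn_integral_cmult)
      finally show ?thesis by (simp add: measure_avg_def ennreal_times_divide)
    qed
    also have "\<dots> \<le> (\<Sum>i. ennreal (c ^ i) * m (Suc i) x)"
      unfolding m_Suc by (intro suminf_le mult_left_mono measure_avg_le_maxop that) auto
    also have "\<dots> = (\<Sum>i. ennreal (1 / c) * (ennreal (c ^ Suc i) * m (Suc i) x))"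
    proof (intro arg_cong[where f=suminf] ext)
      fix i
      have "c ^ i = 1 / c * c ^ Suc i" using c by simp
      then have "ennreal (c ^ i) = ennreal (1 / c) * ennreal (c ^ Suc i)"
        using c by (metis ennreal_mult' divide_nonneg_pos zero_le_one)
      then show "ennreal (c ^ i) * m (Suc i) x = ennreal (1 / c) * (ennreal (c ^ Suc i) * m (Suc i) x)"
        by (simp only: mult.assoc)
    qed
    also have "\<dots> = ennreal (1 / c) * (\<Sum>i. ennreal (c ^ Suc i) * m (Suc i) x)"
      by simp
    also have "(\<Sum>i. ennreal (c ^ Suc i) * m (Suc i) x) \<le> K' x"
      unfolding K'_def
      using suminf_offset[of "\<lambda>i. ennreal (c ^ i) * m i x" 1] by simp
    finally show ?thesis by (simp add: mult_left_mono)
  qed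
  have K'_ge: "ennreal (c ^ i) * m i x \<le> K' x" for i x
    unfolding K'_def using sum_le_suminf[of "\<lambda>i. ennreal (c ^ i) * m i x" "{i}"] by auto
  \<comment> \<open>The ball of radius |x| + 1 about 0 contains x and the unit ball, on which the
    initial function is at least 1; so the first iterate is already positive at x.\<close>
  have K'_pos: "0 < K' x" for x
  proof -
    let ?r = "norm x + 1"
    have r: "0 < ?r" by (simp add: add_nonneg_pos)
    have k0_ge: "indicator (ball 0 1) z \<le> k0 z" for z
    proof (cases "z \<in> ball 0 1")
      case True
      then have "1 \<le> s z" by (simp add: s_def)
      then show ?thesis using epowr_mono[of "1 / q" 1 "s z"] q True by (simp add: k0_def)
    qed simp
    have "ball (0::real^'n) 1 \<subseteq> ball 0 ?r" by (rule subset_ball) simp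
    then have ind: "indicator (ball 0 1) z = (indicator (ball 0 1) z * indicator (ball 0 ?r) z ::
        ennreal)" for z :: "real^'n"
      unfolding indicator_inter_arith[symmetric] by (simp only: Int_absorb2)
    have "emeasure lebesgue (ball (0::real^'n) 1) = (\<integral>\<^sup>+z. indicator (ball (0::real^'n) 1) z \<partial>lebesgue)"
      by (rule nn_integral_indicator[symmetric]) simp
    also have "\<dots> = (\<integral>\<^sup>+z\<in>ball 0 ?r. indicator (ball (0::real^'n) 1) z \<partial>lebesgue)"
      by (rule nn_integral_cong) (rule ind)
    also have "\<dots> \<le> (\<integral>\<^sup>+z\<in>ball 0 ?r. k0 z \<partial>lebesgue)"
      by (intro nn_integral_mono mult_right_mono k0_ge) simp
    finally have "0 < (\<integral>\<^sup>+z\<in>ball 0 ?r. k0 z \<partial>lebesgue)"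
      using vol_pos[of 1 "0::real^'n"] unfolding emeasure_ball_vol
      by (metis ennreal_less_zero_iff less_le_trans zero_less_one)
    then have "0 < measure_avg lebesgue k0 0 ?r"
      by (simp add: measure_avg_def ennreal_zero_less_divide emeasure_ball_vol)
    also have "\<dots> \<le> m 1 x" using r by (auto simp: m_def intro!: measure_avg_le_maxop)
    finally have "0 < ennreal (c ^ 1) * m 1 x" using c by (simp add: ennreal_zero_less_mult_iff)
    then show ?thesis using K'_ge[of 1 x] by (rule less_le_trans)
  qed
  \<comment> \<open>The value 1 on the null set where \<open>K'\<close> is infinite keeps K positive
    and finite everywhere.\<close>
  define K where "K x = (if K' x = top then 1 else enn2real (K' x))" for x
  have K_pos: "0 < K x" for x
    using K'_pos[of x] by (auto simp: K_def enn2real_positive_iff less_top)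
  have [measurable]: "K \<in> borel_measurable lebesgue"
    unfolding K_def by measurable
  have KK': "AE x in lebesgue. ennreal (K x) = K' x"
    using K'_fin by eventually_elim (auto simp: K_def)
  have wmeas_K: "wmeas K (ball y r) = measure_avg lebesgue K' y r * ennreal (vol y r)" if "0 < r" for y r
  proof -
    have "wmeas K (ball y r) = (\<integral>\<^sup>+z\<in>ball y r. K' z \<partial>lebesgue)"
      unfolding wmeas_def using KK' by (intro nn_integral_cong_AE) (auto elim: eventually_mono)
    then show ?thesis using vol_pos[OF that, of y]
      by (simp add: measure_avg_def emeasure_ball_vol ennreal_divide_times ennreal_mult_divide_eq del: vol_pos)
  qed
  have K_loc: "pos_locint K"
  proof (rule pos_locintI)
    fix y :: "real^'n" and r :: real assume r: "0 < r"
    have "AE x in lebesgue. x \<in> ball y r \<longrightarrow> K' x < top"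
      using K'_fin by eventually_elim simp
    from AE_ball_ex[OF this r] obtain x where x: "x \<in> ball y r" "K' x < top" by blast
    have "measure_avg lebesgue K' y r < top"
      using K'_measure_avg[OF r x(1)] x(2) by (auto simp: ennreal_mult_less_top intro: le_less_trans)
    then have "wmeas K (ball y r) < top" unfolding wmeas_K[OF r] by (simp add: ennreal_mult_less_top)
    then show "\<exists>A. wmeas K (ball y r) \<le> ennreal A" by (cases "wmeas K (ball y r)") auto
  qed (auto simp: K_pos)
  have "A1 K (1 / c)"
    unfolding A1_def
  proof (intro conjI allI impI K_loc)
    fix y :: "real^'n" and r :: real assume r: "0 < r"
    show "AE x in lebesgue. x \<in> ball y r \<longrightarrow> avg K y r \<le> 1 / c * K x"
      using KK'
    proof eventually_elim
      case (elim x)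
      show ?case
      proof
        assume "x \<in> ball y r"
        then have "measure_avg lebesgue K' y r \<le> ennreal (1 / c * K x)"
          using K'_measure_avg[OF r, of x y] c by (simp add: elim[symmetric] flip: ennreal_mult')
        then have "wmeas K (ball y r) \<le> ennreal (1 / c * K x) * ennreal (vol y r)"
          unfolding wmeas_K[OF r] by (rule mult_right_mono) simp
        also have "\<dots> = ennreal (1 / c * K x * vol y r)"
          using c K_pos[of x] by (subst ennreal_mult') auto
        finally show "avg K y r \<le> 1 / c * K x"
          using c K_pos[of x] r by (intro avg_le) auto
      qed
    qed
  qed (use c in simp)
  moreover have "(\<integral>\<^sup>+x. ennreal (K x powr q * w x) \<partial>lebesgue) \<le> ennreal D"
  proof -
    have "(\<integral>\<^sup>+x. ennreal (K x powr q * w x) \<partial>lebesgue) = (\<integral>\<^sup>+x. epowr (K' x) q * ennreal (w x) \<partial>lebesgue)"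
    proof (rule nn_integral_cong_AE, use KK' in eventually_elim)
      case (elim x)
      then show ?case using K_pos[of x] by (simp add: elim[symmetric] epowr_ennreal ennreal_mult')
    qed
    then show ?thesis using K'_int by simp
  qed
  moreover have "AE x in lebesgue. k j x \<le> 2 ^ j * K x" for j
    using KK'
  proof eventually_elim
    case (elim x)
    have "ennreal ((1 / 2) ^ j) * ennreal (k j x powr q) \<le> (\<Sum>j. ennreal ((1 / 2) ^ j) * ennreal (k j x powr q))"
      using sum_le_suminf[of "\<lambda>j. ennreal ((1 / 2) ^ j) * ennreal (k j x powr q)" "{j}"] by auto
    also have "\<dots> \<le> s x" by (simp add: s_def)
    also have "s x = epowr (m 0 x) q" using q by (simp add: m_def k0_def epowr_epowr)
    also have "\<dots> \<le> epowr (K' x) q" using K'_ge[of 0 x] q by (intro epowr_mono) auto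
    also have "\<dots> = ennreal (K x powr q)" using K_pos[of x] by (simp add: elim[symmetric] epowr_ennreal)
    finally have "(1 / 2) ^ j * k j x powr q \<le> K x powr q"
      by (simp flip: ennreal_mult')
    then have "k j x powr q \<le> 2 ^ j * K x powr q" by (simp add: field_simps)
    \<comment> \<open>The natural constant 2^(j/q) is coarsened to 2^j, which is free of q.\<close>
    also have "\<dots> \<le> (2 ^ j) powr q * K x powr q"
    proof (rule mult_right_mono)
      show "2 ^ j \<le> (2 ^ j :: real) powr q" using powr_mono[of 1 q "2 ^ j"] q by simp
    qed simp
    also have "\<dots> = (2 ^ j * K x) powr q" using K_pos[of x] by (simp add: powr_mult)
    finally have "k j x powr q \<le> (2 ^ j * K x) powr q" .
    moreover have "0 \<le> 2 ^ j * K x" using K_pos[of x] by simp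
    ultimately show ?case
      using q powr_less_mono2[of q "2 ^ j * K x" "k j x"] by (meson less_trans not_less zero_less_one)
  qed
  ultimately show ?thesis using D by blast
qed

section \<open>Limited range extrapolation\<close>

text \<open>A_1 is included as the endpoint t = 1, which corresponds to q = 1 in
  \<open>A_RH\<close>.\<close>

definition A_weight :: "real \<Rightarrow> (real^'n \<Rightarrow> real) \<Rightarrow> bool" where
  "A_weight t U \<longleftrightarrow> (\<exists>C. if t = 1 then A1 U C else Aq t U C)"

text \<open>For \<open>u > 0\<close>, membership in \<open>A\<^sub>q \<inter> RH\<^sub>s\<close> amounts to \<open>u^s \<in> A\<^sub>t\<close> with \<open>t = s(q-1)+1\<close>.\<close>

definition A_RH :: "real \<Rightarrow> real \<Rightarrow> (real^'n \<Rightarrow> real) \<Rightarrow> bool" where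
  "A_RH q s u \<longleftrightarrow> (\<forall>x. 0 < u x) \<and> A_weight (s * (q - 1) + 1) (\<lambda>x. u x powr s)"

section \<open>Products of Muckenhoupt weights with powers of A_1 weights\<close>

lemma A1_powr_minus_le:
  assumes K: "A1 K C" and r: "0 < r" and d: "0 \<le> d"
  shows "AE y in lebesgue. y \<in> ball x r \<longrightarrow> K y powr (- d) \<le> (C / avg K x r) powr d"
  using A1D(3)[OF K r, of x]
proof eventually_elim
  case (elim y)
  show ?case
  proof
    assume "y \<in> ball x r"
    with elim have "avg K x r \<le> C * K y" by simp
    moreover have "0 < avg K x r" "0 < K y" "0 < C"
      using avg_pos[OF A1D(1)[OF K] r, of x] pos_locintD(2)[OF A1D(1)[OF K]] A1D(2)[OF K] by auto
    ultimately have "avg K x r / C \<le> K y" "0 < avg K x r / C"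
      by (simp_all add: pos_divide_le_eq mult.commute)
    then have "K y powr (- d) \<le> (avg K x r / C) powr (- d)"
      using d by (intro powr_mono2') auto
    also have "\<dots> = (C / avg K x r) powr d"
      using powr_minus[of "avg K x r / C" d] powr_divide[of "avg K x r" C d] powr_divide[of C "avg K x r" d]
      by (simp only: inverse_divide)
    finally show "K y powr (- d) \<le> (C / avg K x r) powr d" .
  qed
qed

text \<open>The negative power of K is pulled out of the average, leaving the average of K to the
  power -(t0 - t). The dual weight is a product of powers of the dual of U and of K with exponents
  summing to 1, so Hoelder's inequality produces the average of K to the opposite power, and the two
  cancel.\<close>

lemma Aq_mult_A1_powr:
  assumes U: "Aq t U C" and K: "A1 K C'" and t: "t < t0"
  shows "\<exists>C. Aq t0 (\<lambda>x. U x * K x powr (- (t0 - t))) C"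
proof -
  note Ul = AqD(2,3)[OF U] and Kl = A1D(1)[OF K]
  have t1: "1 < t" by (rule AqD(1)[OF U])
  define d where "d = t0 - t"
  define a where "a = (t - 1) / (t0 - 1)"
  define b where "b = d / (t0 - 1)"
  have d: "0 < d" using t by (simp add: d_def)
  have ab: "0 \<le> a" "0 \<le> b" "a + b = 1"
    using t t1 by (auto simp: a_def b_def d_def simp flip: add_divide_distrib)
  have Up: "0 < U x" and Kp: "0 < K x" for x using Ul Kl by (auto simp: pos_locintD)
  have C': "0 < C'" by (rule A1D(2)[OF K])
  have [measurable]: "U \<in> borel_measurable lebesgue" "K \<in> borel_measurable lebesgue"
    using Ul Kl by (auto simp: pos_locintD)
  let ?V = "\<lambda>x. U x * K x powr (- d)"
  have le: "AE y in lebesgue. y \<in> ball x r \<longrightarrow> ?V y \<le> (C' / avg K x r) powr d * U y" if "0 < r" for x r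
    using A1_powr_minus_le[OF K that less_imp_le[OF d], of x]
    by eventually_elim (use Up in \<open>auto simp: mult.commute[of "U _"] intro!: mult_right_mono less_imp_le\<close>)
  have dual: "dual_weight t0 ?V = (\<lambda>x. dual_weight t U x powr a * K x powr b)"
  proof
    fix x
    have e: "- 1 / (t - 1) * a = - 1 / (t0 - 1)" "- d * (- 1 / (t0 - 1)) = b"
      using t t1 by (auto simp: a_def b_def)
    show "dual_weight t0 ?V x = dual_weight t U x powr a * K x powr b"
      using Up[of x] Kp[of x] by (simp only: powr_powr e) (simp add: powr_mult powr_powr e(1)[symmetric]
          e(2)[symmetric])
  qed
  have "Aq t0 ?V (C' powr d * C)"
    unfolding Aq_def dual
  proof (intro conjI allI impI)
    show "1 < t0" using t t1 by simp
    show "pos_locint ?V"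
    proof (rule pos_locint_cong_bound[OF Ul(1)])
      show "0 < ?V x" for x using Up[of x] Kp[of x] by simp
      show "\<exists>c\<ge>0. AE y in lebesgue. y \<in> ball x r \<longrightarrow> ?V y \<le> c * U y" if "0 < r" for x r
        using le[OF that, of x] by (intro exI[of _ "(C' / avg K x r) powr d"]) simp
    qed simp
    show "pos_locint (\<lambda>x. dual_weight t U x powr a * K x powr b)"
      by (rule pos_locint_powr_mult[OF Ul(2) Kl ab])
    fix x :: "real^'a" and r :: real assume r: "0 < r"
    let ?s = "avg (dual_weight t U) x r"
    have pos: "0 < avg U x r" "0 < ?s" "0 < avg K x r" using avg_pos r Ul Kl by auto
    have "avg ?V x r \<le> (C' / avg K x r) powr d * avg U x r"
      by (rule avg_mono_AE[OF Ul(1) le[OF r] _ r]) simp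
    moreover have "avg (\<lambda>x. dual_weight t U x powr a * K x powr b) x r powr (t0 - 1) \<le> (?s powr a * avg
        K x r powr b) powr (t0 - 1)"
      using t t1 by (intro powr_mono2 avg_powr_Holder[OF Ul(2) Kl ab r]) auto
    moreover have "(?s powr a * avg K x r powr b) powr (t0 - 1) = ?s powr (t - 1) * avg K x r powr d"
      using t t1 by (simp add: powr_mult powr_powr a_def b_def)
    ultimately have "avg ?V x r * avg (\<lambda>x. dual_weight t U x powr a * K x powr b) x r powr (t0 - 1)
        \<le> ((C' / avg K x r) powr d * avg U x r) * (?s powr (t - 1) * avg K x r powr d)"
      using pos by (intro mult_mono) auto
    also have "\<dots> = C' powr d * (avg U x r * ?s powr (t - 1))"
      using pos C' by (simp add: powr_divide)
    also have "\<dots> \<le> C' powr d * C"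
      by (intro mult_left_mono AqD(4)[OF U r]) simp
    finally show "avg ?V x r * avg (\<lambda>x. dual_weight t U x powr a * K x powr b) x r powr (t0 - 1) \<le> C'
        powr d * C" .
  qed
  then show ?thesis unfolding d_def by blast
qed

text \<open>The mirror image of \<open>Aq_mult_A1_powr\<close>: here K enters the weight itself
  through Hoelder's inequality, and the dual weight through a negative power, which is pulled out.
  At t0 = 1 the product is K alone.\<close>

lemma A_weight_interpolate_A1:
  assumes U: "Aq t U C" and K: "A1 K C'" and t: "1 \<le> t0" "t0 < t"
  shows "A_weight t0 (\<lambda>x. U x powr ((t0 - 1) / (t - 1)) * K x powr ((t - t0) / (t - 1)))"
proof (cases "t0 = 1")
  case True
  have "(\<lambda>x. U x powr 0 * K x powr 1) = K"
    using pos_locintD(2)[OF AqD(2)[OF U]] pos_locintD(2)[OF A1D(1)[OF K]] by (auto simp: less_imp_le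
        less_imp_neq[symmetric])
  then show ?thesis using K t True by (auto simp: A_weight_def)
next
  case False
  note Ul = AqD(2,3)[OF U] and Kl = A1D(1)[OF K]
  have t1: "1 < t0" using False t by simp
  define a where "a = (t0 - 1) / (t - 1)"
  define b where "b = (t - t0) / (t - 1)"
  have ab: "0 \<le> a" "0 \<le> b" "a + b = 1"
    using t t1 by (auto simp: a_def b_def simp flip: add_divide_distrib)
  have Up: "0 < U x" and Kp: "0 < K x" for x using Ul Kl by (auto simp: pos_locintD)
  have C': "0 < C'" by (rule A1D(2)[OF K])
  define e where "e = b / (t0 - 1)"
  have e: "0 \<le> e" using ab t1 by (simp add: e_def)
  have [measurable]: "U \<in> borel_measurable lebesgue" "K \<in> borel_measurable lebesgue"
    using Ul Kl by (auto simp: pos_locintD)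
  let ?V = "\<lambda>x. U x powr a * K x powr b"
  have dual: "dual_weight t0 ?V = (\<lambda>x. dual_weight t U x * K x powr (- e))"
  proof
    fix x
    have e: "a * (- 1 / (t0 - 1)) = - 1 / (t - 1)" "b * (- 1 / (t0 - 1)) = - e"
      using t t1 by (auto simp: a_def e_def)
    show "dual_weight t0 ?V x = dual_weight t U x * K x powr (- e)"
      using Up[of x] Kp[of x] by (simp only: powr_mult powr_powr e powr_ge_zero)
  qed
  have le: "AE y in lebesgue. y \<in> ball x r \<longrightarrow> dual_weight t U y * K y powr (- e) \<le> (C' / avg K x r) powr
      e * dual_weight t U y"
    if "0 < r" for x r
    using A1_powr_minus_le[OF K that e, of x]
    by eventually_elim (auto simp: mult.commute[of "U _ powr _"] intro!: mult_right_mono)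
  have "Aq t0 ?V (C' powr b * C powr a)"
    unfolding Aq_def dual
  proof (intro conjI allI impI t1)
    show "pos_locint ?V"
      by (rule pos_locint_powr_mult[OF Ul(1) Kl ab])
    show "pos_locint (\<lambda>x. dual_weight t U x * K x powr (- e))"
    proof (rule pos_locint_cong_bound[OF Ul(2)])
      show "0 < dual_weight t U x * K x powr (- e)" for x using Up[of x] Kp[of x] by simp
      show "\<exists>c\<ge>0. AE y in lebesgue. y \<in> ball x r \<longrightarrow> dual_weight t U y * K y powr (- e) \<le> c * dual_weight t U y"
        if "0 < r" for x r
        using le[OF that, of x] by (intro exI[of _ "(C' / avg K x r) powr e"]) simp
    qed simp
    fix x :: "real^'a" and r :: real assume r: "0 < r"
    let ?s = "avg (dual_weight t U) x r"
    have pos: "0 < avg U x r" "0 < ?s" "0 < avg K x r" using avg_pos r Ul Kl by auto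
    have "avg (\<lambda>x. dual_weight t U x * K x powr (- e)) x r \<le> (C' / avg K x r) powr e * ?s"
      by (rule avg_mono_AE[OF Ul(2) le[OF r] _ r]) simp
    then have "avg (\<lambda>x. dual_weight t U x * K x powr (- e)) x r powr (t0 - 1) \<le> ((C' / avg K x r) powr e
        * ?s) powr (t0 - 1)"
      using t1 by (intro powr_mono2) auto
    also have "\<dots> = (C' / avg K x r) powr b * ?s powr (t0 - 1)"
      using pos t1 by (simp add: powr_mult powr_powr e_def)
    finally have "avg ?V x r * avg (\<lambda>x. dual_weight t U x * K x powr (- e)) x r powr (t0 - 1)
        \<le> (avg U x r powr a * avg K x r powr b) * ((C' / avg K x r) powr b * ?s powr (t0 - 1))"
      by (intro mult_mono avg_powr_Holder[OF Ul(1) Kl ab r]) auto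
    also have "\<dots> = C' powr b * (avg U x r powr a * ?s powr (t0 - 1))"
      using pos C' by (simp add: powr_divide)
    also have "avg U x r powr a * ?s powr (t0 - 1) = (avg U x r * ?s powr (t - 1)) powr a"
    proof -
      have "(t - 1) * a = t0 - 1" using t by (simp add: a_def)
      then show ?thesis using pos by (simp add: powr_mult powr_powr)
    qed
    also have "C' powr b * \<dots> \<le> C' powr b * C powr a"
      using ab pos by (intro mult_left_mono powr_mono2 AqD(4)[OF U r]) auto
    finally show "avg ?V x r * avg (\<lambda>x. dual_weight t U x * K x powr (- e)) x r powr (t0 - 1) \<le> C' powr
        b * C powr a" .
  qed
  then show ?thesis using False unfolding A_weight_def a_def b_def by auto
qed

text \<open>Exponent bookkeeping for \<open>extrapolation_weight\<close>, with x in the role of u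
  and k in that of the majorant K.\<close>

lemma powr_mult_powr_combine:
  fixes x k :: real
  shows "(x powr a * (k powr m * x powr c) powr b) powr d = x powr (d * (a + c * b)) * k powr (m * b * d)"
proof -
  have "(x powr a * (k powr m * x powr c) powr b) powr d = (x powr (a * d) * x powr (c * b * d)) * k
      powr (m * b * d)"
    by (simp only: powr_mult powr_powr mult_ac)
  also have "x powr (a * d) * x powr (c * b * d) = x powr (d * (a + c * b))"
    unfolding powr_add[symmetric] by (simp only: distrib_left mult_ac)
  finally show ?thesis .
qed

text \<open>Both directions of the extrapolation use the weight \<open>u^(q0/q) Z^(1-q0/q)\<close>.  For \<open>q < q0\<close> the
  function \<open>Z\<close> is \<open>K^t U\<close> with \<open>U = u^s\<close> and \<open>K\<close> a majorant for \<open>U\<close>; for \<open>q0 < q\<close> the weight \<open>U\<close> is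
  replaced by its dual.\<close>

lemma extrapolation_weight:
  fixes u :: "real^'n \<Rightarrow> real" and q q0 \<eta> :: real
  assumes q: "1 < q" "1 \<le> q0" "q0 \<noteq> q" and \<eta>: "0 \<le> \<eta>" "\<eta> * q < 1" "\<eta> * q0 < 1"
    and u: "A_RH q (1 / (1 - \<eta> * q)) u"
  shows "\<exists>\<kappa>\<ge>1. \<forall>h :: nat \<Rightarrow> real^'n \<Rightarrow> real.
    (\<forall>j. h j \<in> borel_measurable lebesgue \<and> (\<forall>x. 0 \<le> h j x) \<and> (\<integral>\<^sup>+x. ennreal (h j x) \<partial>lebesgue) \<le> 1) \<longrightarrow>
    (\<exists>Z D. Z \<in> borel_measurable lebesgue \<and> (\<forall>x. 0 < Z x) \<and> 0 < D \<and> (\<integral>\<^sup>+x. ennreal (Z x) \<partial>lebesgue) \<le> ennreal D \<and>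
      (\<forall>j. AE x in lebesgue. h j x \<le> \<kappa> ^ j * Z x) \<and>
      A_RH q0 (1 / (1 - \<eta> * q0)) (\<lambda>x. u x powr (q0 / q) * Z x powr (1 - q0 / q)))"
proof -
  define s where "s = 1 / (1 - \<eta> * q)"
  define s0 where "s0 = 1 / (1 - \<eta> * q0)"
  define t where "t = s * (q - 1) + 1"
  define t0 where "t0 = s0 * (q0 - 1) + 1"
  define U where "U x = u x powr s" for x
  have s: "0 < s" "0 < s0" using \<eta> by (auto simp: s_def s0_def)
  have t: "1 < t" "1 \<le> t0" using s q by (auto simp: t_def t0_def)
  have up: "0 < u x" for x using u by (simp add: A_RH_def)
  obtain C where A: "Aq t U C"
    using u t(1) by (auto simp: A_RH_def A_weight_def t_def U_def[abs_def] s_def split: if_splits)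
  note Ul = AqD(2,3)[OF A]
  have Up: "0 < U x" for x using up[of x] by (simp add: U_def)
  have nz: "1 - \<eta> * q \<noteq> 0" "1 - \<eta> * q0 \<noteq> 0" "q \<noteq> 0" "q - 1 \<noteq> 0" using \<eta> q by auto
  have e: "\<eta> * q * s = s - 1" "\<eta> * q0 * s0 = s0 - 1"
  proof -
    have "(1 - \<eta> * q) * s = 1" "(1 - \<eta> * q0) * s0 = 1" using nz by (simp_all add: s_def s0_def)
    then show "\<eta> * q * s = s - 1" "\<eta> * q0 * s0 = s0 - 1" by (simp_all add: left_diff_distrib)
  qed
  \<comment> \<open>The factor 1 - \<eta> is the same for both exponents; this makes t0 - t a
    positive multiple of q0 - q.\<close>
  have t_eq: "t = q * (1 - \<eta>) * s" "t0 = q0 * (1 - \<eta>) * s0"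
    using e unfolding t_def t0_def by algebra+
  have t_diff: "t0 - t = (1 - \<eta>) * (q0 - q) * (s * s0)"
    unfolding t_eq using e by algebra
  have "\<eta> * 1 \<le> \<eta> * q" using \<eta>(1) q(1) by (intro mult_left_mono) auto
  then have \<eta>1: "\<eta> < 1" using \<eta>(2) by simp
  have qq0: "q * (1 - q0 / q) = q - q0" using nz by (simp add: right_diff_distrib)
  \<comment> \<open>When Z contains the factor U = u^s, the new weight raised to s0 contains u
    exactly to the power s, so U reappears with exponent 1.\<close>
  have ss: "s0 * (q0 / q + s * (1 - q0 / q)) = s"
  proof -
    have "q * (s0 * (q0 / q + s * (1 - q0 / q))) = s0 * (q * (q0 / q) + s * (q * (1 - q0 / q)))"
      by (simp only: distrib_left mult.left_commute)
    also have "\<dots> = s0 * (q0 + s * (q - q0))" unfolding qq0 using nz by simp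
    also have "\<dots> = q * s" using e by algebra
    finally show ?thesis using nz by simp
  qed
  have t_ss: "t * (1 - q0 / q) * s0 = t - t0"
  proof -
    have "t * (1 - q0 / q) * s0 = (1 - \<eta>) * (q * (1 - q0 / q)) * (s * s0)"
      unfolding t_eq by (simp only: mult_ac)
    then show ?thesis unfolding qq0 using t_diff by algebra
  qed
  \<comment> \<open>The Rubio de Francia majorant bounds roots by 2^j K, so the functions themselves
    lose the power t of 2^j, or the conjugate power in the dual case.\<close>
  define \<kappa> where "\<kappa> = 2 powr (if q < q0 then t else t / (t - 1))"
  have \<kappa>: "1 \<le> \<kappa>" using t by (auto simp: \<kappa>_def intro!: ge_one_powr_ge_zero)
  have main: "\<exists>Z D. Z \<in> borel_measurable lebesgue \<and> (\<forall>x. 0 < Z x) \<and> 0 < D \<and> (\<integral>\<^sup>+x. ennreal (Z x)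
      \<partial>lebesgue) \<le> ennreal D \<and>
      (\<forall>j. AE x in lebesgue. h j x \<le> \<kappa> ^ j * Z x) \<and>
      A_RH q0 s0 (\<lambda>x. u x powr (q0 / q) * Z x powr (1 - q0 / q))"
    if h: "\<And>j. h j \<in> borel_measurable lebesgue" "\<And>j x. 0 \<le> h j x" "\<And>j. (\<integral>\<^sup>+x. ennreal (h j x) \<partial>lebesgue) \<le> 1"
    for h :: "nat \<Rightarrow> real^'n \<Rightarrow> real"
  proof -
    \<comment> \<open>The algorithm is applied in L^p(V) to k = (h/V)^(1/p), for which k^p V = h has
      integral at most 1.\<close>
    have majorant: "\<exists>K C' D. A1 K C' \<and> 0 < D \<and> (\<integral>\<^sup>+x. ennreal (K x powr p * V x) \<partial>lebesgue) \<le> ennreal D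
        \<and> (\<forall>j. AE x in lebesgue. h j x \<le> (2 powr p) ^ j * (K x powr p * V x))"
      if V: "Aq p V C" for p C and V :: "real^'n \<Rightarrow> real"
    proof -
      have p: "1 < p" by (rule AqD(1)[OF V])
      have Vp: "0 < V x" for x using AqD(2)[OF V] by (simp add: pos_locintD)
      define k where "k j x = (h j x / V x) powr (1 / p)" for j x
      have kp: "k j x powr p * V x = h j x" for j x
        using p h(2)[of j x] Vp[of x] by (simp add: k_def powr_powr less_imp_neq[symmetric])
      have [measurable]: "V \<in> borel_measurable lebesgue" using AqD(2)[OF V] by (simp add: pos_locintD)
      have "k j \<in> borel_measurable lebesgue" for j
        using h(1)[of j] unfolding k_def by measurable
      then obtain K C' D where K: "A1 K C'" "0 < D" "(\<integral>\<^sup>+x. ennreal (K x powr p * V x) \<partial>lebesgue) \<le> ennreal D"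
        "\<And>j. AE x in lebesgue. k j x \<le> 2 ^ j * K x"
        using rubio_de_francia[OF V, of k] h(3) by (auto simp: kp k_def[symmetric]) (auto simp: k_def)
      have "AE x in lebesgue. h j x \<le> (2 powr p) ^ j * (K x powr p * V x)" for j
        using K(4)[of j]
      proof eventually_elim
        case (elim x)
        have "k j x powr p \<le> (2 ^ j * K x) powr p"
          using elim p by (intro powr_mono2) (auto simp: k_def)
        also have "\<dots> = (2 powr p) ^ j * K x powr p"
          using pos_locintD(2)[OF A1D(1)[OF K(1)], of x] powr_powr[of 2 "real j" p] powr_powr[of 2 p "real j"]
          by (simp add: powr_mult powr_realpow mult.commute[of p])
        finally have "k j x powr p * V x \<le> ((2 powr p) ^ j * K x powr p) * V x"
          using Vp[of x] by (intro mult_right_mono) auto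
        then show ?case by (simp add: kp mult.assoc)
      qed
      then show ?thesis using K by blast
    qed
    show ?thesis
    proof (cases "q < q0")
      case True
      obtain K C' D where K: "A1 K C'" "0 < D" "(\<integral>\<^sup>+x. ennreal (K x powr t * U x) \<partial>lebesgue) \<le> ennreal D"
        "\<And>j. AE x in lebesgue. h j x \<le> (2 powr t) ^ j * (K x powr t * U x)"
        using majorant[OF A] by blast
      define Z where "Z x = K x powr t * U x" for x
      have Kp: "0 < K x" for x using A1D(1)[OF K(1)] by (simp add: pos_locintD)
      have "0 < t0 - t" unfolding t_diff using True \<eta>1 s by (intro mult_pos_pos) auto
      then have tt: "t < t0" by simp
      have eq: "(u x powr (q0 / q) * Z x powr (1 - q0 / q)) powr s0 = U x * K x powr (- (t0 - t))" for x
      proof -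
        have e: "t * (1 - q0 / q) * s0 = - (t0 - t)" unfolding t_ss by (rule minus_diff_eq[symmetric])
        show ?thesis unfolding Z_def U_def powr_mult_powr_combine ss e ..
      qed
      show ?thesis
      proof (rule exI[of _ Z], rule exI[of _ D], intro conjI allI)
        show "Z \<in> borel_measurable lebesgue"
        proof -
          note [measurable] = pos_locintD(1)[OF A1D(1)[OF K(1)]] pos_locintD(1)[OF Ul(1)]
          show ?thesis unfolding Z_def[abs_def] by measurable
        qed
        show "0 < Z x" for x using Kp[of x] Up[of x] by (simp add: Z_def)
        show "(\<integral>\<^sup>+x. ennreal (Z x) \<partial>lebesgue) \<le> ennreal D" unfolding Z_def by (rule K(3))
        show "AE x in lebesgue. h j x \<le> \<kappa> ^ j * Z x" for j
          using K(4)[of j] True by (simp add: \<kappa>_def Z_def)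
        show "A_RH q0 s0 (\<lambda>x. u x powr (q0 / q) * Z x powr (1 - q0 / q))"
          unfolding A_RH_def eq t0_def[symmetric]
        proof (intro conjI allI)
          show "0 < u x powr (q0 / q) * Z x powr (1 - q0 / q)" for x
            using up[of x] Kp[of x] Up[of x] by (simp add: Z_def)
          show "A_weight t0 (\<lambda>x. U x * K x powr (- (t0 - t)))"
            using Aq_mult_A1_powr[OF A K(1) tt] t tt by (auto simp: A_weight_def)
        qed
      qed (rule K(2))
    next
      case False
      then have qq: "q0 < q" using q by simp
      define V where "V = dual_weight t U"
      define t' where "t' = t / (t - 1)"
      obtain K C' D where K: "A1 K C'" "0 < D" "(\<integral>\<^sup>+x. ennreal (K x powr t' * V x) \<partial>lebesgue) \<le> ennreal D"
        "\<And>j. AE x in lebesgue. h j x \<le> (2 powr t') ^ j * (K x powr t' * V x)"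
        using majorant[OF Aq_dual(1)[OF A]] unfolding t'_def V_def by blast
      define Z where "Z x = K x powr t' * V x" for x
      have Kp: "0 < K x" for x using A1D(1)[OF K(1)] by (simp add: pos_locintD)
      have Vp: "0 < V x" for x using pos_locintD(2)[OF Ul(2), of x] by (simp only: V_def)
      have "0 < (1 - \<eta>) * (q - q0) * (s * s0)" using qq \<eta>1 s by (intro mult_pos_pos) auto
      also have "\<dots> = t - t0" using t_diff by algebra
      finally have tt: "t0 < t" by simp
      have t1: "t - 1 = s * (q - 1)" "t0 - 1 = s0 * (q0 - 1)" by (auto simp: t_def t0_def)
      \<comment> \<open>With the dual weight V = U^(-1/(t-1)) in place of U, the exponents become
        those of \<open>A_weight_interpolate_A1\<close>.\<close>
      have eq: "(u x powr (q0 / q) * Z x powr (1 - q0 / q)) powr s0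
          = U x powr ((t0 - 1) / (t - 1)) * K x powr ((t - t0) / (t - 1))" for x
      proof -
        have e: "t' * (1 - q0 / q) * s0 = (t - t0) / (t - 1)"
          unfolding t'_def t_ss[symmetric] by (simp only: times_divide_eq_left)
        have "q0 / q - (1 - q0 / q) / (q - 1) = (q0 - 1) / (q - 1)"
          using nz by (simp add: divide_simps) (simp add: algebra_simps)
        moreover have "s * (- 1 / (t - 1)) = - 1 / (q - 1)" "s * ((t0 - 1) / (t - 1)) = s0 * ((q0 - 1) /
            (q - 1))"
          unfolding t1 using s by simp_all
        ultimately have e': "s0 * (q0 / q + s * (- 1 / (t - 1)) * (1 - q0 / q)) = s * ((t0 - 1) / (t - 1))"
        proof -
          assume a: "q0 / q - (1 - q0 / q) / (q - 1) = (q0 - 1) / (q - 1)"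
            "s * (- 1 / (t - 1)) = - 1 / (q - 1)" "s * ((t0 - 1) / (t - 1)) = s0 * ((q0 - 1) / (q - 1))"
          have "q0 / q + - 1 / (q - 1) * (1 - q0 / q) = q0 / q - (1 - q0 / q) / (q - 1)" by simp
          then show ?thesis unfolding a by simp
        qed
        show ?thesis unfolding Z_def V_def U_def powr_powr[of "u x" s] powr_mult_powr_combine e' e ..
      qed
      show ?thesis
      proof (rule exI[of _ Z], rule exI[of _ D], intro conjI allI)
        show "Z \<in> borel_measurable lebesgue"
        proof -
          note [measurable] = pos_locintD(1)[OF A1D(1)[OF K(1)]] pos_locintD(1)[OF Ul(2)]
          show ?thesis unfolding Z_def[abs_def] V_def by measurable
        qed
        show "0 < Z x" for x using Kp[of x] Vp[of x] by (simp add: Z_def)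
        show "(\<integral>\<^sup>+x. ennreal (Z x) \<partial>lebesgue) \<le> ennreal D" unfolding Z_def by (rule K(3))
        show "AE x in lebesgue. h j x \<le> \<kappa> ^ j * Z x" for j
          using K(4)[of j] False by (simp add: \<kappa>_def Z_def t'_def)
        show "A_RH q0 s0 (\<lambda>x. u x powr (q0 / q) * Z x powr (1 - q0 / q))"
          unfolding A_RH_def eq t0_def[symmetric]
        proof (intro conjI allI)
          show "0 < u x powr (q0 / q) * Z x powr (1 - q0 / q)" for x
            using up[of x] Kp[of x] Vp[of x] by (simp add: Z_def)
          show "A_weight t0 (\<lambda>x. U x powr ((t0 - 1) / (t - 1)) * K x powr ((t - t0) / (t - 1)))"
            by (rule A_weight_interpolate_A1[OF A K(1) t(2) tt])
        qed
      qed (rule K(2))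
    qed
  qed
  show ?thesis unfolding s0_def[symmetric]
  proof (rule exI[of _ \<kappa>], rule conjI[OF \<kappa>], rule allI, rule impI)
    fix h :: "nat \<Rightarrow> real^'n \<Rightarrow> real"
    assume a: "\<forall>j. h j \<in> borel_measurable lebesgue \<and> (\<forall>x. 0 \<le> h j x) \<and> (\<integral>\<^sup>+x. ennreal (h j x) \<partial>lebesgue) \<le> 1"
    show "\<exists>Z D. Z \<in> borel_measurable lebesgue \<and> (\<forall>x. 0 < Z x) \<and> 0 < D \<and> (\<integral>\<^sup>+x. ennreal (Z x) \<partial>lebesgue)
        \<le> ennreal D \<and>
      (\<forall>j. AE x in lebesgue. h j x \<le> \<kappa> ^ j * Z x) \<and>
      A_RH q0 s0 (\<lambda>x. u x powr (q0 / q) * Z x powr (1 - q0 / q))"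
      by (rule main) (use a in simp_all)
  qed
qed

section \<open>From the exponent q0 to the exponent q\<close>

lemma A_weight_pos_locint: "A_weight t U \<Longrightarrow> pos_locint U"
  by (auto simp: A_weight_def split: if_splits dest: A1D(1) AqD(2))

lemma A_RH_pos_locint:
  assumes u: "A_RH q s u" and s: "1 \<le> s"
  shows "pos_locint u"
proof -
  have "pos_locint (\<lambda>x. (u x powr s) powr (1 / s))"
    using u s by (intro pos_locint_powr_le A_weight_pos_locint) (auto simp: A_RH_def)
  moreover have "(u x powr s) powr (1 / s) = u x" for x
    using u s by (simp add: A_RH_def powr_powr less_imp_le)
  ultimately show ?thesis by simp
qed

text \<open>Strictness leaves room to replace A, which may be 0, by a positive real number that can
  serve as a divisor.\<close>

lemma ennreal_scale_between:
  assumes L: "0 < L" and less: "ennreal L * A < X"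
  shows "\<exists>a>0. A \<le> ennreal a \<and> ennreal (L * a) < X"
proof (cases A)
  case top
  then have "ennreal L * A = top" using L by (simp add: ennreal_mult_top ennreal_eq_0_iff)
  then show ?thesis using less by simp
next
  case (real A')
  obtain y where y: "ennreal L * A < y" "y < X" using dense[OF less] by blast
  then obtain y' where y': "y = ennreal y'" "0 \<le> y'" by (cases y) auto
  have "L * A' < y'" using y(1) real L y' by (simp add: ennreal_less_iff flip: ennreal_mult')
  then have "A' < y' / L" "L * (y' / L) = y'" using L by (auto simp: field_simps)
  then show ?thesis using real y(2) y'(1) by (intro exI[of _ "y' / L"]) (auto intro: ennreal_leI)
qed

text \<open>For q0 < q the function G is normalised by its own weighted integral, which may be
  infinite. Cutting off height and support makes it finite and keeps the violated
  inequality.\<close>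

lemma nn_integral_truncation:
  assumes [measurable]: "G \<in> borel_measurable lebesgue" and G: "\<And>x. 0 \<le> G x"
    and u: "pos_locint u" and q: "0 < q" and c: "c < (\<integral>\<^sup>+x. ennreal (G x powr q * u x) \<partial>lebesgue)"
  shows "\<exists>g \<in> borel_measurable lebesgue. (\<forall>x. 0 \<le> g x \<and> g x \<le> G x) \<and>
    c < (\<integral>\<^sup>+x. ennreal (g x powr q * u x) \<partial>lebesgue) \<and> (\<integral>\<^sup>+x. ennreal (g x powr q * u x) \<partial>lebesgue) < top"
proof -
  have [measurable]: "u \<in> borel_measurable lebesgue" using u by (simp add: pos_locintD)
  define g where "g n x = min (G x) (real n) * indicator (ball 0 (real n)) x" for n x
  have g: "0 \<le> g n x" "g n x \<le> G x" "g n x \<le> real n" for n x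
    using G[of x] by (auto simp: g_def indicator_def)
  have [measurable]: "g n \<in> borel_measurable lebesgue" for n unfolding g_def by measurable
  have inc: "incseq (\<lambda>n x. ennreal (g n x powr q * u x))"
  proof (intro incseq_SucI le_funI ennreal_leI mult_right_mono)
    fix n x
    have "g n x \<le> g (Suc n) x" using G[of x] by (auto simp: g_def indicator_def)
    then show "g n x powr q \<le> g (Suc n) x powr q" using q g by (intro powr_mono2) auto
  qed (use pos_locint_nonneg[OF u] in auto)
  have sup: "(SUP n. ennreal (g n x powr q * u x)) = ennreal (G x powr q * u x)" for x
  proof (rule antisym)
    show "(SUP n. ennreal (g n x powr q * u x)) \<le> ennreal (G x powr q * u x)"
      using g q pos_locint_nonneg[OF u] by (intro SUP_least ennreal_leI mult_right_mono powr_mono2) auto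
    obtain n where n: "max (G x) (norm x) < real n" using reals_Archimedean2 by blast
    then have "g n x = G x" by (auto simp: g_def)
    then show "ennreal (G x powr q * u x) \<le> (SUP n. ennreal (g n x powr q * u x))"
      by (intro SUP_upper2[of n]) auto
  qed
  have "(\<integral>\<^sup>+x. ennreal (G x powr q * u x) \<partial>lebesgue) = (SUP n. \<integral>\<^sup>+x. ennreal (g n x powr q * u x) \<partial>lebesgue)"
    unfolding sup[symmetric] by (rule nn_integral_monotone_convergence_SUP[OF inc]) measurable
  with c obtain n where n: "c < (\<integral>\<^sup>+x. ennreal (g n x powr q * u x) \<partial>lebesgue)"
    by (auto simp: less_SUP_iff)
  have "(\<integral>\<^sup>+x. ennreal (g n x powr q * u x) \<partial>lebesgue)
      \<le> (\<integral>\<^sup>+x. ennreal (real n powr q) * (ennreal (u x) * indicator (ball 0 (real n)) x) \<partial>lebesgue)"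
  proof (rule nn_integral_mono)
    fix x
    show "ennreal (g n x powr q * u x) \<le> ennreal (real n powr q) * (ennreal (u x) * indicator (ball 0
        (real n)) x)"
    proof (cases "x \<in> ball 0 (real n)")
      case True
      have "g n x powr q * u x \<le> real n powr q * u x"
        using g q pos_locint_nonneg[OF u] by (intro mult_right_mono powr_mono2) auto
      then show ?thesis using True by (simp add: ennreal_leI flip: ennreal_mult')
    qed (simp add: g_def)
  qed
  also have "\<dots> = ennreal (real n powr q) * wmeas u (ball 0 (real n))"
    unfolding wmeas_def by (rule nn_integral_cmult) measurable
  also have "\<dots> < top" using pos_locintD(3)[OF u] by (simp add: ennreal_mult_less_top)
  finally show ?thesis using n g by (intro bexI[of _ "g n"]) auto
qed

lemma powr_minus_cancel:
  fixes x :: real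
  assumes "0 < x"
  shows "x powr a * (x powr (- a) * y) = y" "x powr (- a) * (x powr a * y) = y"
  using assms by (simp_all add: powr_minus)

text \<open>A pointwise bound T \<le> c Z for an integrand T = F^q u or T = g^q u exchanges powers
  of T and Z in one direction; Hoelder's inequality against the integrable Z does the opposite for
  the other function. For q < q0 the majorant Z is built for F, for q > q0 for a truncation g of G.
  At q = 1 there is no majorant, as the maximal operator is unbounded on L^1; hence the assumption
  that q0 = 1 in that case.\<close>

theorem limited_range_extrapolation:
  fixes FG :: "((real^'n \<Rightarrow> real) \<times> (real^'n \<Rightarrow> real)) set" and q q0 \<eta> :: real
  assumes q: "1 \<le> q" "1 \<le> q0" "q = 1 \<Longrightarrow> q0 = 1" and \<eta>: "0 \<le> \<eta>" "\<eta> * q < 1" "\<eta> * q0 < 1"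
    and FG: "\<And>F G. (F, G) \<in> FG \<Longrightarrow> F \<in> borel_measurable lebesgue \<and> G \<in> borel_measurable lebesgue \<and> (\<forall>x. 0
        \<le> F x \<and> 0 \<le> G x)"
    and hyp: "\<And>v. A_RH q0 (1 / (1 - \<eta> * q0)) v \<Longrightarrow> \<exists>C\<ge>0. \<forall>(F, G) \<in> FG.
      (\<integral>\<^sup>+x. ennreal (G x powr q0 * v x) \<partial>lebesgue) \<le> ennreal C * (\<integral>\<^sup>+x. ennreal (F x powr q0 * v x) \<partial>lebesgue)"
    and u: "A_RH q (1 / (1 - \<eta> * q)) u"
  shows "\<exists>C\<ge>0. \<forall>(F, G) \<in> FG.
      (\<integral>\<^sup>+x. ennreal (G x powr q * u x) \<partial>lebesgue) \<le> ennreal C * (\<integral>\<^sup>+x. ennreal (F x powr q * u x) \<partial>lebesgue)"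
proof (cases "q0 = q")
  case True
  then show ?thesis using hyp[of u] u by simp
next
  case False
  then have q1: "1 < q" using q by force
  let ?I = "\<lambda>F. \<integral>\<^sup>+x. ennreal (F x powr q * u x) \<partial>lebesgue"
  have u_loc: "pos_locint u"
  proof (rule A_RH_pos_locint[OF u])
    show "1 \<le> 1 / (1 - \<eta> * q)" using \<eta> q1 by (simp add: pos_le_divide_eq)
  qed
  have u_pos: "0 < u x" for x using u_loc by (simp add: pos_locintD)
  have [measurable]: "u \<in> borel_measurable lebesgue" using u_loc by (simp add: pos_locintD)
  show ?thesis
  proof (rule ccontr)
    assume contra: "\<not> ?thesis"
    have viol: "\<exists>F G. (F, G) \<in> FG \<and> ennreal L * ?I F < ?I G" if "0 \<le> L" for L
    proof (rule ccontr)
      assume "\<not> ?thesis"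
      then have "?I G \<le> ennreal L * ?I F" if "(F, G) \<in> FG" for F G
        using that by (meson not_less)
      then show False using contra that by blast
    qed
    obtain \<kappa> where \<kappa>: "1 \<le> \<kappa>" and Z_ex: "\<And>h :: nat \<Rightarrow> real^'n \<Rightarrow> real.
      (\<And>j. h j \<in> borel_measurable lebesgue) \<Longrightarrow> (\<And>j x. 0 \<le> h j x) \<Longrightarrow> (\<And>j. (\<integral>\<^sup>+x. ennreal (h j x) \<partial>lebesgue) \<le> 1) \<Longrightarrow>
      (\<exists>Z D. Z \<in> borel_measurable lebesgue \<and> (\<forall>x. 0 < Z x) \<and> 0 < D \<and> (\<integral>\<^sup>+x. ennreal (Z x) \<partial>lebesgue) \<le>
          ennreal D \<and>
        (\<forall>j. AE x in lebesgue. h j x \<le> \<kappa> ^ j * Z x) \<and>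
        A_RH q0 (1 / (1 - \<eta> * q0)) (\<lambda>x. u x powr (q0 / q) * Z x powr (1 - q0 / q)))"
      using extrapolation_weight[OF q1 q(2) False \<eta> u] by auto
    have normalized: "(\<integral>\<^sup>+x. ennreal (f x powr q * u x / a) \<partial>lebesgue) \<le> 1"
      if "0 < a" "?I f \<le> ennreal a" and [measurable]: "f \<in> borel_measurable lebesgue" for f a
    proof -
      have "(\<integral>\<^sup>+x. ennreal (f x powr q * u x / a) \<partial>lebesgue) = (\<integral>\<^sup>+x. ennreal (1 / a) * ennreal (f x
          powr q * u x) \<partial>lebesgue)"
        using \<open>0 < a\<close> by (intro nn_integral_cong) (simp flip: ennreal_mult')
      also have "\<dots> = ennreal (1 / a) * ?I f" by (rule nn_integral_cmult) measurable
      also have "\<dots> \<le> ennreal (1 / a) * ennreal a" by (intro mult_left_mono that) simp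
      also have "\<dots> = 1" using \<open>0 < a\<close> by (simp flip: ennreal_mult')
      finally show ?thesis .
    qed
    have split_weight: "f x powr q0 * (u x powr (q0 / q) * z powr (1 - q0 / q)) = (f x powr q * u x)
        powr (q0 / q) * z powr (1 - q0 / q)"
      if "0 \<le> f x" for f x and z :: real
      using q1 by (simp add: powr_mult powr_powr)
    show False
    proof (cases "q < q0")
      case True
      \<comment> \<open>The estimate \<open>key\<close> has the constant C1 \<kappa>^j with C1
        independent of j, so the factor j + 1 eventually contradicts it.\<close>
      define L where "L j = \<kappa> ^ j * (real j + 1)" for j :: nat
      have L: "0 < L j" for j using \<kappa> by (auto simp: L_def)
      define P where "P j F G a \<longleftrightarrow> (F, G) \<in> FG \<and> 0 < a \<and> ?I F \<le> ennreal a \<and> ennreal (L j * a) < ?I G" for j F G a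
      have "\<exists>F G a. P j F G a" for j
      proof -
        obtain F G where FG': "(F, G) \<in> FG" "ennreal (L j) * ?I F < ?I G" using viol[OF less_imp_le[OF
            L[of j]]] by blast
        from ennreal_scale_between[OF L[of j] FG'(2)] FG'(1) show ?thesis unfolding P_def by blast
      qed
      then obtain F G a where "\<And>j. P j (F j) (G j) (a j)" by metis
      then have FGa: "\<And>j. (F j, G j) \<in> FG" "\<And>j. 0 < a j" "\<And>j. ?I (F j) \<le> ennreal (a j)"
        "\<And>j. ennreal (L j * a j) < ?I (G j)" unfolding P_def by auto
      have [measurable]: "F j \<in> borel_measurable lebesgue" "G j \<in> borel_measurable lebesgue" for j
        using FG[OF FGa(1)[of j]] by auto
      have F0: "0 \<le> F j x" for j x using FG[OF FGa(1)[of j]] by auto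
      obtain Z D where Z [measurable]: "Z \<in> borel_measurable lebesgue" and Zp: "\<And>x. 0 < Z x" and D: "0 < D"
        and Zint: "(\<integral>\<^sup>+x. ennreal (Z x) \<partial>lebesgue) \<le> ennreal D"
        and Zmaj: "\<And>j. AE x in lebesgue. F j x powr q * u x / a j \<le> \<kappa> ^ j * Z x"
        and Zw: "A_RH q0 (1 / (1 - \<eta> * q0)) (\<lambda>x. u x powr (q0 / q) * Z x powr (1 - q0 / q))"
        using Z_ex[of "\<lambda>j x. F j x powr q * u x / a j"] normalized[OF FGa(2,3)] FGa(2) u_pos
        by (auto simp: less_imp_le)
      define v where "v x = u x powr (q0 / q) * Z x powr (1 - q0 / q)" for x
      obtain C0 where C0: "0 \<le> C0" "\<forall>(F, G) \<in> FG. (\<integral>\<^sup>+x. ennreal (G x powr q0 * v x) \<partial>lebesgue)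
          \<le> ennreal C0 * (\<integral>\<^sup>+x. ennreal (F x powr q0 * v x) \<partial>lebesgue)"
        using hyp[OF Zw] unfolding v_def by blast
      define C1 where "C1 = (C0 + 1) powr (q / q0) * D powr (1 - q / q0)"
      have key: "?I (G j) \<le> ennreal (C1 * (\<kappa> ^ j * a j))" for j
      proof -
        let ?b = "a j * \<kappa> ^ j"
        have b: "0 < ?b" using FGa(2)[of j] \<kappa> by simp
        have "(\<integral>\<^sup>+x. ennreal (F j x powr q0 * v x) \<partial>lebesgue)
            \<le> (\<integral>\<^sup>+x. ennreal (?b powr (q0 / q - 1)) * ennreal (F j x powr q * u x) \<partial>lebesgue)"
        proof (rule nn_integral_mono_AE, use Zmaj[of j] in eventually_elim)
          case (elim x)
          let ?T = "F j x powr q * u x"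
          have T0: "0 \<le> ?T" using u_pos[of x] by simp
          have "?T \<le> ?b * Z x" using elim FGa(2)[of j] by (simp add: field_simps)
          then have le: "?T / Z x \<le> ?b" using Zp[of x] by (simp add: divide_le_eq)
          have "F j x powr q0 * v x = ?T powr (q0 / q) * Z x powr (1 - q0 / q)"
            unfolding v_def by (rule split_weight[OF F0])
          \<comment> \<open>One power of \<open>?T\<close> is kept for integration; the excess q0/q
            - 1 > 0 falls on \<open>?T / Z\<close>, which the majorant bounds.\<close>
          also have "\<dots> = (?T / Z x) powr (q0 / q - 1) * ?T"
          proof (cases "?T = 0")
            case False
            have "?T powr (q0 / q) = ?T powr (q0 / q - 1) * ?T powr 1"
              unfolding powr_add[symmetric] by simp
            moreover have "Z x powr (1 - q0 / q) = 1 / Z x powr (q0 / q - 1)"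
              using powr_minus_divide[of "Z x" "q0 / q - 1"] by simp
            ultimately show ?thesis using T0 by (simp add: powr_divide)
          next
            case True
            then show ?thesis by (simp only: True powr_zero_eq_one powr_0 mult_zero_left mult_zero_right)
          qed
          also have "\<dots> \<le> ?b powr (q0 / q - 1) * ?T"
          proof (intro mult_right_mono powr_mono2)
            show "0 \<le> q0 / q - 1" using \<open>q < q0\<close> q1 by simp
          qed (use le T0 Zp[of x] in \<open>auto intro: divide_nonneg_pos\<close>)
          finally show ?case using T0 by (simp add: ennreal_leI flip: ennreal_mult')
        qed
        also have "\<dots> = ennreal (?b powr (q0 / q - 1)) * ?I (F j)" by (rule nn_integral_cmult) measurable
        also have "\<dots> \<le> ennreal (?b powr (q0 / q - 1)) * ennreal (a j)" by (intro mult_left_mono FGa) simp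
        also have "\<dots> \<le> ennreal (?b powr (q0 / q - 1)) * ennreal ?b"
          using FGa(2)[of j] \<kappa> by (intro mult_left_mono ennreal_leI) auto
        also have "\<dots> = ennreal (?b powr (q0 / q))"
          using b by (simp add: powr_diff flip: ennreal_mult')
        finally have "(\<integral>\<^sup>+x. ennreal (F j x powr q0 * v x) \<partial>lebesgue) \<le> ennreal (?b powr (q0 / q))" .
        then have "ennreal C0 * (\<integral>\<^sup>+x. ennreal (F j x powr q0 * v x) \<partial>lebesgue) \<le> ennreal (C0 + 1) *
            ennreal (?b powr (q0 / q))"
          by (intro mult_mono ennreal_leI) auto
        moreover have "(\<integral>\<^sup>+x. ennreal (G j x powr q0 * v x) \<partial>lebesgue) \<le> ennreal C0 * (\<integral>\<^sup>+x. ennreal (F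
            j x powr q0 * v x) \<partial>lebesgue)"
          using C0(2) FGa(1)[of j] by fast
        ultimately have "(\<integral>\<^sup>+x. ennreal (G j x powr q0 * v x) \<partial>lebesgue) \<le> ennreal (C0 + 1) * ennreal
            (?b powr (q0 / q))"
          by (rule order_trans[rotated])
        also have "\<dots> = ennreal ((C0 + 1) * ?b powr (q0 / q))"
          by (rule ennreal_mult'[symmetric]) (use C0(1) in simp)
        finally have Gle: "(\<integral>\<^sup>+x. ennreal (G j x powr q0 * v x) \<partial>lebesgue) \<le> ennreal ((C0 + 1) * ?b powr
            (q0 / q))" .
        have [measurable]: "v \<in> borel_measurable lebesgue" unfolding v_def by measurable
        have vp: "0 < v x" for x using u_pos[of x] Zp[of x] by (simp add: v_def)
        \<comment> \<open>The power of Z inside v is compensated exactly by Z^(1 - q/q0), so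
          Hoelder's inequality with exponents q/q0 and 1 - q/q0 applies.\<close>
        have "?I (G j) = (\<integral>\<^sup>+x. ennreal ((G j x powr q0 * v x) powr (q / q0) * Z x powr (1 - q / q0))
            \<partial>lebesgue)"
        proof (rule nn_integral_cong)
          fix x
          have e: "(1 - q0 / q) * (q / q0) + (1 - q / q0) = 0" using q1 q(2) by (simp add: field_simps)
          have "(G j x powr q0 * v x) powr (q / q0) * Z x powr (1 - q / q0)
              = G j x powr (q0 * (q / q0)) * u x powr (q0 / q * (q / q0)) * (Z x powr ((1 - q0 / q) * (q
                  / q0)) * Z x powr (1 - q / q0))"
            unfolding v_def by (simp only: powr_mult powr_powr mult.assoc)
          also have "\<dots> = G j x powr q * u x"
            unfolding powr_add[symmetric] e using q1 q(2) Zp[of x] u_pos[of x] by simp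
          finally show "ennreal (G j x powr q * u x) = ennreal ((G j x powr q0 * v x) powr (q / q0) * Z
              x powr (1 - q / q0))" by simp
        qed
        also have "\<dots> \<le> ennreal (((C0 + 1) * ?b powr (q0 / q)) powr (q / q0) * D powr (1 - q / q0))"
        proof (rule nn_integral_Holder_le[OF _ _ _ _ _ _ _ _ D Gle Zint])
          show "0 < (C0 + 1) * ?b powr (q0 / q)" using FGa(2)[of j] \<kappa> C0(1) by (intro mult_pos_pos) auto
          show "0 \<le> G j x powr q0 * v x" "0 \<le> Z x" for x using vp[of x] Zp[of x] by (auto simp: less_imp_le)
          show "0 \<le> q / q0" "0 \<le> 1 - q / q0" "q / q0 + (1 - q / q0) = 1" using True q1 by auto
        qed measurable
        also have "((C0 + 1) * ?b powr (q0 / q)) powr (q / q0) * D powr (1 - q / q0) = C1 * (\<kappa> ^ j * a j)"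
          using b q1 q(2) by (simp add: C1_def powr_mult[of "C0 + 1"] powr_powr)
        finally show ?thesis .
      qed
      obtain j where j: "C1 < real j" using reals_Archimedean2 by blast
      have "C1 * (\<kappa> ^ j * a j) \<le> (real j + 1) * (\<kappa> ^ j * a j)"
        using j FGa(2)[of j] \<kappa> by (intro mult_right_mono) auto
      also have "\<dots> = L j * a j" by (simp add: L_def)
      finally have "?I (G j) \<le> ennreal (L j * a j)" using key[of j] by (meson ennreal_leI order_trans)
      then show False using FGa(4)[of j] by simp
    next
      case False
      then have qq: "q0 < q" using \<open>q0 \<noteq> q\<close> by simp
      let ?e = "1 - q0 / q"
      have e0: "0 < ?e" using qq q1 by simp
      \<comment> \<open>In this case \<open>key\<close> compares powers q0/q and loses \<kappa>^(j(1
        - q0/q)); the outer exponent q/q0 undoes that power.\<close>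
      define L where "L j = ((\<kappa> ^ j) powr ?e * (real j + 1)) powr (q / q0)" for j :: nat
      have \<kappa>p: "0 < \<kappa> ^ j" for j using \<kappa> by simp
      have L: "0 < L j" for j using \<kappa> unfolding L_def by auto
      define P where "P j F G g a b \<longleftrightarrow> (F, G) \<in> FG \<and> g \<in> borel_measurable lebesgue \<and> (\<forall>x. 0 \<le> g x \<and> g x \<le> G x) \<and>
          0 < a \<and> ?I F \<le> ennreal a \<and> ?I g = ennreal b \<and> L j * a < b" for j F G g a b
      have "\<exists>F G g a b. P j F G g a b" for j
      proof -
        obtain F G where FG': "(F, G) \<in> FG" "ennreal (L j) * ?I F < ?I G" using viol[OF less_imp_le[OF
            L[of j]]] by blast
        obtain g where g: "g \<in> borel_measurable lebesgue" "\<forall>x. 0 \<le> g x \<and> g x \<le> G x" "ennreal (L j) * ?I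
            F < ?I g" "?I g < top"
          using nn_integral_truncation[OF _ _ u_loc _ FG'(2)] FG[OF FG'(1)] q1 by auto
        obtain a where a: "0 < a" "?I F \<le> ennreal a" "ennreal (L j * a) < ?I g"
          using ennreal_scale_between[OF L g(3)] by blast
        obtain b where b: "?I g = ennreal b" "0 \<le> b" using g(4) by (cases "?I g") auto
        have "L j * a < b" using a(3) a(1) L[of j] unfolding b(1) by (simp add: ennreal_less_iff)
        then show ?thesis using FG' g a b unfolding P_def by blast
      qed
      then obtain F G g a b where "\<And>j. P j (F j) (G j) (g j) (a j) (b j)" by metis
      then have FGa: "\<And>j. (F j, G j) \<in> FG" "\<And>j. g j \<in> borel_measurable lebesgue"
        "\<And>j x. 0 \<le> g j x \<and> g j x \<le> G j x" "\<And>j. 0 < a j" "\<And>j. ?I (F j) \<le> ennreal (a j)" "\<And>j. ?I (g j) =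
            ennreal (b j)"
        "\<And>j. L j * a j < b j" unfolding P_def by auto
      have b: "0 < b j" for j using FGa(4,7)[of j] L[of j] by (meson less_trans mult_pos_pos)
      note FGa(2) [measurable]
      have [measurable]: "F j \<in> borel_measurable lebesgue" "G j \<in> borel_measurable lebesgue" for j
        using FG[OF FGa(1)[of j]] by auto
      have F0: "0 \<le> F j x" for j x using FG[OF FGa(1)[of j]] by auto
      have "(\<integral>\<^sup>+x. ennreal (g j x powr q * u x / b j) \<partial>lebesgue) \<le> 1" for j
        using normalized[OF b, of "g j" j] FGa(6)[of j] by simp
      then obtain Z D where Z [measurable]: "Z \<in> borel_measurable lebesgue" and Zp: "\<And>x. 0 < Z x" and D: "0 < D"
        and Zint: "(\<integral>\<^sup>+x. ennreal (Z x) \<partial>lebesgue) \<le> ennreal D"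
        and Zmaj: "\<And>j. AE x in lebesgue. g j x powr q * u x / b j \<le> \<kappa> ^ j * Z x"
        and Zw: "A_RH q0 (1 / (1 - \<eta> * q0)) (\<lambda>x. u x powr (q0 / q) * Z x powr (1 - q0 / q))"
        using Z_ex[of "\<lambda>j x. g j x powr q * u x / b j"] b u_pos
        by (auto simp: less_imp_le)
      define v where "v x = u x powr (q0 / q) * Z x powr (1 - q0 / q)" for x
      have [measurable]: "v \<in> borel_measurable lebesgue" unfolding v_def by measurable
      have vp: "0 < v x" for x using u_pos[of x] Zp[of x] by (simp add: v_def)
      obtain C0 where C0: "0 \<le> C0" "\<forall>(F, G) \<in> FG. (\<integral>\<^sup>+x. ennreal (G x powr q0 * v x) \<partial>lebesgue)
          \<le> ennreal C0 * (\<integral>\<^sup>+x. ennreal (F x powr q0 * v x) \<partial>lebesgue)"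
        using hyp[OF Zw] unfolding v_def by blast
      define C1 where "C1 = C0 * D powr ?e"
      have key: "b j powr (q0 / q) \<le> C1 * (\<kappa> ^ j) powr ?e * a j powr (q0 / q)" for j
      proof -
        let ?c = "b j * \<kappa> ^ j"
        have c: "0 < ?c" using b[of j] \<kappa>p[of j] by simp
        have "ennreal (?c powr (- ?e)) * ?I (g j) = (\<integral>\<^sup>+x. ennreal (?c powr (- ?e)) * ennreal (g j x
            powr q * u x) \<partial>lebesgue)"
          by (rule nn_integral_cmult[symmetric]) measurable
        also have "\<dots> \<le> (\<integral>\<^sup>+x. ennreal (g j x powr q0 * v x) \<partial>lebesgue)"
        proof (rule nn_integral_mono_AE, use Zmaj[of j] in eventually_elim)
          case (elim x)
          let ?T = "g j x powr q * u x"
          have T0: "0 \<le> ?T" using u_pos[of x] by simp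
          have le: "?T / ?c \<le> Z x" using elim b[of j] \<kappa>p[of j] by (simp add: field_simps)
          \<comment> \<open>The power of Z in v is now positive, so Z \<ge> T/c bounds v from
            below.\<close>
          have "?c powr (- ?e) * ?T = ?T powr (q0 / q) * (?T / ?c) powr ?e"
          proof (cases "?T = 0")
            case False
            have "?T powr (q0 / q) * ?T powr ?e = ?T powr 1" unfolding powr_add[symmetric] by simp
            then have "?T powr (q0 / q) * ?T powr ?e = ?T" using T0 by simp
            moreover have "?c powr (- ?e) = 1 / ?c powr ?e" by (rule powr_minus_divide)
            ultimately show ?thesis unfolding powr_divide by (metis mult.commute mult_1 times_divide_eq_right)
          next
            case True
            then show ?thesis by (simp only: True powr_0 mult_zero_left mult_zero_right)
          qed
          also have "\<dots> \<le> ?T powr (q0 / q) * Z x powr ?e"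
            using le c T0 e0 by (intro mult_left_mono powr_mono2 divide_nonneg_pos) auto
          also have "\<dots> = g j x powr q0 * v x"
            unfolding v_def using FGa(3)[of j x] by (intro split_weight[symmetric]) auto
          finally show ?case using T0 by (simp add: ennreal_leI flip: ennreal_mult')
        qed
        also have "\<dots> \<le> (\<integral>\<^sup>+x. ennreal (G j x powr q0 * v x) \<partial>lebesgue)"
          using FGa(3)[of j] vp q(2) by (intro nn_integral_mono ennreal_leI mult_right_mono powr_mono2)
              (auto simp: less_imp_le)
        also have "\<dots> \<le> ennreal C0 * (\<integral>\<^sup>+x. ennreal (F j x powr q0 * v x) \<partial>lebesgue)"
          using C0(2) FGa(1)[of j] by fast
        also have "(\<integral>\<^sup>+x. ennreal (F j x powr q0 * v x) \<partial>lebesgue)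
            = (\<integral>\<^sup>+x. ennreal ((F j x powr q * u x) powr (q0 / q) * Z x powr ?e) \<partial>lebesgue)"
          unfolding v_def using F0 by (intro nn_integral_cong arg_cong[where f=ennreal] split_weight) auto
        also have "ennreal C0 * \<dots> \<le> ennreal C0 * ennreal (a j powr (q0 / q) * D powr ?e)"
          using e0 q1 q(2) FGa(4)[of j] D u_pos Zp
          by (intro mult_left_mono nn_integral_Holder_le FGa(5) Zint) (auto simp: less_imp_le)
        finally have "?c powr (- ?e) * b j \<le> C0 * (a j powr (q0 / q) * D powr ?e)"
          unfolding FGa(6) using C0(1) by (simp flip: ennreal_mult')
        then have "?c powr ?e * (?c powr (- ?e) * b j) \<le> ?c powr ?e * (C0 * (a j powr (q0 / q) * D powr ?e))"
          by (intro mult_left_mono) auto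
        moreover have "?c powr ?e * (?c powr (- ?e) * b j) = b j"
          by (rule powr_minus_cancel[OF c])
        ultimately have "b j \<le> b j powr ?e * ((\<kappa> ^ j) powr ?e * (C0 * (a j powr (q0 / q) * D powr ?e)))"
          by (simp only: powr_mult mult.assoc)
        then have m1: "b j powr (- ?e) * b j \<le> b j powr (- ?e) * (b j powr ?e * ((\<kappa> ^ j) powr ?e * (C0 *
            (a j powr (q0 / q) * D powr ?e))))"
          by (rule mult_left_mono) simp
        have m2: "b j powr (- ?e) * b j = b j powr (q0 / q)"
        proof -
          have "b j powr (- ?e) * b j powr 1 = b j powr (q0 / q)" unfolding powr_add[symmetric] by simp
          then show ?thesis using b[of j] by simp
        qed
        show ?thesis
          using m1 unfolding m2 powr_minus_cancel(2)[OF b] unfolding C1_def by (simp only: mult_ac)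
      qed
      obtain j where j: "C1 < real j" using reals_Archimedean2 by blast
      have "(L j * a j) powr (q0 / q) < b j powr (q0 / q)"
        using FGa(4,7)[of j] L[of j] q1 q(2) by (intro powr_less_mono2) auto
      also have "\<dots> \<le> C1 * (\<kappa> ^ j) powr ?e * a j powr (q0 / q)" by (rule key)
      also have "\<dots> \<le> (real j + 1) * (\<kappa> ^ j) powr ?e * a j powr (q0 / q)"
        using j by (intro mult_right_mono) auto
      also have "\<dots> = (L j * a j) powr (q0 / q)"
        using q1 q(2) unfolding L_def powr_mult[of _ "a j"] powr_powr by (simp add: add_nonneg_nonneg
            mult.commute)
      finally show False by simp
    qed
  qed
qed

section \<open>Weights adapted to a Morrey norm\<close>

lemma vol_eq: "0 < t \<Longrightarrow> vol (x :: real^'n) t = vol (0 :: real^'n) 1 * t powr real CARD('n)"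
  using vol_scale[of 1 t x "0 :: real^'n"] by (simp add: powr_realpow mult.commute)

text \<open>Growth of the mass with exponent k turns into growth of t^a v^b with exponent a + k b.
  Positivity of this exponent is the form in which the conditions on \<lambda> and \<alpha> are
  used.\<close>

lemma powr_ratio_bound:
  fixes t T :: real
  assumes t: "0 < t" "0 < T" and v: "0 \<le> v" "v \<le> A * (t / T) powr k * V" and nn: "0 \<le> A" "0 \<le> V" "0 \<le> b"
  shows "t powr a * v powr b \<le> A powr b * (t / T) powr (a + k * b) * (T powr a * V powr b)"
proof -
  have "t powr a = (t / T) powr a * T powr a" using t by (simp add: powr_divide)
  moreover have "v powr b \<le> (A * (t / T) powr k * V) powr b" using v nn by (intro powr_mono2) auto
  moreover have "(A * (t / T) powr k * V) powr b = A powr b * (t / T) powr (k * b) * V powr b"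
    by (simp only: powr_mult powr_powr)
  ultimately have "t powr a * v powr b \<le> ((t / T) powr a * T powr a) * (A powr b * (t / T) powr (k * b)
      * V powr b)"
    by (metis mult_left_mono powr_ge_zero)
  also have "\<dots> = A powr b * (t / T) powr (a + k * b) * (T powr a * V powr b)"
    unfolding powr_add by (simp only: mult_ac)
  finally show ?thesis .
qed

lemma powr_le_one_of_le:
  fixes t T :: real
  shows "0 < t \<Longrightarrow> t \<le> T \<Longrightarrow> 0 \<le> a \<Longrightarrow> (t / T) powr a \<le> 1"
  using powr_mono2[of a "t / T" 1] by simp

text \<open>In the application \<open>b = \<lambda>\<^sub>2/n\<close>, \<open>k0 = n(1-1/\<sigma>)\<close> for some \<open>\<sigma>\<close> with \<open>w \<in> RH\<^sub>\<sigma>\<close>,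
  \<open>k1 = n\<theta>\<close> and \<open>\<beta> = \<alpha>(1-\<lambda>\<^sub>2/n)\<close>.\<close>

locale morrey_weight =
  fixes w :: "real^'n \<Rightarrow> real" and D K Cr k0 Crh s Ct k1 l1 b \<beta> :: real
  assumes w: "pos_locint w"
    and D: "1 \<le> D" "0 \<le> K"
    and dbl: "\<And>x r y R. ball x r \<subseteq> ball y R \<Longrightarrow> 0 < r \<Longrightarrow> 0 < R \<Longrightarrow> mass w y R \<le> D * (R / r) powr K * mass w x r"
    and Cr: "1 \<le> Cr"
    and rd: "\<And>x r R. 0 < r \<Longrightarrow> r \<le> R \<Longrightarrow> mass w x r \<le> Cr * (r / R) powr k0 * mass w x R"
    and s: "1 \<le> s" and ws: "pos_locint (\<lambda>x. w x powr s)" and Crh: "0 < Crh"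
    and rh: "\<And>x r. 0 < r \<Longrightarrow> avg (\<lambda>x. w x powr s) x r \<le> Crh * avg w x r powr s"
    and Ct: "1 \<le> Ct" and k1: "0 \<le> k1"
    and th: "\<And>r R. 0 < r \<Longrightarrow> r \<le> R \<Longrightarrow> mass w 0 r \<le> Ct * (r / R) powr k1 * mass w 0 R"
    and b: "0 \<le> b" "b \<le> 1" and \<beta>: "0 \<le> \<beta>"
    and E1: "0 < l1 + k0 * b" and E2: "\<beta> < l1 + k1 * b"
    and E3: "0 < real CARD('n) * (1 - s) - s * l1 + k0 * (s * (1 - b))"
begin

text \<open>Since \<open>v = \<bar>x\<bar>^\<alpha> w\<close> satisfies \<open>v(B(x,t)) \<approx> max(\<bar>x\<bar>,t)^\<alpha> w(B(x,t))\<close>, the bound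
  \<open>\<integral> f^p w \<lesssim> \<Theta>(B)\<close> over all balls is equivalent to a bound on the Morrey norm of \<open>f\<close> with respect to \<open>v\<close>.
  This removes the power weight from the construction of the weights below.\<close>

definition Theta :: "real^'n \<Rightarrow> real \<Rightarrow> real" where
  "Theta x t = max (norm x) t powr (- \<beta>) * (t powr l1 * mass w x t powr b)"

definition C_comp :: "real \<Rightarrow> real" where
  "C_comp k = k powr \<bar>l1\<bar> * (D * k powr K) powr b"

definition C_mono :: real where
  "C_mono = Cr powr b * (Ct * D * 4 powr K) powr b"

section \<open>Growth of the function Theta\<close>

lemma mass_w_pos: "0 < t \<Longrightarrow> 0 < mass w x t"
  by (rule mass_pos[OF w])

lemma Theta_pos: "0 < t \<Longrightarrow> 0 < Theta x t"
  using mass_w_pos[of t x] by (auto simp: Theta_def intro!: mult_pos_pos)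

lemma C_comp_pos: "0 < k \<Longrightarrow> 0 < C_comp k"
  using D by (auto simp: C_comp_def intro!: mult_pos_pos)

lemma C_mono_ge: "1 \<le> C_mono"
proof -
  have "1 \<le> Cr powr b" using Cr b by (simp add: ge_one_powr_ge_zero)
  moreover have "1 \<le> Ct * D * 4 powr K"
    using Ct D ge_one_powr_ge_zero[of 4 K] mult_mono[of 1 Ct 1 D] mult_mono[of 1 "Ct * D" 1 "4 powr K"] by simp
  then have "1 \<le> (Ct * D * 4 powr K) powr b" using b by (simp add: ge_one_powr_ge_zero)
  ultimately show ?thesis
    using mult_mono[of 1 "Cr powr b" 1 "(Ct * D * 4 powr K) powr b"] by (simp add: C_mono_def)
qed

lemma mass_mono_w: "ball x r \<subseteq> ball y R \<Longrightarrow> mass w x r \<le> mass w y R"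
  by (rule mass_mono[OF w])

text \<open>The factor with \<beta> decreases in t since \<beta> \<ge> 0; the other two factors are
  compared exactly.\<close>

lemma Theta_upper:
  assumes t: "0 < t" "t \<le> T"
  shows "Theta x T \<le> (T / t) powr l1 * (mass w x T / mass w x t) powr b * Theta x t"
proof -
  have "max (norm x) T powr (- \<beta>) \<le> max (norm x) t powr (- \<beta>)"
    using t \<beta> by (intro powr_mono2') auto
  then have "Theta x T \<le> max (norm x) t powr (- \<beta>) * (T powr l1 * mass w x T powr b)"
    unfolding Theta_def by (rule mult_right_mono) simp
  also have "\<dots> = (T / t) powr l1 * (mass w x T / mass w x t) powr b * Theta x t"
    using t mass_w_pos[of t x] unfolding Theta_def powr_divide by simp
  finally show ?thesis .
qed

lemma Theta_comp:
  assumes t: "0 < t" "t \<le> T" "T \<le> k * t"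
  shows "Theta x T \<le> C_comp k * Theta x t"
proof -
  have k: "T / t \<le> k" "1 \<le> T / t" using t by (auto simp: field_simps)
  have "(T / t) powr l1 \<le> (T / t) powr \<bar>l1\<bar>" using k by (intro powr_mono) auto
  also have "\<dots> \<le> k powr \<bar>l1\<bar>" using k by (intro powr_mono2) auto
  finally have 1: "(T / t) powr l1 \<le> k powr \<bar>l1\<bar>" .
  have "mass w x T \<le> D * (T / t) powr K * mass w x t" using t by (intro dbl subset_ball) auto
  also have "\<dots> \<le> D * k powr K * mass w x t"
    using k D mass_w_pos[OF t(1), of x] by (intro mult_right_mono mult_left_mono powr_mono2) auto
  finally have "mass w x T / mass w x t \<le> D * k powr K" using mass_w_pos[OF t(1), of x] by (simp add:
      pos_divide_le_eq)
  then have 2: "(mass w x T / mass w x t) powr b \<le> (D * k powr K) powr b"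
    using b by (intro powr_mono2) auto
  have "Theta x T \<le> (T / t) powr l1 * (mass w x T / mass w x t) powr b * Theta x t" by (rule
      Theta_upper[OF t(1,2)])
  also have "\<dots> \<le> C_comp k * Theta x t"
    unfolding C_comp_def using 1 2 Theta_pos[OF t(1), of x] by (intro mult_right_mono mult_mono) auto
  finally show ?thesis .
qed

text \<open>Up to radius |x| the factor with \<beta> is constant, so reverse doubling of w gives
  growth with exponent l1 + k0 b, positive by \<open>E1\<close>.\<close>

lemma Theta_mono_near:
  assumes t: "0 < t" "t \<le> T" "T \<le> norm x"
  shows "Theta x t \<le> Cr powr b * Theta x T"
proof -
  have T: "0 < T" using t by simp
  have "t powr l1 * mass w x t powr b \<le> Cr powr b * (t / T) powr (l1 + k0 * b) * (T powr l1 * mass w x T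
      powr b)"
    using t T Cr b mass_w_pos[OF T, of x] mass_w_pos[OF t(1), of x] by (intro powr_ratio_bound rd) auto
  also have "\<dots> \<le> Cr powr b * 1 * (T powr l1 * mass w x T powr b)"
    using powr_le_one_of_le[OF t(1,2), of "l1 + k0 * b"] E1 by (intro mult_right_mono mult_left_mono) auto
  finally have "max (norm x) t powr (- \<beta>) * (t powr l1 * mass w x t powr b)
      \<le> max (norm x) t powr (- \<beta>) * (Cr powr b * 1 * (T powr l1 * mass w x T powr b))"
    by (rule mult_left_mono) simp
  moreover have "max (norm x) t = norm x" "max (norm x) T = norm x" using t by auto
  ultimately show ?thesis by (simp add: Theta_def mult_ac)
qed

text \<open>Beyond radius |x| balls about x and about 0 are comparable, so the growth rate k1 at the
  origin applies. The exponent l1 - \<beta> + k1 b is positive by \<open>E2\<close>.\<close>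

lemma Theta_mono_far:
  assumes t: "0 < t" "t \<le> T" "norm x \<le> t"
  shows "Theta x t \<le> (Ct * D * 4 powr K) powr b * Theta x T"
proof -
  have T: "0 < T" using t by simp
  have "mass w x t \<le> mass w 0 (2 * t)" using t by (intro mass_mono_w) (simp add: ball_subset_ball_iff)
  also have "\<dots> \<le> Ct * (2 * t / (3 * T)) powr k1 * mass w 0 (3 * T)" using t by (intro th) auto
  also have "\<dots> \<le> Ct * (t / T) powr k1 * mass w 0 (3 * T)"
    using t T k1 Ct by (intro mult_right_mono mult_left_mono powr_mono2) (auto simp: field_simps)
  also have "\<dots> \<le> Ct * (t / T) powr k1 * mass w x (4 * T)"
    using t T Ct by (intro mult_left_mono mass_mono_w) (auto simp: ball_subset_ball_iff)
  also have "\<dots> \<le> Ct * (t / T) powr k1 * (D * (4 * T / T) powr K * mass w x T)"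
    using T Ct by (intro mult_left_mono dbl subset_ball) auto
  also have "\<dots> = (Ct * D * 4 powr K) * (t / T) powr k1 * mass w x T" using T by simp
  finally have le: "mass w x t \<le> (Ct * D * 4 powr K) * (t / T) powr k1 * mass w x T" .
  have C0: "0 \<le> Ct * D * 4 powr K" using Ct D by simp
  have "t powr (l1 - \<beta>) * mass w x t powr b
      \<le> (Ct * D * 4 powr K) powr b * (t / T) powr ((l1 - \<beta>) + k1 * b) * (T powr (l1 - \<beta>) * mass w x T powr b)"
    using t T C0 b by (intro powr_ratio_bound le) auto
  also have "\<dots> \<le> (Ct * D * 4 powr K) powr b * 1 * (T powr (l1 - \<beta>) * mass w x T powr b)"
    using powr_le_one_of_le[OF t(1,2), of "(l1 - \<beta>) + k1 * b"] E2 by (intro mult_right_mono mult_left_mono) auto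
  finally have le2: "t powr (l1 - \<beta>) * mass w x t powr b \<le> (Ct * D * 4 powr K) powr b * (T powr (l1 - \<beta>)
      * mass w x T powr b)"
    by simp
  have "Theta x \<rho> = \<rho> powr (l1 - \<beta>) * mass w x \<rho> powr b" if "norm x \<le> \<rho>" for \<rho>
  proof -
    have "max (norm x) \<rho> = \<rho>" using that by simp
    then show ?thesis unfolding Theta_def by (simp add: mult_ac flip: powr_add)
  qed
  then show ?thesis using le2 t by simp
qed

text \<open>The two regimes meet at radius |x|, whence the product of constants in
  \<open>C_mono\<close>.\<close>

lemma Theta_mono:
  assumes t: "0 < t" "t \<le> T"
  shows "Theta x t \<le> C_mono * Theta x T"
proof -
  have c: "1 \<le> Cr powr b" "1 \<le> (Ct * D * 4 powr K) powr b"
  proof -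
    show "1 \<le> Cr powr b" using Cr b by (simp add: ge_one_powr_ge_zero)
    have "1 \<le> Ct * D * 4 powr K"
      using Ct D ge_one_powr_ge_zero[of 4 K] mult_mono[of 1 Ct 1 D] mult_mono[of 1 "Ct * D" 1 "4 powr
          K"] by simp
    then show "1 \<le> (Ct * D * 4 powr K) powr b" using b by (simp add: ge_one_powr_ge_zero)
  qed
  have Tp: "0 < T" using t by simp
  consider "T \<le> norm x" | "norm x \<le> t" | "t < norm x" "norm x < T" by linarith
  then show ?thesis
  proof cases
    case 1
    have "Theta x t \<le> Cr powr b * 1 * Theta x T" using Theta_mono_near[OF t 1] by simp
    also have "\<dots> \<le> C_mono * Theta x T"
      unfolding C_mono_def using c Theta_pos[OF Tp, of x] by (intro mult_right_mono mult_left_mono) auto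
    finally show ?thesis .
  next
    case 2
    have "Theta x t \<le> 1 * (Ct * D * 4 powr K) powr b * Theta x T" using Theta_mono_far[OF t 2] by simp
    also have "\<dots> \<le> C_mono * Theta x T"
      unfolding C_mono_def using c Theta_pos[OF Tp, of x] by (intro mult_right_mono) auto
    finally show ?thesis .
  next
    case 3
    have "Theta x t \<le> Cr powr b * Theta x (norm x)" using 3 t by (intro Theta_mono_near) auto
    also have "\<dots> \<le> Cr powr b * ((Ct * D * 4 powr K) powr b * Theta x T)"
      using 3 t by (intro mult_left_mono Theta_mono_far) auto
    finally show ?thesis by (simp add: C_mono_def mult.assoc)
  qed
qed

text \<open>The ball of radius t about 0 lies in the ball of radius 4t about x, and the factor with
  \<beta> changes by at most 3^\<beta>.\<close>

lemma Theta_origin: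
  assumes t: "0 < t" and x: "norm x \<le> 3 * t"
  shows "Theta 0 t \<le> 3 powr \<beta> * (D * 4 powr K) powr b * Theta x t"
proof -
  have "mass w 0 t \<le> mass w x (4 * t)" using t x by (intro mass_mono_w) (auto simp: ball_subset_ball_iff)
  also have "\<dots> \<le> D * (4 * t / t) powr K * mass w x t" using t by (intro dbl subset_ball) auto
  finally have "mass w 0 t powr b \<le> (D * 4 powr K * mass w x t) powr b" using b t by (intro powr_mono2) auto
  also have "\<dots> = (D * 4 powr K) powr b * mass w x t powr b" by (rule powr_mult)
  finally have 1: "mass w 0 t powr b \<le> (D * 4 powr K) powr b * mass w x t powr b" .
  have "t powr (- \<beta>) = 3 powr \<beta> * (3 * t) powr (- \<beta>)" unfolding powr_mult by (simp add: powr_minus)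
  also have "\<dots> \<le> 3 powr \<beta> * max (norm x) t powr (- \<beta>)"
    using t x \<beta> by (intro mult_left_mono powr_mono2') auto
  finally have 2: "t powr (- \<beta>) \<le> 3 powr \<beta> * max (norm x) t powr (- \<beta>)" .
  have "Theta 0 t = t powr (- \<beta>) * (t powr l1 * mass w 0 t powr b)" using t by (simp add: Theta_def max_def)
  also have "\<dots> \<le> (3 powr \<beta> * max (norm x) t powr (- \<beta>)) * (t powr l1 * ((D * 4 powr K) powr b * mass w x
      t powr b))"
    by (intro mult_mono 2 mult_left_mono 1) auto
  finally show ?thesis by (simp add: Theta_def mult_ac)
qed

text \<open>Half of the margin in \<open>E3\<close>, divided by s. This half is spent on the decay
  of the profile; the other half is left over as \<open>decay_exp\<close>.\<close>

definition \<epsilon> :: real where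
  "\<epsilon> = (real CARD('n) * (1 - s) - s * l1 + k0 * (s * (1 - b))) / (2 * s)"

lemma eps_pos: "0 < \<epsilon>"
  using E3 s by (simp add: \<epsilon>_def)

definition decay_exp :: real where "decay_exp = s * \<epsilon>"

lemma decay_exp_pos: "0 < decay_exp"
  using eps_pos s by (simp add: decay_exp_def)

lemma decay_exp_eq: "decay_exp = real CARD('n) * (1 - s) - s * (\<epsilon> + l1) + k0 * (s * (1 - b))"
proof -
  have "2 * (s * \<epsilon>) = real CARD('n) * (1 - s) - s * l1 + k0 * (s * (1 - b))"
    using s by (simp add: \<epsilon>_def)
  then show ?thesis unfolding decay_exp_def distrib_left by linarith
qed

text \<open>The weight \<open>w psi x r\<close> dominates \<open>w/\<Theta>(x,r)\<close> on \<open>B(x,r)\<close>, while the factor \<open>(r/t)^\<epsilon>\<close> makes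
  its integral against \<open>f^p\<close> converge over dyadic annuli.\<close>

definition psi_profile :: "real^'n \<Rightarrow> real \<Rightarrow> real \<Rightarrow> real" where
  "psi_profile x r t = (r / t) powr \<epsilon> / Theta x t"

definition psi :: "real^'n \<Rightarrow> real \<Rightarrow> real^'n \<Rightarrow> real" where
  "psi x r y = psi_profile x r (dist y x + r)"

lemma psi_profile_pos: "0 < r \<Longrightarrow> 0 < t \<Longrightarrow> 0 < psi_profile x r t"
  using Theta_pos[of t x] by (simp add: psi_profile_def)

lemma psi_pos: "0 < r \<Longrightarrow> 0 < psi x r y"
  unfolding psi_def by (rule psi_profile_pos) (simp_all add: add_nonneg_pos)

lemma psi_profile_antimono:
  assumes r: "0 < r" and t: "0 < t" "t \<le> T"
  shows "psi_profile x r T \<le> C_mono * psi_profile x r t"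
proof -
  have p: "0 < Theta x t" "0 < Theta x T" using Theta_pos t by auto
  have "Theta x t \<le> C_mono * Theta x T" by (rule Theta_mono[OF t])
  then have "1 / Theta x T \<le> C_mono / Theta x t" using p by (simp add: divide_simps mult.commute)
  moreover have "(r / T) powr \<epsilon> \<le> (r / t) powr \<epsilon>"
    using r t eps_pos by (intro powr_mono2) (auto simp: divide_left_mono)
  ultimately have "(r / T) powr \<epsilon> * (1 / Theta x T) \<le> (r / t) powr \<epsilon> * (C_mono / Theta x t)"
    using p by (intro mult_mono) auto
  then show ?thesis by (simp add: psi_profile_def mult_ac)
qed

lemma psi_profile_comp:
  assumes r: "0 < r" and t: "0 < t" "t \<le> T" "T \<le> k * t"
  shows "psi_profile x r t \<le> k powr \<epsilon> * C_comp k * psi_profile x r T"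
proof -
  have p: "0 < Theta x t" "0 < Theta x T" using Theta_pos t by auto
  have k: "0 < k" using t by (metis less_le_trans mult.commute mult_pos_neg not_less_iff_gr_or_eq
      mult_zero_left order_less_irrefl)
  have "Theta x T \<le> C_comp k * Theta x t" by (rule Theta_comp[OF t])
  then have 1: "1 / Theta x t \<le> C_comp k / Theta x T" using p by (simp add: divide_simps mult.commute)
  have "r / t \<le> k * (r / T)" using r t by (simp add: divide_simps mult.commute mult_left_mono)
  then have "(r / t) powr \<epsilon> \<le> (k * (r / T)) powr \<epsilon>" using r t eps_pos by (intro powr_mono2) auto
  also have "\<dots> = k powr \<epsilon> * (r / T) powr \<epsilon>" by (rule powr_mult)
  finally have "(r / t) powr \<epsilon> * (1 / Theta x t) \<le> (k powr \<epsilon> * (r / T) powr \<epsilon>) * (C_comp k / Theta x T)"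
    using 1 p by (intro mult_mono) auto
  then show ?thesis by (simp add: psi_profile_def mult_ac)
qed

text \<open>The mass ratio is kept rather than estimated by doubling:
  \<open>Q_psi_profile_decay\<close> cancels it against part of the mass in \<open>Q\<close>,
  without loss in the exponent.\<close>

lemma psi_profile_ratio:
  assumes r: "0 < r" and t: "0 < t" "t \<le> T"
  shows "psi_profile x r t \<le> (T / t) powr (\<epsilon> + l1) * (mass w x T / mass w x t) powr b * psi_profile x r T"
proof -
  have p: "0 < Theta x t" "0 < Theta x T" using Theta_pos t by auto
  have "Theta x T \<le> (T / t) powr l1 * (mass w x T / mass w x t) powr b * Theta x t" by (rule Theta_upper[OF t])
  then have 1: "1 / Theta x t \<le> (T / t) powr l1 * (mass w x T / mass w x t) powr b / Theta x T" using p
      by (simp add: divide_simps mult.commute)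
  have "r / t = (T / t) * (r / T)" using t by simp
  then have "(r / t) powr \<epsilon> = (T / t) powr \<epsilon> * (r / T) powr \<epsilon>" by (simp only: powr_mult)
  then have "(r / t) powr \<epsilon> * (1 / Theta x t) \<le> ((T / t) powr \<epsilon> * (r / T) powr \<epsilon>) * ((T / t) powr l1 *
      (mass w x T / mass w x t) powr b / Theta x T)"
    using 1 p by (intro mult_mono) auto
  then show ?thesis by (simp add: psi_profile_def powr_add mult_ac)
qed

text \<open>Up to a constant this is vol times avg^s, the bound that the reverse Hoelder inequality
  gives for the integral of w^s over the ball.\<close>

definition Q :: "real^'n \<Rightarrow> real \<Rightarrow> real" where
  "Q x t = t powr (real CARD('n) * (1 - s)) * mass w x t powr s"

lemma vol_avg_Q:
  assumes "0 < t"
  shows "vol x t * avg w x t powr s = vol (0 :: real^'n) 1 powr (1 - s) * Q x t"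
proof -
  define V where "V = vol x t"
  have V: "0 < V" and o: "0 < vol (0 :: real^'n) 1" using assms by (auto simp: V_def)
  have "V * avg w x t powr s = V powr (1 + - s) * mass w x t powr s"
    using V unfolding avg_def V_def[symmetric] powr_divide powr_add by (simp add: powr_minus_divide)
  also have "V powr (1 + - s) = vol (0 :: real^'n) 1 powr (1 - s) * t powr (real CARD('n) * (1 - s))"
    unfolding V_def vol_eq[OF assms, of x] powr_mult powr_powr by simp
  finally show ?thesis by (simp add: Q_def V_def mult_ac)
qed

text \<open>The profile costs (T/t)^(s(\<epsilon> + l1)) and the mass ratio to the power s b. Of the
  power s of the mass in \<open>Q\<close> the part s(1 - b) survives, and reverse doubling with rate
  k0 applies to it; the exponents add up to \<open>decay_exp\<close>.\<close>

lemma Q_psi_profile_decay: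
  assumes r: "0 < r" and t: "0 < t" "t \<le> T"
  shows "Q x t * psi_profile x r t powr s \<le> Cr powr (s * (1 - b)) * (t / T) powr decay_exp * (Q x T *
      psi_profile x r T powr s)"
proof -
  have T: "0 < T" using t by simp
  let ?n = "real CARD('n)"
  let ?a = "?n * (1 - s) - s * (\<epsilon> + l1)"
  have w_pos: "0 < mass w x t" "0 < mass w x T" using mass_w_pos t T by auto
  have s0: "0 \<le> s" using s by simp
  have "psi_profile x r t powr s \<le> ((T / t) powr (\<epsilon> + l1) * (mass w x T / mass w x t) powr b *
      psi_profile x r T) powr s"
    using psi_profile_ratio[OF r t, of x] psi_profile_pos[OF r t(1), of x] s by (intro powr_mono2) auto
  also have "\<dots> = (T / t) powr ((\<epsilon> + l1) * s) * (mass w x T / mass w x t) powr (b * s) * psi_profile x r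
      T powr s"
    by (simp only: powr_mult powr_powr)
  finally have "Q x t * psi_profile x r t powr s \<le> Q x t * ((T / t) powr ((\<epsilon> + l1) * s) * (mass w x T /
      mass w x t) powr (b * s) * psi_profile x r T powr s)"
    by (rule mult_left_mono) (simp add: Q_def)
  also have "\<dots> = (t powr ?a * mass w x t powr (s * (1 - b))) * (T powr (s * (\<epsilon> + l1)) * mass w x T powr
      (s * b) * psi_profile x r T powr s)"
  proof -
    have "t powr ?a = t powr (?n * (1 - s)) / t powr ((\<epsilon> + l1) * s)" by (simp only: powr_diff
        mult.commute[of s])
    moreover have "mass w x t powr (s * (1 - b)) = mass w x t powr s / mass w x t powr (b * s)"
      by (simp only: right_diff_distrib mult_1_right powr_diff mult.commute[of s b])
    ultimately show ?thesis unfolding Q_def powr_divide by (simp add: mult_ac)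
  qed
  also have "\<dots> \<le> (Cr powr (s * (1 - b)) * (t / T) powr (?a + k0 * (s * (1 - b))) * (T powr ?a * mass w x
      T powr (s * (1 - b))))
       * (T powr (s * (\<epsilon> + l1)) * mass w x T powr (s * b) * psi_profile x r T powr s)"
    using t T Cr b s0 w_pos by (intro mult_right_mono powr_ratio_bound rd) auto
  also have "\<dots> = Cr powr (s * (1 - b)) * (t / T) powr decay_exp * ((T powr ?a * T powr (s * (\<epsilon> + l1))) *
       (mass w x T powr (s * (1 - b)) * mass w x T powr (s * b)) * psi_profile x r T powr s)"
    unfolding decay_exp_eq by (simp only: mult_ac)
  also have "T powr ?a * T powr (s * (\<epsilon> + l1)) = T powr (?n * (1 - s))"
    unfolding powr_add[symmetric] by simp
  also have "mass w x T powr (s * (1 - b)) * mass w x T powr (s * b) = mass w x T powr s"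
    unfolding powr_add[symmetric] by (simp add: right_diff_distrib)
  finally show ?thesis unfolding Q_def .
qed

end

section \<open>Geometric series and dyadic shells\<close>

lemma suminf_ennreal_geometric:
  fixes X h :: real
  assumes "0 \<le> X" "0 \<le> h" "h < 1"
  shows "(\<Sum>i. ennreal (X * h ^ i)) = ennreal (X / (1 - h))"
proof -
  have "(\<Sum>i. X * h ^ i) = X / (1 - h)"
    using assms by (simp add: suminf_mult suminf_geometric summable_geometric)
  then show ?thesis
    using assms by (subst suminf_ennreal2) (auto intro!: summable_mult summable_geometric)
qed

lemma ennreal_mult_cong: "0 \<le> a \<Longrightarrow> a * b = c \<Longrightarrow> ennreal a * ennreal b = ennreal c"
  by (auto simp: ennreal_mult')

lemma dyadic_shell_below:
  fixes \<rho> T :: real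
  assumes "0 < \<rho>" "\<rho> < T"
  shows "\<exists>i. T / 2 ^ i \<le> 2 * \<rho> \<and> \<rho> < T / 2 ^ i"
proof -
  define n where "n = (LEAST n. T / 2 ^ n \<le> \<rho>)"
  obtain k where "T / \<rho> < 2 ^ k" using real_arch_pow[of 2] by auto
  then have "T / 2 ^ k \<le> \<rho>" using assms by (simp add: field_simps)
  then have n: "T / 2 ^ n \<le> \<rho>" unfolding n_def by (rule LeastI)
  then have "n \<noteq> 0" using assms by (intro notI) simp
  then obtain i where i: "n = Suc i" by (cases n) auto
  then have "\<not> T / 2 ^ i \<le> \<rho>" using not_less_Least[of i "\<lambda>n. T / 2 ^ n \<le> \<rho>"] by (simp add: n_def)
  moreover have "T / 2 ^ i \<le> 2 * \<rho>" using n i by (simp add: field_simps)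
  ultimately show ?thesis by (intro exI[of _ i]) simp
qed

lemma dyadic_shell_above:
  fixes \<rho> r :: real
  assumes "0 < r" "r \<le> \<rho>"
  shows "\<exists>i. r * 2 ^ Suc i \<le> 2 * \<rho> \<and> \<rho> < r * 2 ^ Suc i"
proof -
  define n where "n = (LEAST n. \<rho> < r * 2 ^ n)"
  obtain k where "\<rho> / r < 2 ^ k" using real_arch_pow[of 2] by auto
  then have "\<rho> < r * 2 ^ k" using assms by (simp add: field_simps)
  then have n: "\<rho> < r * 2 ^ n" unfolding n_def by (rule LeastI)
  then have "n \<noteq> 0" using assms by (intro notI) simp
  then obtain i where i: "n = Suc i" by (cases n) auto
  then have "\<not> \<rho> < r * 2 ^ i" using not_less_Least[of i "\<lambda>n. \<rho> < r * 2 ^ n"] by (simp add: n_def)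
  then show ?thesis using n i by (intro exI[of _ i]) simp
qed

lemma borel_imp_lebesgue_measurable:
  fixes f :: "'a::euclidean_space \<Rightarrow> real"
  shows "f \<in> borel_measurable borel \<Longrightarrow> f \<in> borel_measurable lebesgue"
  by (simp add: measurable_completion)

lemma ennreal_term_le_suminf: "f i \<le> (\<Sum>i. f i :: ennreal)"
  using sum_le_suminf[of f "{i}"] by auto

section \<open>Estimates for the weights psi of a single ball\<close>

context morrey_weight
begin

lemma w_measurable [measurable]: "w \<in> borel_measurable lebesgue"
  using w by (simp add: pos_locintD)

lemma w_pos: "0 < w x"
  using w by (simp add: pos_locintD)

text \<open>The mass of a ball is monotone in the radius, hence a Borel function of it.\<close>

lemma psi_measurable [measurable]: "psi x r \<in> borel_measurable lebesgue"
proof (rule borel_imp_lebesgue_measurable)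
  have "mono (mass w x)" by (rule monoI, rule mass_mono_w, rule subset_ball)
  then have [measurable]: "mass w x \<in> borel_measurable borel" by (rule borel_measurable_mono)
  show "psi x r \<in> borel_measurable borel"
    unfolding psi_def[abs_def] psi_profile_def Theta_def by measurable
qed

definition C_quasi :: real where
  "C_quasi = C_mono + 3 powr \<epsilon> * C_comp 3"

lemma C_quasi_pos: "0 < C_quasi"
  using C_mono_ge C_comp_pos[of 3] by (simp add: C_quasi_def add_pos_nonneg less_imp_le)

text \<open>The profile is essentially decreasing and drops by at most a constant factor when the
  radius is tripled. Hence it may be evaluated at any radius that is at most three times too
  large.\<close>

lemma psi_profile_quasi:
  assumes r: "0 < r" and t: "0 < t" "0 < T" "T \<le> 3 * t"
  shows "psi_profile x r t \<le> C_quasi * psi_profile x r T"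
proof -
  have p: "0 < psi_profile x r T" using r t by (intro psi_profile_pos)
  have c: "0 \<le> C_mono" "0 \<le> 3 powr \<epsilon> * C_comp 3" using C_mono_ge C_comp_pos[of 3] by auto
  show ?thesis
  proof (cases "t \<le> T")
    case True
    have "psi_profile x r t \<le> 3 powr \<epsilon> * C_comp 3 * psi_profile x r T" using psi_profile_comp[OF r t(1)
        True t(3)] .
    also have "\<dots> \<le> C_quasi * psi_profile x r T" using p c by (intro mult_right_mono) (auto simp: C_quasi_def)
    finally show ?thesis .
  next
    case False
    then have "psi_profile x r t \<le> C_mono * psi_profile x r T" using psi_profile_antimono[OF r t(2), of
        t] by simp
    also have "\<dots> \<le> C_quasi * psi_profile x r T" using p c by (intro mult_right_mono) (auto simp: C_quasi_def)
    finally show ?thesis .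
  qed
qed

lemma wmeas_ws_le:
  assumes "0 < t"
  shows "wmeas (\<lambda>x. w x powr s) (ball x t) \<le> ennreal (Crh * (vol (0 :: real^'n) 1 powr (1 - s) * Q x t))"
proof -
  have "wmeas (\<lambda>x. w x powr s) (ball x t) = ennreal (vol x t * avg (\<lambda>x. w x powr s) x t)"
    using assms by (simp add: pos_locintD(4)[OF ws] mass_avg mult.commute)
  also have "\<dots> \<le> ennreal (vol x t * (Crh * avg w x t powr s))"
    using assms by (intro ennreal_leI mult_left_mono rh) (auto simp: less_imp_le)
  also have "vol x t * (Crh * avg w x t powr s) = Crh * (vol x t * avg w x t powr s)" by simp
  finally show ?thesis unfolding vol_avg_Q[OF assms] .
qed

lemma Q_nonneg: "0 \<le> Q x t"
  by (simp add: Q_def)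

definition decay_ratio :: real where "decay_ratio = (1 / 2) powr decay_exp"

lemma decay_ratio: "0 < decay_ratio" "decay_ratio < 1"
  using decay_exp_pos powr_less_mono2[of decay_exp "1 / 2" 1] by (auto simp: decay_ratio_def)

definition C_A1 :: real where
  "C_A1 = C_quasi powr s * Crh * Cr powr (s * (1 - b)) * (1 / (1 - decay_ratio)) * ((D * 5 powr K) powr
      s * C_quasi powr s) + Crh * C_quasi powr s"

lemma C_A1_pos: "0 < C_A1"
  unfolding C_A1_def using C_quasi_pos Crh Cr D decay_ratio
  by (intro add_nonneg_pos mult_nonneg_nonneg mult_pos_pos) auto

text \<open>In other words, \<open>psi^s\<close> is an \<open>A\<^sub>1\<close> weight with respect to \<open>w^s dx\<close>, uniformly in the ball.
  This property, unlike \<open>w psi \<in> A\<^sub>q\<close>, survives summation over a sequence of balls.\<close>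

lemma psi_A1:
  assumes r: "0 < r" and R: "0 < R" and z: "z \<in> ball y R"
  shows "wmeas (\<lambda>u. (w u * psi x r u) powr s) (ball y R) \<le> ennreal (C_A1 * (vol y R * avg w y R powr s)
      * psi x r z powr s)"
proof (cases "2 * R \<le> dist y x + r")
  case True
  \<comment> \<open>As |y - x| + r is at least 2R, the radii at which the profile is taken on the
    ball agree within a factor 3, so psi is essentially constant there.\<close>
  have le: "psi x r u \<le> C_quasi * psi x r z" if u: "u \<in> ball y R" for u
  proof -
    have "dist z x \<le> dist y x + R" "dist y x \<le> dist u x + R"
      using z u dist_triangle[of z x y] dist_triangle[of y x u] by (auto simp: dist_commute)
    then have "dist z x + r \<le> 3 * (dist u x + r)" using True R by argo
    then show ?thesis unfolding psi_def using r by (intro psi_profile_quasi) (auto simp: add_nonneg_pos)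
  qed
  have "wmeas (\<lambda>u. (w u * psi x r u) powr s) (ball y R)
      \<le> ennreal ((C_quasi * psi x r z) powr s) * wmeas (\<lambda>u. w u powr s) (ball y R)"
  proof (rule wmeas_mono_AE)
    show "AE u in lebesgue. u \<in> ball y R \<longrightarrow> (w u * psi x r u) powr s \<le> (C_quasi * psi x r z) powr s * w u powr s"
    proof (rule AE_I2, rule impI)
      fix u assume "u \<in> ball y R"
      then have "psi x r u powr s \<le> (C_quasi * psi x r z) powr s"
        using le[of u] psi_pos[OF r, of x u] s by (intro powr_mono2) auto
      then show "(w u * psi x r u) powr s \<le> (C_quasi * psi x r z) powr s * w u powr s"
        unfolding powr_mult[of "w u"] by (subst mult.commute) (rule mult_right_mono, simp_all)
    qed
  qed auto
  also have "\<dots> \<le> ennreal ((C_quasi * psi x r z) powr s) * ennreal (Crh * (vol (0 :: real^'n) 1 powr (1 -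
      s) * Q y R))"
    by (intro mult_left_mono wmeas_ws_le R) simp
  also have "\<dots> = ennreal ((Crh * C_quasi powr s) * (vol y R * avg w y R powr s) * psi x r z powr s)"
    unfolding vol_avg_Q[OF R] powr_mult by (rule ennreal_mult_cong) (simp_all add: mult_ac)
  also have "\<dots> \<le> ennreal (C_A1 * (vol y R * avg w y R powr s) * psi x r z powr s)"
  proof (intro ennreal_leI mult_right_mono)
    show "Crh * C_quasi powr s \<le> C_A1" unfolding C_A1_def using C_quasi_pos Crh decay_ratio by simp
  qed (use R in \<open>auto simp: less_imp_le\<close>)
  finally show ?thesis .
next
  case False
  \<comment> \<open>In this case |u - x| + r < 3R on the whole ball. The integral is split along
    dyadic balls about x, and \<open>Q_psi_profile_decay\<close> yields a geometric series governed
    by the largest one.\<close>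
  define T where "T = 3 * R"
  define t where "t i = T / 2 ^ i" for i :: nat
  have T: "0 < T" and t: "0 < t i" "t i \<le> T" for i using R by (auto simp: T_def t_def divide_le_eq)
  have rho: "dist u x + r < T" "0 < dist u x + r" if "u \<in> ball y R" for u
  proof -
    show "0 < dist u x + r" using r by (simp add: add_nonneg_pos)
    show "dist u x + r < T" using that False dist_triangle[of u x y] by (simp add: T_def dist_commute)
  qed
  let ?o = "vol (0 :: real^'n) 1 powr (1 - s)"
  let ?M = "Q x T * psi_profile x r T powr s"
  let ?E = "C_quasi powr s * Crh * Cr powr (s * (1 - b)) * ?o * ?M"
  have "wmeas (\<lambda>u. (w u * psi x r u) powr s) (ball y R)
     \<le> (\<integral>\<^sup>+u. (\<Sum>i. ennreal ((C_quasi * psi_profile x r (t i)) powr s) * (ennreal (w u powr s) *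
         indicator (ball x (t i)) u)) \<partial>lebesgue)"
    unfolding wmeas_def
  proof (rule nn_integral_mono)
    fix u
    show "ennreal ((w u * psi x r u) powr s) * indicator (ball y R) u
      \<le> (\<Sum>i. ennreal ((C_quasi * psi_profile x r (t i)) powr s) * (ennreal (w u powr s) * indicator
          (ball x (t i)) u))"
    proof (cases "u \<in> ball y R")
      case True
      obtain i where i: "t i \<le> 2 * (dist u x + r)" "dist u x + r < t i"
        using dyadic_shell_below[OF rho(2,1)[OF True]] unfolding t_def by blast
      have "psi x r u \<le> C_quasi * psi_profile x r (t i)"
        unfolding psi_def using rho[OF True] i t(1)[of i] r by (intro psi_profile_quasi) auto
      then have "(w u * psi x r u) powr s \<le> (w u * (C_quasi * psi_profile x r (t i))) powr s"
        using w_pos[of u] psi_pos[OF r, of x u] s by (intro powr_mono2 mult_left_mono) auto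
      also have "\<dots> = (C_quasi * psi_profile x r (t i)) powr s * w u powr s" unfolding powr_mult[of "w
          u"] by simp
      finally have "ennreal ((w u * psi x r u) powr s) \<le> ennreal ((C_quasi * psi_profile x r (t i)) powr
          s * w u powr s)"
        by (rule ennreal_leI)
      also have "\<dots> = ennreal ((C_quasi * psi_profile x r (t i)) powr s) * ennreal (w u powr s)" by (rule
          ennreal_mult') simp
      finally have "ennreal ((w u * psi x r u) powr s) \<le> ennreal ((C_quasi * psi_profile x r (t i)) powr
          s) * ennreal (w u powr s)" .
      moreover have "u \<in> ball x (t i)" using i r by (simp add: dist_commute)
      ultimately have "ennreal ((w u * psi x r u) powr s) * indicator (ball y R) u
        \<le> ennreal ((C_quasi * psi_profile x r (t i)) powr s) * (ennreal (w u powr s) * indicator (ball x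
            (t i)) u)"
        using True by simp
      also have "\<dots> \<le> (\<Sum>i. ennreal ((C_quasi * psi_profile x r (t i)) powr s) * (ennreal (w u powr s) *
          indicator (ball x (t i)) u))"
        by (rule ennreal_term_le_suminf)
      finally show ?thesis .
    qed simp
  qed
  also have "\<dots> = (\<Sum>i. ennreal ((C_quasi * psi_profile x r (t i)) powr s) * wmeas (\<lambda>u. w u powr s) (ball
      x (t i)))"
    unfolding wmeas_def by (simp add: nn_integral_suminf nn_integral_cmult)
  also have "\<dots> \<le> (\<Sum>i. ennreal (?E * decay_ratio ^ i))"
  proof (intro suminf_le)
    fix i
    have "ennreal ((C_quasi * psi_profile x r (t i)) powr s) * wmeas (\<lambda>u. w u powr s) (ball x (t i))
      \<le> ennreal ((C_quasi * psi_profile x r (t i)) powr s) * ennreal (Crh * (?o * Q x (t i)))"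
      by (intro mult_left_mono wmeas_ws_le t) simp
    also have "\<dots> = ennreal ((C_quasi powr s * Crh * ?o) * (Q x (t i) * psi_profile x r (t i) powr s))"
      unfolding powr_mult by (rule ennreal_mult_cong) (simp_all add: mult_ac)
    also have "\<dots> \<le> ennreal ((C_quasi powr s * Crh * ?o) * (Cr powr (s * (1 - b)) * (t i / T) powr
        decay_exp * ?M))"
      using Crh by (intro ennreal_leI mult_left_mono Q_psi_profile_decay r t) auto
    also have "(t i / T) powr decay_exp = decay_ratio ^ i"
    proof -
      have "t i / T = (1 / 2) ^ i" using T by (simp add: t_def power_divide)
      then have "(t i / T) powr decay_exp = ((1 / 2) powr real i) powr decay_exp" by (simp add: powr_realpow)
      also have "\<dots> = decay_ratio powr real i" unfolding decay_ratio_def powr_powr by (simp only: mult.commute)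
      finally show ?thesis using decay_ratio by (simp add: powr_realpow)
    qed
    also have "(C_quasi powr s * Crh * ?o) * (Cr powr (s * (1 - b)) * decay_ratio ^ i * ?M) = ?E *
        decay_ratio ^ i" by (simp only: mult_ac)
    finally show "ennreal ((C_quasi * psi_profile x r (t i)) powr s) * wmeas (\<lambda>u. w u powr s) (ball x (t
        i)) \<le> ennreal (?E * decay_ratio ^ i)" .
  qed auto
  also have "\<dots> = ennreal (?E / (1 - decay_ratio))"
    using Crh Q_nonneg decay_ratio by (intro suminf_ennreal_geometric) auto
  also have "\<dots> \<le> ennreal (C_A1 * (vol y R * avg w y R powr s) * psi x r z powr s)"
  proof (rule ennreal_leI)
    have yx: "dist y x \<le> 2 * R" using False r by simp
    \<comment> \<open>The ball of radius 3R about x lies in the one of radius 5R about y, since |y -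
      x| \<le> 2R; doubling returns to radius R.\<close>
    have "mass w x T \<le> mass w y (5 * R)"
      using yx R by (intro mass_mono_w) (simp add: T_def ball_subset_ball_iff dist_commute)
    also have "\<dots> \<le> D * (5 * R / R) powr K * mass w y R" using R by (intro dbl subset_ball) auto
    finally have "mass w x T powr s \<le> (D * 5 powr K * mass w y R) powr s" using R s by (intro powr_mono2) auto
    also have "\<dots> = (D * 5 powr K) powr s * mass w y R powr s" by (rule powr_mult)
    finally have 1: "mass w x T powr s \<le> (D * 5 powr K) powr s * mass w y R powr s" .
    have "T powr (real CARD('n) * (1 - s)) \<le> R powr (real CARD('n) * (1 - s))"
      using R s by (intro powr_mono2') (auto simp: T_def mult_nonneg_nonpos)
    then have "Q x T \<le> R powr (real CARD('n) * (1 - s)) * ((D * 5 powr K) powr s * mass w y R powr s)"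
      unfolding Q_def using 1 by (intro mult_mono) auto
    then have Qle: "Q x T \<le> (D * 5 powr K) powr s * Q y R" unfolding Q_def by (simp add: mult_ac)
    have "psi_profile x r T \<le> C_quasi * psi x r z"
      unfolding psi_def using rho[OF z] r T by (intro psi_profile_quasi) auto
    then have "psi_profile x r T powr s \<le> (C_quasi * psi x r z) powr s" using psi_profile_pos[OF r T, of
        x] s by (intro powr_mono2) auto
    then have psle: "psi_profile x r T powr s \<le> C_quasi powr s * psi x r z powr s" by (simp only: powr_mult)
    have "?M \<le> ((D * 5 powr K) powr s * Q y R) * (C_quasi powr s * psi x r z powr s)"
      using Qle psle Q_nonneg by (intro mult_mono) auto
    then have "(C_quasi powr s * Crh * Cr powr (s * (1 - b)) * ?o * (1 / (1 - decay_ratio))) * ?M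
       \<le> (C_quasi powr s * Crh * Cr powr (s * (1 - b)) * ?o * (1 / (1 - decay_ratio))) * (((D * 5 powr
           K) powr s * Q y R) * (C_quasi powr s * psi x r z powr s))"
      using Crh decay_ratio by (intro mult_left_mono) auto
    then have "?E / (1 - decay_ratio) \<le> (C_quasi powr s * Crh * Cr powr (s * (1 - b)) * (1 / (1 -
        decay_ratio)) * ((D * 5 powr K) powr s * C_quasi powr s)) * (?o * Q y R) * psi x r z powr s"
      by (simp add: mult_ac)
    also have "\<dots> \<le> C_A1 * (?o * Q y R) * psi x r z powr s"
      unfolding C_A1_def using Crh Q_nonneg[of y R] by (intro mult_right_mono) auto
    finally show "?E / (1 - decay_ratio) \<le> C_A1 * (vol y R * avg w y R powr s) * psi x r z powr s"
      unfolding vol_avg_Q[OF R] .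
  qed
  finally show ?thesis .
qed

text \<open>Here h plays the role of f^p. The bound N ranges over \<open>ennreal\<close>, so that an
  infinite Morrey norm is no separate case.\<close>

definition morrey_bound :: "(real^'n \<Rightarrow> real) \<Rightarrow> ennreal \<Rightarrow> bool" where
  "morrey_bound h N \<longleftrightarrow> h \<in> borel_measurable lebesgue \<and> (\<forall>y. 0 \<le> h y) \<and>
     (\<forall>y R. 0 < R \<longrightarrow> (\<integral>\<^sup>+z\<in>ball y R. ennreal (h z * w z) \<partial>lebesgue) \<le> N * ennreal (Theta y R))"

definition C_int :: real where
  "C_int = C_quasi / (1 - (1 / 2) powr \<epsilon>)"

lemma C_int_pos: "0 < C_int"
  using C_quasi_pos eps_pos powr_less_mono2[of \<epsilon> "1 / 2" 1] by (simp add: C_int_def)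

text \<open>On the shell of radius t the profile is bounded by a multiple of (r/t)^\<epsilon> /
  \<open>Theta\<close>, and the integral of h w by N \<open>Theta\<close>. The two factors
  \<open>Theta\<close> cancel and leave a geometric series with ratio 2^-\<epsilon>.\<close>

lemma psi_integral_le:
  assumes r: "0 < r" and h: "morrey_bound h N"
  shows "(\<integral>\<^sup>+z. ennreal (h z * w z * psi x r z) \<partial>lebesgue) \<le> ennreal C_int * N"
proof -
  have [measurable]: "h \<in> borel_measurable lebesgue" and h0: "0 \<le> h z" for z
    using h by (auto simp: morrey_bound_def)
  define t where "t i = r * 2 ^ Suc i" for i :: nat
  have t: "0 < t i" for i using r by (simp add: t_def)
  define g where "g = (1 / 2) powr \<epsilon>"
  have g: "0 < g" "g < 1" using eps_pos powr_less_mono2[of \<epsilon> "1 / 2" 1] by (auto simp: g_def)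
  have "(\<integral>\<^sup>+z. ennreal (h z * w z * psi x r z) \<partial>lebesgue)
    \<le> (\<integral>\<^sup>+z. (\<Sum>i. ennreal (C_quasi * psi_profile x r (t i)) * (ennreal (h z * w z) * indicator (ball x
        (t i)) z)) \<partial>lebesgue)"
  proof (rule nn_integral_mono)
    fix z
    obtain i where i: "t i \<le> 2 * (dist z x + r)" "dist z x + r < t i"
      using dyadic_shell_above[OF r, of "dist z x + r"] unfolding t_def by auto
    have "psi x r z \<le> C_quasi * psi_profile x r (t i)"
      unfolding psi_def using i t[of i] r by (intro psi_profile_quasi) (auto simp: add_nonneg_pos)
    then have "h z * w z * psi x r z \<le> h z * w z * (C_quasi * psi_profile x r (t i))"
      using h0[of z] w_pos[of z] by (intro mult_left_mono) auto
    then have "ennreal (h z * w z * psi x r z) \<le> ennreal (C_quasi * psi_profile x r (t i) * (h z * w z))"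
      by (intro ennreal_leI) (simp only: mult_ac)
    also have "\<dots> = ennreal (C_quasi * psi_profile x r (t i)) * ennreal (h z * w z)"
      using C_quasi_pos psi_profile_pos[OF r t[of i], of x] by (intro ennreal_mult') simp
    also have "\<dots> = ennreal (C_quasi * psi_profile x r (t i)) * (ennreal (h z * w z) * indicator (ball x
        (t i)) z)"
      using i r by (simp add: dist_commute)
    also have "\<dots> \<le> (\<Sum>i. ennreal (C_quasi * psi_profile x r (t i)) * (ennreal (h z * w z) * indicator
        (ball x (t i)) z))"
      by (rule ennreal_term_le_suminf)
    finally show "ennreal (h z * w z * psi x r z) \<le> \<dots>" .
  qed
  also have "\<dots> = (\<Sum>i. ennreal (C_quasi * psi_profile x r (t i)) * (\<integral>\<^sup>+z\<in>ball x (t i). ennreal (h z * w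
      z) \<partial>lebesgue))"
    by (simp add: nn_integral_suminf nn_integral_cmult)
  also have "\<dots> \<le> (\<Sum>i. ennreal (C_quasi * g ^ i) * N)"
  proof (intro suminf_le)
    fix i
    have "ennreal (C_quasi * psi_profile x r (t i)) * (\<integral>\<^sup>+z\<in>ball x (t i). ennreal (h z * w z) \<partial>lebesgue)
      \<le> ennreal (C_quasi * psi_profile x r (t i)) * (N * ennreal (Theta x (t i)))"
      using h t[of i] by (intro mult_left_mono) (auto simp: morrey_bound_def)
    also have "\<dots> = ennreal (C_quasi * psi_profile x r (t i) * Theta x (t i)) * N"
      using C_quasi_pos psi_profile_pos[OF r t[of i], of x] Theta_pos[OF t[of i], of x] by (subst
          ennreal_mult) (auto simp: mult_ac)
    also have "\<dots> \<le> ennreal (C_quasi * g ^ i) * N"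
    proof (intro mult_right_mono ennreal_leI)
      have "psi_profile x r (t i) * Theta x (t i) = (r / t i) powr \<epsilon>"
        using Theta_pos[OF t[of i], of x] by (simp add: psi_profile_def)
      also have "r / t i = (1 / 2) ^ Suc i" using r by (simp add: t_def power_divide)
      also have "((1 / 2) ^ Suc i) powr \<epsilon> = ((1 / 2) powr real (Suc i)) powr \<epsilon>" by (simp only:
          powr_realpow zero_less_divide_1_iff zero_less_numeral)
      also have "\<dots> = g powr real (Suc i)" unfolding g_def powr_powr by (simp only: mult.commute)
      also have "\<dots> = g ^ Suc i" using g by (simp only: powr_realpow)
      also have "\<dots> \<le> g ^ i" using g by (intro power_decreasing) auto
      finally show "C_quasi * psi_profile x r (t i) * Theta x (t i) \<le> C_quasi * g ^ i"
        using C_quasi_pos by (simp add: mult.assoc)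
    qed simp
    finally show "ennreal (C_quasi * psi_profile x r (t i)) * (\<integral>\<^sup>+z\<in>ball x (t i). ennreal (h z * w z)
        \<partial>lebesgue) \<le> ennreal (C_quasi * g ^ i) * N" .
  qed auto
  also have "\<dots> = ennreal C_int * N"
    using g C_quasi_pos by (simp only: ennreal_suminf_multc) (subst suminf_ennreal_geometric, auto simp:
        C_int_def g_def)
  finally show ?thesis .
qed

text \<open>At radius r the profile equals 1 / \<open>Theta\<close>, and |y - x| + r stays below 2r
  on the ball.\<close>

lemma psi_lower:
  assumes r: "0 < r" and y: "y \<in> ball x r"
  shows "1 / Theta x r \<le> C_quasi * psi x r y"
proof -
  have "1 / Theta x r = psi_profile x r r" using r by (simp add: psi_profile_def)
  also have "\<dots> \<le> C_quasi * psi x r y"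
    unfolding psi_def using r y by (intro psi_profile_quasi) (auto simp: dist_commute add_nonneg_pos)
  finally show ?thesis .
qed

definition C_origin :: real where
  "C_origin = 3 powr \<beta> * (D * 4 powr K) powr b * C_mono / Theta 0 (1 / 4)"

text \<open>Uniformity in x and r makes sums over arbitrary balls finite almost everywhere. Wherever
  x lies, the unit ball contains a point at distance at least 1/4 from it; the profile is taken
  there at a radius at least 1/4, where \<open>Theta\<close> is bounded below by a multiple of its
  value for radius 1/4 at the origin.\<close>

lemma psi_bounded_near_origin:
  assumes r: "0 < r"
  shows "\<exists>z\<in>ball 0 1. psi x r z \<le> C_origin"
proof -
  obtain e :: "real^'n" where e: "norm e = 1 / 2" using vector_choose_size[of "1 / 2"] by auto
  obtain z where z: "norm z \<le> 1 / 2" "1 / 4 \<le> dist z x"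
  proof (cases "1 / 4 \<le> norm x")
    case True
    then show ?thesis using that[of 0] by (simp add: dist_norm)
  next
    case False
    have "norm e - norm x \<le> dist e x" unfolding dist_norm by (rule norm_triangle_ineq2)
    then show ?thesis using that[of e] e False by simp
  qed
  let ?t = "dist z x + r"
  have t: "1 / 4 \<le> ?t" "0 < ?t" "r \<le> ?t" using z r by auto
  have "norm x \<le> norm z + dist z x"
    unfolding dist_norm using norm_triangle_ineq4[of z "z - x"] by simp
  then have x: "norm x \<le> 3 * ?t" using z t r by argo
  have p: "0 < Theta x ?t" "0 < Theta 0 (1 / 4)" using Theta_pos t by auto
  have "Theta 0 (1 / 4) \<le> C_mono * Theta 0 ?t" using t by (intro Theta_mono) auto
  also have "\<dots> \<le> C_mono * (3 powr \<beta> * (D * 4 powr K) powr b * Theta x ?t)"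
    using C_mono_ge t x by (intro mult_left_mono Theta_origin) auto
  finally have "1 / Theta x ?t \<le> C_origin" using p by (simp add: C_origin_def divide_simps mult_ac)
  moreover have "psi x r z \<le> 1 * (1 / Theta x ?t)"
  proof -
    have "(r / ?t) powr \<epsilon> \<le> 1" using powr_le_one_of_le[OF r t(3)] eps_pos by simp
    then show ?thesis unfolding psi_def psi_profile_def using p by (simp add: divide_right_mono)
  qed
  ultimately show ?thesis using z by (intro bexI[of _ z]) auto
qed

end

section \<open>One weight for a sequence of balls\<close>

context morrey_weight
begin

text \<open>The weight is u = w P^(1/s), where P is the sum of 4^-k psi_k^s. The inequality
  \<open>psi_A1\<close> is linear in psi^s, so it passes to P with the same constant; combined with
  w in A_q it yields u^s in A_t for t = s(q-1) + 1. The coefficients 4^-k are small enough for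
  P^(1/s) to be dominated by a convergent combination of the psi_k themselves.\<close>

lemma morrey_weight_exists:
  assumes q: "1 \<le> q" and wq: "if q = 1 then A1 w Cw else Aq q w Cw" and rs: "\<And>k. 0 < rs k"
  shows "\<exists>u C. A_RH q s u \<and> 0 < C \<and> (\<forall>k::nat. AE y in lebesgue. w y * psi (xs k) (rs k) y \<le> 4 ^ k * u y) \<and>
    (\<forall>h N. morrey_bound h N \<longrightarrow> (\<integral>\<^sup>+z. ennreal (h z * u z) \<partial>lebesgue) \<le> ennreal C * N)"
proof -
  define f where "f k = psi (xs k) (rs k)" for k
  have fp: "0 < f k y" for k y unfolding f_def by (rule psi_pos[OF rs])
  have [measurable]: "f k \<in> borel_measurable lebesgue" for k unfolding f_def by measurable
  define P' where "P' y = (\<Sum>k. ennreal ((1 / 4) ^ k) * ennreal (f k y powr s))" for y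
  have [measurable]: "P' \<in> borel_measurable lebesgue" unfolding P'_def by measurable
  have term_le: "ennreal ((1 / 4) ^ k) * ennreal (f k y powr s) \<le> P' y" for k y
    unfolding P'_def by (rule ennreal_term_le_suminf)
  have P'_pos: "0 < P' y" for y
  proof -
    have "0 < ennreal ((1 / 4) ^ 0) * ennreal (f 0 y powr s)" using fp[of 0 y] by (simp add: less_imp_neq)
    also have "\<dots> \<le> P' y" by (rule term_le)
    finally show ?thesis .
  qed
  have expand: "(\<integral>\<^sup>+u\<in>ball y R. ennreal (w u powr s) * P' u \<partial>lebesgue)
      = (\<Sum>k. ennreal ((1 / 4) ^ k) * wmeas (\<lambda>u. (w u * f k u) powr s) (ball y R))" for y R
  proof -
    have "(\<integral>\<^sup>+u\<in>ball y R. ennreal (w u powr s) * P' u \<partial>lebesgue)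
       = (\<integral>\<^sup>+u. (\<Sum>k. ennreal ((1 / 4) ^ k) * (ennreal ((w u * f k u) powr s) * indicator (ball y R) u))
           \<partial>lebesgue)"
    proof (rule nn_integral_cong)
      fix u
      have "ennreal (w u powr s) * P' u * indicator (ball y R) u
        = (\<Sum>k. (ennreal (w u powr s) * (ennreal ((1 / 4) ^ k) * ennreal (f k u powr s))) * indicator
            (ball y R) u)"
        unfolding P'_def by (simp only: ennreal_suminf_multc ennreal_suminf_cmult)
      also have "\<dots> = (\<Sum>k. ennreal ((1 / 4) ^ k) * (ennreal ((w u * f k u) powr s) * indicator (ball y R) u))"
      proof (intro arg_cong[where f=suminf] ext)
        fix k
        have e: "ennreal ((w u * f k u) powr s) = ennreal (w u powr s) * ennreal (f k u powr s)"
          unfolding powr_mult by (rule ennreal_mult') simp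
        show "(ennreal (w u powr s) * (ennreal ((1 / 4) ^ k) * ennreal (f k u powr s))) * indicator (ball y R) u
          = ennreal ((1 / 4) ^ k) * (ennreal ((w u * f k u) powr s) * indicator (ball y R) u)"
          unfolding e by (simp only: mult_ac)
      qed
      finally show "ennreal (w u powr s) * P' u * indicator (ball y R) u
        = (\<Sum>k. ennreal ((1 / 4) ^ k) * (ennreal ((w u * f k u) powr s) * indicator (ball y R) u))" .
    qed
    also have "\<dots> = (\<Sum>k. ennreal ((1 / 4) ^ k) * wmeas (\<lambda>u. (w u * f k u) powr s) (ball y R))"
      unfolding wmeas_def by (simp add: nn_integral_suminf nn_integral_cmult)
    finally show ?thesis .
  qed
  let ?V = "\<lambda>y R. vol y R * avg w y R powr s"
  have V0: "0 \<le> ?V y R" if "0 < R" for y R using vol_pos[OF that, of y] by simp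
  have A1_bound: "(\<integral>\<^sup>+u\<in>ball y R. ennreal (w u powr s) * P' u \<partial>lebesgue) \<le> ennreal (C_A1 * ?V y R) * P' z"
    if R: "0 < R" and z: "z \<in> ball y R" for y R z
  proof -
    have "(\<Sum>k. ennreal ((1 / 4) ^ k) * wmeas (\<lambda>u. (w u * f k u) powr s) (ball y R))
      \<le> (\<Sum>k. ennreal (C_A1 * ?V y R) * (ennreal ((1 / 4) ^ k) * ennreal (f k z powr s)))"
    proof (intro suminf_le)
      fix k
      have "ennreal ((1 / 4) ^ k) * wmeas (\<lambda>u. (w u * f k u) powr s) (ball y R)
        \<le> ennreal ((1 / 4) ^ k) * ennreal (C_A1 * ?V y R * f k z powr s)"
        unfolding f_def by (intro mult_left_mono psi_A1 rs R z) simp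
      also have "ennreal (C_A1 * ?V y R * f k z powr s) = ennreal (C_A1 * ?V y R) * ennreal (f k z powr s)"
        using V0[OF R, of y] C_A1_pos by (intro ennreal_mult') simp
      finally show "ennreal ((1 / 4) ^ k) * wmeas (\<lambda>u. (w u * f k u) powr s) (ball y R)
        \<le> ennreal (C_A1 * ?V y R) * (ennreal ((1 / 4) ^ k) * ennreal (f k z powr s))"
        by (simp only: mult.left_commute)
    qed auto
    also have "\<dots> = ennreal (C_A1 * ?V y R) * P' z" unfolding P'_def by (rule ennreal_suminf_cmult)
    finally show ?thesis unfolding expand .
  qed
  \<comment> \<open>In each term \<open>psi_A1\<close> is evaluated at a point where psi_k is at
    most \<open>C_origin\<close>. This point depends on k but lies in the unit ball, hence in every
    ball about 0 considered here.\<close>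
  have P'_fin: "AE y in lebesgue. P' y < top"
  proof -
    have "AE y in lebesgue. y \<in> ball 0 (real m + 1) \<longrightarrow> P' y < top" for m
    proof -
      let ?B = "ball 0 (real m + 1) :: (real^'n) set"
      have R: "0 < real m + 1" by simp
      have "(\<integral>\<^sup>+u\<in>?B. ennreal (w u powr s) * P' u \<partial>lebesgue)
        \<le> (\<Sum>k. ennreal (C_A1 * ?V 0 (real m + 1) * C_origin powr s * (1 / 4) ^ k))"
        unfolding expand
      proof (intro suminf_le)
        fix k
        obtain z where z: "z \<in> ball 0 1" "f k z \<le> C_origin"
          unfolding f_def using psi_bounded_near_origin[OF rs] by blast
        have zB: "z \<in> ?B" using z(1) by simp
        have "wmeas (\<lambda>u. (w u * f k u) powr s) ?B \<le> ennreal (C_A1 * ?V 0 (real m + 1) * f k z powr s)"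
          unfolding f_def by (intro psi_A1 rs R zB)
        also have "\<dots> \<le> ennreal (C_A1 * ?V 0 (real m + 1) * C_origin powr s)"
          using z(2) fp[of k z] s C_A1_pos V0[OF R, of 0] by (intro ennreal_leI mult_left_mono powr_mono2) auto
        finally have "ennreal ((1 / 4) ^ k) * wmeas (\<lambda>u. (w u * f k u) powr s) ?B
          \<le> ennreal ((1 / 4) ^ k) * ennreal (C_A1 * ?V 0 (real m + 1) * C_origin powr s)"
          by (rule mult_left_mono) simp
        also have "\<dots> = ennreal (C_A1 * ?V 0 (real m + 1) * C_origin powr s * (1 / 4) ^ k)"
          by (rule ennreal_mult_cong) (simp_all add: mult_ac)
        finally show "ennreal ((1 / 4) ^ k) * wmeas (\<lambda>u. (w u * f k u) powr s) ?B
          \<le> ennreal (C_A1 * ?V 0 (real m + 1) * C_origin powr s * (1 / 4) ^ k)" .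
      qed auto
      also have "\<dots> < top"
        using V0[OF R, of 0] C_A1_pos by (subst suminf_ennreal_geometric) auto
      finally have "(\<integral>\<^sup>+u\<in>?B. ennreal (w u powr s) * P' u \<partial>lebesgue) \<noteq> \<infinity>" by simp
      then have "AE u in lebesgue. ennreal (w u powr s) * P' u * indicator ?B u \<noteq> \<infinity>"
        by (intro nn_integral_PInf_AE) measurable
      then show ?thesis
      proof eventually_elim
        case (elim u)
        have "0 < w u powr s" using w_pos[of u] by simp
        then show ?case using elim by (auto simp: ennreal_mult_eq_top_iff less_top[symmetric] ennreal_eq_0_iff)
      qed
    qed
    then have "AE y in lebesgue. \<forall>m. y \<in> ball 0 (real m + 1) \<longrightarrow> P' y < top"
      unfolding AE_all_countable by (rule allI)
    then show ?thesis
    proof eventually_elim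
      case (elim y)
      obtain m where "norm y < real m" using reals_Archimedean2 by blast
      then have "y \<in> ball 0 (real m + 1)" by simp
      then show ?case using elim by blast
    qed
  qed
  define P where "P y = (if P' y = top then 1 else enn2real (P' y))" for y
  have Pp: "0 < P y" for y using P'_pos[of y] by (auto simp: P_def enn2real_positive_iff less_top)
  have [measurable]: "P \<in> borel_measurable lebesgue" unfolding P_def by measurable
  have PP': "AE y in lebesgue. ennreal (P y) = P' y" using P'_fin by eventually_elim (auto simp: P_def)
  define U where "U y = w y powr s * P y" for y
  have Up: "0 < U y" for y using w_pos[of y] Pp[of y] by (simp add: U_def)
  have [measurable]: "U \<in> borel_measurable lebesgue" unfolding U_def by measurable
  have wmeas_U: "wmeas U (ball y R) = (\<integral>\<^sup>+u\<in>ball y R. ennreal (w u powr s) * P' u \<partial>lebesgue)" for y R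
    unfolding wmeas_def
  proof (rule nn_integral_cong_AE, use PP' in eventually_elim)
    case (elim u)
    then show ?case by (simp add: U_def ennreal_mult')
  qed
  have wmeas_U_le: "wmeas U (ball y R) \<le> ennreal (C_A1 * avg w y R powr s * P z * vol y R)"
    if "0 < R" "z \<in> ball y R" "ennreal (P z) = P' z" for y R z
  proof -
    have "wmeas U (ball y R) \<le> ennreal (C_A1 * ?V y R) * ennreal (P z)"
      unfolding wmeas_U that(3) by (rule A1_bound[OF that(1,2)])
    also have "\<dots> = ennreal (C_A1 * avg w y R powr s * P z * vol y R)"
    proof (rule ennreal_mult_cong)
      show "0 \<le> C_A1 * ?V y R" using C_A1_pos V0[OF that(1), of y] by simp
    qed (simp only: mult_ac)
    finally show ?thesis .
  qed
  have U_loc: "pos_locint U"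
  proof (rule pos_locintI)
    fix y :: "real^'n" and R :: real assume R: "0 < R"
    have "AE z in lebesgue. z \<in> ball y R \<longrightarrow> ennreal (P z) = P' z" using PP' by eventually_elim simp
    from AE_ball_ex[OF this R] obtain z where "z \<in> ball y R" "ennreal (P z) = P' z" by blast
    then show "\<exists>A. wmeas U (ball y R) \<le> ennreal A" using wmeas_U_le[OF R] by blast
  qed (auto simp: Up)
  have avg_U: "AE z in lebesgue. z \<in> ball y R \<longrightarrow> avg U y R \<le> C_A1 * avg w y R powr s * P z" if R: "0 < R" for y R
    using PP'
  proof eventually_elim
    case (elim z)
    show ?case
      using C_A1_pos Pp[of z] R wmeas_U_le[OF R _ elim, of y] by (auto intro!: avg_le simp del: mem_ball)
  qed
  define u where "u y = w y * P y powr (1 / s)" for y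
  have up: "0 < u y" for y using w_pos[of y] Pp[of y] by (simp add: u_def)
  have us: "u y powr s = U y" for y
    using s Pp[of y] unfolding u_def U_def powr_mult powr_powr by simp
  have "A_weight (s * (q - 1) + 1) U"
  proof (cases "q = 1")
    case True
    then have wA: "A1 w Cw" using wq by simp
    have "A1 U (C_A1 * Cw powr s)"
      unfolding A1_def
    proof (intro conjI allI impI U_loc)
      show "0 < C_A1 * Cw powr s" using C_A1_pos A1D(2)[OF wA] by simp
      fix y :: "real^'n" and R :: real assume R: "0 < R"
      show "AE z in lebesgue. z \<in> ball y R \<longrightarrow> avg U y R \<le> C_A1 * Cw powr s * U z"
        using avg_U[OF R, of y] A1D(3)[OF wA R, of y]
      proof eventually_elim
        case (elim z)
        show ?case
        proof
          assume "z \<in> ball y R"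
          with elim have 1: "avg U y R \<le> C_A1 * avg w y R powr s * P z" and 2: "avg w y R \<le> Cw * w z" by auto
          have "avg w y R powr s \<le> (Cw * w z) powr s" using 2 s by (intro powr_mono2) auto
          then have "C_A1 * avg w y R powr s * P z \<le> C_A1 * (Cw * w z) powr s * P z"
            using C_A1_pos Pp[of z] by (intro mult_right_mono mult_left_mono) auto
          also have "\<dots> = C_A1 * Cw powr s * U z" unfolding powr_mult U_def by (simp only: mult_ac)
          finally show "avg U y R \<le> C_A1 * Cw powr s * U z" using 1 by linarith
        qed
      qed
    qed
    then show ?thesis using True unfolding A_weight_def by auto
  next
    case False
    then have wA: "Aq q w Cw" using wq by simp
    have q1: "1 < q" by (rule AqD(1)[OF wA])
    define t where "t = s * (q - 1) + 1"
    define e where "e = 1 / (s * (q - 1))"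
    have t1: "t - 1 = s * (q - 1)" by (simp add: t_def)
    have sq: "0 < s * (q - 1)" using s q1 by simp
    have e: "0 \<le> e" using sq by (simp add: e_def)
    let ?sg = "dual_weight q w"
    note sg = AqD(3)[OF wA]
    have dual: "dual_weight t U = (\<lambda>y. ?sg y * P y powr (- e))"
    proof
      fix y
      have "s * (- 1 / (t - 1)) = - 1 / (q - 1)" unfolding t1 using s by simp
      then have "(w y powr s) powr (- 1 / (t - 1)) = ?sg y" by (simp only: powr_powr)
      moreover have "- 1 / (t - 1) = - e" by (simp add: t1 e_def)
      ultimately show "dual_weight t U y = ?sg y * P y powr (- e)" unfolding U_def powr_mult by simp
    qed
    \<comment> \<open>The lower bound for P turns P^(-e) into a constant on the ball. Raised to the
      power t - 1 it contributes the reciprocal of the average of U, and what remains is the s-th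
      power of the A_q product of w.\<close>
    have dual_le: "AE z in lebesgue. z \<in> ball y R \<longrightarrow> ?sg z * P z powr (- e) \<le> (C_A1 * avg w y R powr s /
        avg U y R) powr e * ?sg z"
      if R: "0 < R" for y R
      using avg_U[OF R, of y]
    proof eventually_elim
      case (elim z)
      show ?case
      proof
        assume "z \<in> ball y R"
        with elim have 1: "avg U y R \<le> C_A1 * avg w y R powr s * P z" by simp
        have p: "0 < avg U y R" "0 < C_A1 * avg w y R powr s" using avg_pos[OF U_loc R, of y] avg_pos[OF
            w R, of y] C_A1_pos by auto
        have "1 / P z \<le> C_A1 * avg w y R powr s / avg U y R"
          using 1 p Pp[of z] by (simp add: divide_simps mult_ac)
        then have "(1 / P z) powr e \<le> (C_A1 * avg w y R powr s / avg U y R) powr e"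
          using e Pp[of z] by (intro powr_mono2) auto
        moreover have "(1 / P z) powr e = P z powr (- e)" unfolding powr_divide by (simp add: powr_minus_divide)
        ultimately have "P z powr (- e) * ?sg z \<le> (C_A1 * avg w y R powr s / avg U y R) powr e * ?sg z"
          by (intro mult_right_mono) auto
        then show "?sg z * P z powr (- e) \<le> (C_A1 * avg w y R powr s / avg U y R) powr e * ?sg z"
          by (simp only: mult.commute)
      qed
    qed
    have "Aq t U (C_A1 * Cw powr s)"
      unfolding Aq_def dual
    proof (intro conjI allI impI U_loc)
      show "1 < t" using sq by (simp add: t_def)
      show "pos_locint (\<lambda>y. ?sg y * P y powr (- e))"
      proof (rule pos_locint_cong_bound[OF sg])
        show "(\<lambda>y. ?sg y * P y powr (- e)) \<in> borel_measurable lebesgue" by measurable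
        show "0 < ?sg y * P y powr (- e)" for y using w_pos[of y] Pp[of y] by simp
        show "\<exists>c\<ge>0. AE z in lebesgue. z \<in> ball y R \<longrightarrow> ?sg z * P z powr (- e) \<le> c * ?sg z" if "0 < R" for y R
          using dual_le[OF that, of y] by (intro exI[of _ "(C_A1 * avg w y R powr s / avg U y R) powr
              e"] conjI) simp_all
      qed
      fix y :: "real^'n" and R :: real assume R: "0 < R"
      have p: "0 < avg U y R" "0 < avg w y R" "0 < avg ?sg y R"
        using avg_pos[OF U_loc R, of y] avg_pos[OF w R, of y] avg_pos[OF sg R, of y] by auto
      let ?X = "C_A1 * avg w y R powr s / avg U y R"
      have X: "0 \<le> ?X" using p C_A1_pos by simp
      have "avg (\<lambda>y. ?sg y * P y powr (- e)) y R \<le> ?X powr e * avg ?sg y R"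
        by (rule avg_mono_AE[OF sg dual_le[OF R] _ R]) simp
      then have "avg (\<lambda>y. ?sg y * P y powr (- e)) y R powr (t - 1) \<le> (?X powr e * avg ?sg y R) powr (t - 1)"
        using sq by (intro powr_mono2) (auto simp: t1)
      also have "\<dots> = ?X * (avg ?sg y R powr (q - 1)) powr s"
      proof -
        have e1: "e * (t - 1) = 1" "t - 1 = (q - 1) * s" using sq by (auto simp: e_def t1)
        have "(Y powr e * a) powr (t - 1) = Y * (a powr (q - 1)) powr s" if "0 \<le> Y" for Y a :: real
        proof -
          have "(Y powr e * a) powr (t - 1) = Y powr (e * (t - 1)) * a powr (t - 1)" by (simp only:
              powr_mult powr_powr)
          also have "\<dots> = Y powr 1 * a powr ((q - 1) * s)" by (simp only: e1(1) e1(2)[symmetric])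
          finally show ?thesis using that by (simp only: powr_powr powr_one)
        qed
        from this[OF X] show ?thesis .
      qed
      finally have "avg U y R * avg (\<lambda>y. ?sg y * P y powr (- e)) y R powr (t - 1) \<le> avg U y R * (?X *
          (avg ?sg y R powr (q - 1)) powr s)"
        using p by (intro mult_left_mono) auto
      also have "\<dots> = C_A1 * (avg w y R * avg ?sg y R powr (q - 1)) powr s"
        unfolding powr_mult using p by simp
      also have "\<dots> \<le> C_A1 * Cw powr s"
        using C_A1_pos s p by (intro mult_left_mono powr_mono2 AqD(4)[OF wA R]) auto
      finally show "avg U y R * avg (\<lambda>y. ?sg y * P y powr (- e)) y R powr (t - 1) \<le> C_A1 * Cw powr s" .
    qed
    moreover have "s * (q - 1) + 1 \<noteq> 1" using s q1 by simp
    ultimately show ?thesis unfolding A_weight_def t_def by auto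
  qed
  then have Wu: "A_RH q s u" unfolding A_RH_def us using up by simp
  have lower: "AE y in lebesgue. w y * f k y \<le> 4 ^ k * u y" for k
    using PP'
  proof eventually_elim
    case (elim y)
    have "ennreal ((1 / 4) ^ k * f k y powr s) = ennreal ((1 / 4) ^ k) * ennreal (f k y powr s)" by
        (rule ennreal_mult') simp
    also have "\<dots> \<le> P' y" by (rule term_le)
    finally have "(1 / 4) ^ k * f k y powr s \<le> P y" using Pp[of y] unfolding elim[symmetric] by simp
    then have "f k y powr s \<le> 4 ^ k * P y" by (simp add: field_simps)
    then have "(f k y powr s) powr (1 / s) \<le> (4 ^ k * P y) powr (1 / s)" using s by (intro powr_mono2) auto
    then have "f k y \<le> (4 ^ k) powr (1 / s) * P y powr (1 / s)"
      using s fp[of k y] unfolding powr_powr powr_mult by simp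
    also have "\<dots> \<le> 4 ^ k * P y powr (1 / s)"
    proof (rule mult_right_mono)
      show "(4 ^ k) powr (1 / s) \<le> (4 ^ k :: real)" using powr_mono[of "1 / s" 1 "4 ^ k"] s by simp
    qed simp
    finally have "w y * f k y \<le> w y * (4 ^ k * P y powr (1 / s))" using w_pos[of y] by (intro
        mult_left_mono) auto
    then show ?case by (simp add: u_def mult_ac)
  qed
  \<comment> \<open>\<open>epowr_suminf_le\<close> doubles the base 1/4 before the root is taken, so
    the ratio is (1/2)^(1/s) < 1.\<close>
  define g where "g = (1 / 2) powr (1 / s)"
  have g: "0 < g" "g < 1" using s powr_less_mono2[of "1 / s" "1 / 2" 1] by (auto simp: g_def)
  define C where "C = 2 powr (1 / s) * C_int * (1 / (1 - g))"
  have C: "0 < C" unfolding C_def using g C_int_pos by simp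
  have upper: "(\<integral>\<^sup>+z. ennreal (h z * u z) \<partial>lebesgue) \<le> ennreal C * N" if h: "morrey_bound h N" for h N
  proof -
    have [measurable]: "h \<in> borel_measurable lebesgue" and h0: "0 \<le> h z" for z
      using h by (auto simp: morrey_bound_def)
    have root: "epowr (P' z) (1 / s) \<le> ennreal (2 powr (1 / s)) * (\<Sum>k. ennreal (g ^ k) * ennreal (f k z))" for z
    proof -
      have "epowr (P' z) (1 / s) \<le> ennreal (2 powr (1 / s)) * (\<Sum>k. ennreal (((2 * (1 / 4)) powr (1 / s))
          ^ k) * epowr (ennreal (f k z powr s)) (1 / s))"
        unfolding P'_def using s by (intro epowr_suminf_le) auto
      moreover have "epowr (ennreal (f k z powr s)) (1 / s) = ennreal (f k z)" for k
        using s fp[of k z] by (simp add: epowr_ennreal powr_powr)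
      ultimately show ?thesis by (simp add: g_def)
    qed
    have "(\<integral>\<^sup>+z. ennreal (h z * u z) \<partial>lebesgue)
       \<le> (\<integral>\<^sup>+z. ennreal (2 powr (1 / s)) * (\<Sum>k. ennreal (g ^ k) * ennreal (h z * w z * f k z)) \<partial>lebesgue)"
    proof (rule nn_integral_mono_AE, use PP' in eventually_elim)
      case (elim z)
      have hw: "0 \<le> h z * w z" using h0[of z] w_pos[of z] by simp
      have "ennreal (h z * u z) = ennreal (h z * w z) * ennreal (P z powr (1 / s))"
        using hw unfolding u_def by (subst ennreal_mult'[symmetric]) (simp_all add: mult.assoc)
      also have "ennreal (P z powr (1 / s)) = epowr (P' z) (1 / s)"
        using Pp[of z] unfolding elim[symmetric] by (simp add: epowr_ennreal)
      also have "ennreal (h z * w z) * \<dots> \<le> ennreal (h z * w z) * (ennreal (2 powr (1 / s)) * (\<Sum>k.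
          ennreal (g ^ k) * ennreal (f k z)))"
        by (intro mult_left_mono root) simp
      also have "\<dots> = ennreal (2 powr (1 / s)) * (\<Sum>k. ennreal (h z * w z) * (ennreal (g ^ k) * ennreal (f k z)))"
        unfolding ennreal_suminf_cmult by (rule mult.left_commute)
      also have "(\<lambda>k. ennreal (h z * w z) * (ennreal (g ^ k) * ennreal (f k z))) = (\<lambda>k. ennreal (g ^ k)
          * ennreal (h z * w z * f k z))"
        using hw by (simp add: ennreal_mult' mult.left_commute)
      finally show ?case .
    qed
    also have "\<dots> = ennreal (2 powr (1 / s)) * (\<Sum>k. ennreal (g ^ k) * (\<integral>\<^sup>+z. ennreal (h z * w z * f k z)
        \<partial>lebesgue))"
      by (simp add: nn_integral_suminf nn_integral_cmult)
    also have "\<dots> \<le> ennreal (2 powr (1 / s)) * (\<Sum>k. ennreal (g ^ k) * (ennreal C_int * N))"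
      unfolding f_def by (intro mult_left_mono suminf_le psi_integral_le rs h) auto
    also have "(\<Sum>k. ennreal (g ^ k) * (ennreal C_int * N)) = ennreal (1 / (1 - g)) * (ennreal C_int * N)"
    proof -
      have "(\<Sum>k. ennreal (1 * g ^ k)) = ennreal (1 / (1 - g))"
        by (rule suminf_ennreal_geometric) (use g in auto)
      then show ?thesis unfolding ennreal_suminf_multc mult_1 by (rule arg_cong)
    qed
    also have "ennreal (2 powr (1 / s)) * (ennreal (1 / (1 - g)) * (ennreal C_int * N)) = ennreal C * N"
    proof -
      have "ennreal C = ennreal (2 powr (1 / s)) * (ennreal (1 / (1 - g)) * ennreal C_int)"
      proof -
        have "ennreal (2 powr (1 / s)) * (ennreal (1 / (1 - g)) * ennreal C_int) = ennreal (2 powr (1 /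
            s)) * ennreal (1 / (1 - g) * C_int)"
          using g by (subst ennreal_mult'[symmetric]) simp_all
        also have "\<dots> = ennreal C"
          by (rule ennreal_mult_cong) (simp_all add: C_def)
        finally show ?thesis by (rule sym)
      qed
      then show ?thesis by (simp only: mult.assoc)
    qed
    finally show ?thesis .
  qed
  show ?thesis
  proof (rule exI[of _ u], rule exI[of _ C], intro conjI allI impI)
    show "AE y in lebesgue. w y * psi (xs k) (rs k) y \<le> 4 ^ k * u y" for k
      using lower[of k] unfolding f_def .
  qed (fact Wu C upper)+
qed

text \<open>On the k-th ball w is at most \<open>C_quasi\<close> 4^k \<open>Theta\<close> u, and the
  integral of F^q u is at most C N by the Morrey bound. The one inequality in L^q(u) thus holds on
  all balls with a loss of only 4^k, against violations by (k+1) 4^k.\<close>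

theorem morrey_transfer:
  fixes FG :: "((real^'n \<Rightarrow> real) \<times> (real^'n \<Rightarrow> real)) set"
  assumes q: "1 \<le> q" and wq: "if q = 1 then A1 w Cw else Aq q w Cw"
    and FG: "\<And>F G. (F, G) \<in> FG \<Longrightarrow> F \<in> borel_measurable lebesgue \<and> G \<in> borel_measurable lebesgue \<and> (\<forall>x. 0
        \<le> F x \<and> 0 \<le> G x)"
    and ext: "\<And>u. A_RH q s u \<Longrightarrow> \<exists>C\<ge>0. \<forall>(F, G) \<in> FG.
      (\<integral>\<^sup>+x. ennreal (G x powr q * u x) \<partial>lebesgue) \<le> ennreal C * (\<integral>\<^sup>+x. ennreal (F x powr q * u x) \<partial>lebesgue)"
  shows "\<exists>C>0. \<forall>(F, G) \<in> FG. \<forall>N. morrey_bound (\<lambda>x. F x powr q) N \<longrightarrow>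
      (\<forall>x r. 0 < r \<longrightarrow> (\<integral>\<^sup>+z\<in>ball x r. ennreal (G z powr q * w z) \<partial>lebesgue) \<le> ennreal C * N * ennreal
          (Theta x r))"
proof (rule ccontr)
  assume contra: "\<not> ?thesis"
  let ?I = "\<lambda>G x r. \<integral>\<^sup>+z\<in>ball x r. ennreal (G z powr q * w z) \<partial>lebesgue"
  define B where "B k F G N x r \<longleftrightarrow> (F, G) \<in> FG \<and> morrey_bound (\<lambda>x. F x powr q) N \<and> 0 < r \<and>
      ennreal ((real k + 1) * 4 ^ k) * N * ennreal (Theta x r) < ?I G x r" for k :: nat and F G N x r
  have "\<exists>F G N x r. B k F G N x r" for k
  proof (rule ccontr)
    assume "\<not> ?thesis"
    then have "?I G x r \<le> ennreal ((real k + 1) * 4 ^ k) * N * ennreal (Theta x r)"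
      if "(F, G) \<in> FG" "morrey_bound (\<lambda>x. F x powr q) N" "0 < r" for F G N x r
      using that unfolding B_def by (meson not_less)
    moreover have "0 < (real k + 1) * 4 ^ k" by (simp add: add_nonneg_pos)
    ultimately show False using contra by blast
  qed
  then obtain F G N xs rs where "\<And>k. B k (F k) (G k) (N k) (xs k) (rs k)" by metis
  then have viol: "\<And>k. (F k, G k) \<in> FG" "\<And>k. morrey_bound (\<lambda>x. F k x powr q) (N k)" "\<And>k. 0 < rs k"
    "\<And>k. ennreal ((real k + 1) * 4 ^ k) * N k * ennreal (Theta (xs k) (rs k)) < ?I (G k) (xs k) (rs k)"
    unfolding B_def by auto
  obtain u C where u: "A_RH q s u" and C: "0 < C"
    and low: "\<And>k. AE y in lebesgue. w y * psi (xs k) (rs k) y \<le> 4 ^ k * u y"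
    and upp: "\<And>h N. morrey_bound h N \<Longrightarrow> (\<integral>\<^sup>+z. ennreal (h z * u z) \<partial>lebesgue) \<le> ennreal C * N"
    using morrey_weight_exists[OF q wq, of rs xs, OF viol(3)] by blast
  have [measurable]: "u \<in> borel_measurable lebesgue" using A_RH_pos_locint[OF u s] by (simp add: pos_locintD)
  obtain C0 where C0: "0 \<le> C0" "\<forall>(F, G) \<in> FG.
      (\<integral>\<^sup>+x. ennreal (G x powr q * u x) \<partial>lebesgue) \<le> ennreal C0 * (\<integral>\<^sup>+x. ennreal (F x powr q * u x) \<partial>lebesgue)"
    using ext[OF u] by blast
  obtain k :: nat where k: "C_quasi * C0 * C < real k" using reals_Archimedean2 by blast
  have [measurable]: "G k \<in> borel_measurable lebesgue" using FG[OF viol(1)[of k]] by auto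
  let ?T = "Theta (xs k) (rs k)"
  have T: "0 < ?T" by (rule Theta_pos[OF viol(3)])
  have "?I (G k) (xs k) (rs k) \<le> (\<integral>\<^sup>+z. ennreal (C_quasi * ?T * 4 ^ k) * ennreal (G k z powr q * u z)
      \<partial>lebesgue)"
  proof (rule nn_integral_mono_AE, use low[of k] in eventually_elim)
    case (elim z)
    show ?case
    proof (cases "z \<in> ball (xs k) (rs k)")
      case True
      have "1 \<le> C_quasi * ?T * psi (xs k) (rs k) z"
        using psi_lower[OF viol(3) True] T by (simp add: divide_simps mult_ac)
      then have "w z * 1 \<le> w z * (C_quasi * ?T * psi (xs k) (rs k) z)" using w_pos[of z] by (intro
          mult_left_mono) auto
      also have "\<dots> = (C_quasi * ?T) * (w z * psi (xs k) (rs k) z)" by (simp only: mult_ac)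
      also have "\<dots> \<le> (C_quasi * ?T) * (4 ^ k * u z)" using elim C_quasi_pos T by (intro mult_left_mono) auto
      finally have "G k z powr q * w z \<le> G k z powr q * ((C_quasi * ?T) * (4 ^ k * u z))" by (intro
          mult_left_mono) auto
      also have "\<dots> = C_quasi * ?T * 4 ^ k * (G k z powr q * u z)" by (simp only: mult_ac)
      finally have "ennreal (G k z powr q * w z) \<le> ennreal (C_quasi * ?T * 4 ^ k * (G k z powr q * u
          z))" by (rule ennreal_leI)
      also have "\<dots> = ennreal (C_quasi * ?T * 4 ^ k) * ennreal (G k z powr q * u z)"
        using C_quasi_pos T by (intro ennreal_mult') simp
      finally show ?thesis using True by simp
    qed simp
  qed
  also have "\<dots> = ennreal (C_quasi * ?T * 4 ^ k) * (\<integral>\<^sup>+z. ennreal (G k z powr q * u z) \<partial>lebesgue)"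
    by (rule nn_integral_cmult) measurable
  also have "\<dots> \<le> ennreal (C_quasi * ?T * 4 ^ k) * (ennreal C0 * (ennreal C * N k))"
  proof (rule mult_left_mono)
    have "(\<integral>\<^sup>+z. ennreal (G k z powr q * u z) \<partial>lebesgue) \<le> ennreal C0 * (\<integral>\<^sup>+z. ennreal (F k z powr q * u
        z) \<partial>lebesgue)"
      using C0(2) viol(1)[of k] by fast
    also have "\<dots> \<le> ennreal C0 * (ennreal C * N k)" by (intro mult_left_mono upp viol) simp
    finally show "(\<integral>\<^sup>+z. ennreal (G k z powr q * u z) \<partial>lebesgue) \<le> ennreal C0 * (ennreal C * N k)" .
  qed simp
  also have "\<dots> = ennreal (C_quasi * C0 * C * 4 ^ k) * N k * ennreal ?T"
  proof -
    have "ennreal (C_quasi * ?T * 4 ^ k) * (ennreal C0 * ennreal C) = ennreal (C_quasi * C0 * C * 4 ^ k)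
        * ennreal ?T"
      using C_quasi_pos C0(1) C T by (simp add: ennreal_mult'[symmetric] mult_ac)
    then have "ennreal (C_quasi * ?T * 4 ^ k) * (ennreal C0 * ennreal C) * N k = ennreal (C_quasi * C0 *
        C * 4 ^ k) * ennreal ?T * N k"
      by (rule arg_cong)
    then show ?thesis by (simp only: mult_ac)
  qed
  also have "\<dots> \<le> ennreal ((real k + 1) * 4 ^ k) * N k * ennreal ?T"
    using k by (intro mult_right_mono ennreal_leI) auto
  finally show False using viol(4)[of k] by simp
qed

end

section \<open>The classes of weights in the statement\<close>

lemma wmeas_div_emeasure:
  assumes h: "pos_locint h" and r: "0 < r"
  shows "wmeas h (ball x r) / emeasure lebesgue (ball x r) = ennreal (avg h x r)"
  using mass_pos[OF h r, of x] vol_pos[OF r, of x]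
  by (simp add: pos_locintD(4)[OF h] emeasure_ball_vol divide_ennreal avg_def del: vol_pos)

lemma pos_locint_weight:
  assumes u: "pos_locint u"
  shows "weight u"
  unfolding weight_def
proof (intro conjI allI impI)
  show "AE x in lebesgue. 0 < u x" using pos_locintD(2)[OF u] by simp
  have [measurable]: "u \<in> borel_measurable lebesgue" using u by (simp add: pos_locintD)
  fix K :: "(real^'a) set" assume K: "compact K"
  then have Kb: "K \<in> sets lebesgue" using compact_imp_closed[OF K] by (simp add: borel_closed)
  obtain r where "0 < r" "K \<subseteq> ball 0 r"
    using bounded_subset_ballD[OF compact_imp_bounded[OF K], of 0] by blast
  then have "wmeas u K \<le> wmeas u (ball 0 r)" by (intro wmeas_mono)
  also have "\<dots> < top" by (rule pos_locintD(3)[OF u])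
  finally have fin: "wmeas u K < top" .
  show "set_integrable lebesgue K u"
    unfolding set_integrable_def integrable_iff_bounded
  proof
    show "(\<lambda>x. indicat_real K x *\<^sub>R u x) \<in> borel_measurable lebesgue"
      using Kb by (intro borel_measurable_scaleR borel_measurable_indicator) auto
    have "(\<integral>\<^sup>+x. ennreal (norm (indicat_real K x *\<^sub>R u x)) \<partial>lebesgue) = wmeas u K"
      unfolding wmeas_def using pos_locint_nonneg[OF u] by (intro nn_integral_cong) (auto simp: indicator_def)
    then show "(\<integral>\<^sup>+x. ennreal (norm (indicat_real K x *\<^sub>R u x)) \<partial>lebesgue) < \<infinity>" using fin by simp
  qed
qed

text \<open>For t = s(q-1) + 1 the weights u^s and u have the same dual weight in A_t and A_q.
  Jensen's inequality turns the A_t bound into the A_q bound; since the A_q product of u is at least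
  1, the A_t bound also gives the reverse Hoelder inequality. For q = 1 both come from the A_1 bound
  of u^s.\<close>

lemma A_RH_class_membership:
  assumes u: "A_RH q s u" and q: "1 \<le> q" and s: "1 \<le> s"
  shows "u \<in> A_class q \<inter> RH_class s"
proof -
  have loc: "pos_locint u" by (rule A_RH_pos_locint[OF u s])
  have up: "0 < u x" for x using loc by (simp add: pos_locintD)
  define U where "U x = u x powr s" for x
  have A_weight_U: "A_weight (s * (q - 1) + 1) U" using u by (simp add: A_RH_def U_def[abs_def])
  have U: "pos_locint U" using A_weight_U by (rule A_weight_pos_locint)
  have root: "(\<lambda>x. U x powr (1 / s)) = u" using s up by (auto simp: U_def powr_powr less_imp_le)
  have avg_u: "avg u x r \<le> avg U x r powr (1 / s)" if "0 < r" for x r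
    using avg_powr_le[OF U, of "1 / s" r x] s that unfolding root by simp
  have "A_const q u < top \<and> RH_const s u < top"
  proof (cases "q = 1")
    case True
    then obtain C where C: "A1 U C" using A_weight_U by (auto simp: A_weight_def)
    have le: "AE y in lebesgue. y \<in> ball x r \<longrightarrow> avg U x r powr (1 / s) \<le> C powr (1 / s) * u y" if r: "0 <
        r" for x r
      using A1D(3)[OF C r, of x]
    proof eventually_elim
      case (elim y)
      show ?case
      proof
        assume "y \<in> ball x r"
        then have "avg U x r powr (1 / s) \<le> (C * U y) powr (1 / s)" using elim s by (intro powr_mono2) auto
        also have "\<dots> = C powr (1 / s) * u y" unfolding powr_mult using root by (simp add: fun_eq_iff)
        finally show "avg U x r powr (1 / s) \<le> C powr (1 / s) * u y" .
      qed
    qed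
    have "A_const q u \<le> ennreal (C powr (1 / s))"
      unfolding A_const_def if_P[OF True]
    proof (intro Inf_lower CollectI allI impI)
      fix x :: "real^'a" and r :: real assume r: "0 < r"
      show "AE y in lebesgue. y \<in> ball x r \<longrightarrow> wmeas u (ball x r) / emeasure lebesgue (ball x r) \<le> ennreal
          (C powr (1 / s)) * ennreal (u y)"
        using le[OF r, of x]
      proof eventually_elim
        case (elim y)
        show ?case
        proof
          assume "y \<in> ball x r"
          then have "avg u x r \<le> C powr (1 / s) * u y" using elim avg_u[OF r, of x] by linarith
          then have "ennreal (avg u x r) \<le> ennreal (C powr (1 / s) * u y)" by (rule ennreal_leI)
          also have "\<dots> = ennreal (C powr (1 / s)) * ennreal (u y)" by (rule ennreal_mult') simp
          finally show "wmeas u (ball x r) / emeasure lebesgue (ball x r) \<le> ennreal (C powr (1 / s)) *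
              ennreal (u y)"
            unfolding wmeas_div_emeasure[OF loc r] .
        qed
      qed
    qed
    moreover have "RH_const s u \<le> ennreal (C powr (1 / s))"
      unfolding RH_const_def
    proof (intro Inf_lower CollectI allI impI)
      fix x :: "real^'a" and r :: real assume r: "0 < r"
      let ?c = "C powr (1 / s) / avg U x r powr (1 / s)"
      have p: "0 < avg U x r powr (1 / s)" using avg_pos[OF U r, of x] by simp
      \<comment> \<open>The pointwise lower bound for u is averaged over the ball, in the form of a
        comparison of the constant weight 1 with u.\<close>
      have "avg (\<lambda>_. 1) x r \<le> ?c * avg u x r"
      proof (rule avg_mono_AE[OF loc _ _ r])
        show "AE y in lebesgue. y \<in> ball x r \<longrightarrow> 1 \<le> ?c * u y"
          using le[OF r, of x] by eventually_elim (use p in \<open>auto simp: pos_le_divide_eq\<close>)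
      qed simp
      then have "avg U x r powr (1 / s) \<le> C powr (1 / s) * avg u x r"
        using p by (simp add: avg_one[OF r] pos_le_divide_eq)
      then have "ennreal (avg U x r powr (1 / s)) \<le> ennreal (C powr (1 / s) * avg u x r)" by (rule ennreal_leI)
      also have "\<dots> = ennreal (C powr (1 / s)) * ennreal (avg u x r)" by (rule ennreal_mult') simp
      finally show "epowr (wmeas (\<lambda>y. u y powr s) (ball x r) / emeasure lebesgue (ball x r)) (1 / s)
          \<le> ennreal (C powr (1 / s)) * (wmeas u (ball x r) / emeasure lebesgue (ball x r))"
        unfolding wmeas_div_emeasure[OF loc r] wmeas_div_emeasure[OF U[unfolded U_def[abs_def]] r]
        by (simp add: epowr_ennreal U_def[abs_def])
    qed
    ultimately show ?thesis by (metis ennreal_less_top le_less_trans)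
  next
    case False
    then have q1: "1 < q" using q by simp
    define t where "t = s * (q - 1) + 1"
    have t: "t \<noteq> 1" "t - 1 = s * (q - 1)" using q1 s by (auto simp: t_def)
    obtain C where C: "Aq t U C" using A_weight_U t(1) by (auto simp: A_weight_def t_def[symmetric])
    have dual: "dual_weight t U = dual_weight q u"
    proof
      fix x
      have "s * (- 1 / (t - 1)) = - 1 / (q - 1)" unfolding t(2) using s by simp
      then show "dual_weight t U x = dual_weight q u x" unfolding U_def powr_powr by simp
    qed
    let ?sg = "dual_weight q u"
    have sg: "pos_locint ?sg" using AqD(3)[OF C] unfolding dual .
    have key: "avg U x r powr (1 / s) * avg ?sg x r powr (q - 1) \<le> C powr (1 / s)" if r: "0 < r" for x r
    proof -
      have "(avg U x r * avg ?sg x r powr (t - 1)) powr (1 / s) \<le> C powr (1 / s)"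
        using AqD(4)[OF C r, of x] s unfolding dual by (intro powr_mono2) auto
      moreover have "(t - 1) * (1 / s) = q - 1" unfolding t(2) using s by simp
      ultimately show ?thesis unfolding powr_mult powr_powr by simp
    qed
    have "A_const q u \<le> ennreal (C powr (1 / s))"
      unfolding A_const_def if_not_P[OF False]
    proof (rule SUP_least)
      fix i :: "(real^'a) \<times> real" assume i: "i \<in> UNIV \<times> {0<..}"
      obtain x r where xr: "i = (x, r)" by (cases i)
      have r: "0 < r" using i xr by simp
      have e: "1 - conj_exp (ereal q) = - 1 / (q - 1)" using q1 by (simp add: conj_exp_def field_simps)
      have "avg u x r * avg ?sg x r powr (q - 1) \<le> C powr (1 / s)"
        using mult_right_mono[OF avg_u[OF r, of x], of "avg ?sg x r powr (q - 1)"] key[OF r, of x] by simp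
      then have "ennreal (avg u x r * avg ?sg x r powr (q - 1)) \<le> ennreal (C powr (1 / s))" by (rule
          ennreal_leI)
      moreover have eq: "ennreal (avg u x r * avg ?sg x r powr (q - 1)) = ennreal (avg u x r) * epowr
          (ennreal (avg ?sg x r)) (q - 1)"
        by (simp add: epowr_ennreal ennreal_mult')
      ultimately have "ennreal (avg u x r) * epowr (ennreal (avg ?sg x r)) (q - 1) \<le> ennreal (C powr (1 / s))"
        by (simp only: eq)
      then show "(case i of (x, r) \<Rightarrow> wmeas u (ball x r) / emeasure lebesgue (ball x r) *
          epowr (wmeas (\<lambda>y. u y powr (1 - conj_exp (ereal q))) (ball x r) / emeasure lebesgue (ball x
              r)) (q - 1)) \<le> ennreal (C powr (1 / s))"
        unfolding xr prod.case e wmeas_div_emeasure[OF loc r] wmeas_div_emeasure[OF sg r] .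
    qed
    moreover have "RH_const s u \<le> ennreal (C powr (1 / s))"
      unfolding RH_const_def
    proof (intro Inf_lower CollectI allI impI)
      fix x :: "real^'a" and r :: real assume r: "0 < r"
      have "avg U x r powr (1 / s) * 1 \<le> avg U x r powr (1 / s) * (avg u x r * avg ?sg x r powr (q - 1))"
        by (intro mult_left_mono avg_dual_weight_ge[OF loc sg q1 r]) simp
      also have "\<dots> = (avg U x r powr (1 / s) * avg ?sg x r powr (q - 1)) * avg u x r" by (simp only: mult_ac)
      also have "\<dots> \<le> C powr (1 / s) * avg u x r" by (intro mult_right_mono key[OF r]) simp
      finally have "ennreal (avg U x r powr (1 / s)) \<le> ennreal (C powr (1 / s) * avg u x r)" by (simp
          add: ennreal_leI)
      also have "\<dots> = ennreal (C powr (1 / s)) * ennreal (avg u x r)" by (rule ennreal_mult') simp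
      finally show "epowr (wmeas (\<lambda>y. u y powr s) (ball x r) / emeasure lebesgue (ball x r)) (1 / s)
          \<le> ennreal (C powr (1 / s)) * (wmeas u (ball x r) / emeasure lebesgue (ball x r))"
        unfolding wmeas_div_emeasure[OF loc r] wmeas_div_emeasure[OF U[unfolded U_def[abs_def]] r]
        by (simp add: epowr_ennreal U_def[abs_def])
    qed
    ultimately show ?thesis by (metis ennreal_less_top le_less_trans)
  qed
  then show ?thesis using pos_locint_weight[OF loc] by (simp add: A_class_def RH_class_def)
qed

text \<open>A weight is positive only almost everywhere, and real powers of its other values are meaningless.\<close>

definition pos_version :: "(real^'n \<Rightarrow> real) \<Rightarrow> real^'n \<Rightarrow> real" where
  "pos_version w x = (if 0 < w x then w x else 1)"

section \<open>Positive representatives of weights\<close>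

text \<open>\<open>weight\<close> provides integrability on compact sets; w is the pointwise limit
  of its restrictions to growing balls.\<close>

lemma weight_measurable:
  fixes w :: "real^'n \<Rightarrow> real"
  assumes "weight w"
  shows "w \<in> borel_measurable lebesgue"
proof (rule borel_measurable_LIMSEQ_real)
  show "(\<lambda>x. indicat_real (cball 0 (real i)) x *\<^sub>R w x) \<in> borel_measurable lebesgue" for i
    using assms unfolding weight_def set_integrable_def by (intro borel_measurable_integrable) auto
  fix x :: "real^'n"
  obtain m :: nat where "norm x \<le> real m" using real_arch_simple by blast
  then have "\<forall>i\<ge>m. indicat_real (cball 0 (real i)) x *\<^sub>R w x = w x" by (auto simp: indicator_def)
  then show "(\<lambda>i. indicat_real (cball 0 (real i)) x *\<^sub>R w x) \<longlonglongrightarrow> w x"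
    by (intro tendsto_eventually) (auto simp: eventually_sequentially)
qed

lemma pos_version_AE: "weight w \<Longrightarrow> AE x in lebesgue. pos_version w x = w x"
  unfolding weight_def by (auto simp: pos_version_def elim: eventually_mono)

lemma wmeas_cong_AE: "AE x in lebesgue. f x = g x \<Longrightarrow> wmeas f E = wmeas g E"
  unfolding wmeas_def by (intro nn_integral_cong_AE) (auto elim: eventually_mono)

lemma wmeas_pos_version: "weight w \<Longrightarrow> wmeas (pos_version w) E = wmeas w E"
  by (intro wmeas_cong_AE pos_version_AE)

lemma wmeas_pos_version_powr: "weight w \<Longrightarrow> wmeas (\<lambda>x. pos_version w x powr a) E = wmeas (\<lambda>x. w x powr a) E"
  by (rule wmeas_cong_AE, drule pos_version_AE, erule eventually_mono) simp

lemma pos_version_pos: "0 < pos_version w x"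
  by (simp add: pos_version_def)

lemma pos_version_measurable: "weight w \<Longrightarrow> pos_version w \<in> borel_measurable lebesgue"
  using weight_measurable[of w] unfolding pos_version_def[abs_def] by measurable

lemma average_finite_imp:
  fixes x :: "real^'n"
  assumes "wmeas h (ball x r) / emeasure lebesgue (ball x r) < top" "0 < r"
  shows "\<exists>A. wmeas h (ball x r) \<le> ennreal A"
proof -
  have "wmeas h (ball x r) \<noteq> top"
    using assms by (auto simp: emeasure_ball_vol ennreal_top_divide)
  then show ?thesis by (cases "wmeas h (ball x r)") auto
qed

lemma weight_pos_locint:
  assumes w: "weight w"
  shows "pos_locint (pos_version w)"
  using weight_average(2)[OF w] pos_version_measurable[OF w]
  by (intro pos_locintI average_finite_imp) (auto simp: pos_version_pos wmeas_pos_version[OF w])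

text \<open>Averages do not see the null set on which w is changed. For q > 1 local integrability of
  the dual weight is a consequence: the product in the A_q constant is finite and its first factor
  is positive.\<close>

lemma A_class_pos_version:
  assumes w: "w \<in> A_class q" and q: "1 \<le> q"
  shows "\<exists>C. if q = 1 then A1 (pos_version w) C else Aq q (pos_version w) C"
proof -
  have wt: "weight w" and fin: "A_const q w < top" using w by (auto simp: A_class_def)
  have loc: "pos_locint (pos_version w)" by (rule weight_pos_locint[OF wt])
  have avw: "wmeas w (ball x r) / emeasure lebesgue (ball x r) = ennreal (avg (pos_version w) x r)" if
      "0 < r" for x r
    using wmeas_div_emeasure[OF loc that, of x] by (simp add: wmeas_pos_version[OF wt])
  show ?thesis
  proof (cases "q = 1")
    case True
    obtain c where c: "c < top" "\<And>x r. 0 < r \<Longrightarrow> AE y in lebesgue. y \<in> ball x r \<longrightarrow>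
        wmeas w (ball x r) / emeasure lebesgue (ball x r) \<le> c * ennreal (w y)"
      using fin True by (auto simp: A_const_def Inf_less_iff)
    obtain c' where c': "c = ennreal c'" "0 \<le> c'" using c(1) by (cases c) auto
    \<comment> \<open>The added 1 secures the positive constant that \<open>A1\<close>
      demands.\<close>
    have "A1 (pos_version w) (c' + 1)"
      unfolding A1_def
    proof (intro conjI allI impI loc)
      show "0 < c' + 1" using c' by simp
      fix x :: "real^'a" and r :: real assume r: "0 < r"
      show "AE y in lebesgue. y \<in> ball x r \<longrightarrow> avg (pos_version w) x r \<le> (c' + 1) * pos_version w y"
        using c(2)[OF r, of x] pos_version_AE[OF wt]
      proof eventually_elim
        case (elim y)
        show ?case
        proof
          assume "y \<in> ball x r"
          then have "ennreal (avg (pos_version w) x r) \<le> ennreal (c' * pos_version w y)"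
            using elim c' pos_version_pos[of w y] unfolding avw[OF r] by (simp add: ennreal_mult')
          then have "avg (pos_version w) x r \<le> c' * pos_version w y"
            using c' pos_version_pos[of w y] by (subst (asm) ennreal_le_iff) auto
          also have "\<dots> \<le> (c' + 1) * pos_version w y" using pos_version_pos[of w y] by (intro
              mult_right_mono) auto
          finally show "avg (pos_version w) x r \<le> (c' + 1) * pos_version w y" .
        qed
      qed
    qed
    then show ?thesis using True by auto
  next
    case False
    then have q1: "1 < q" using q by simp
    let ?sg = "dual_weight q (pos_version w)"
    have e: "1 - conj_exp (ereal q) = - 1 / (q - 1)" using q1 by (simp add: conj_exp_def field_simps)
    have prod: "ennreal (avg (pos_version w) x r) * epowr (wmeas ?sg (ball x r) / emeasure lebesgue
        (ball x r)) (q - 1) \<le> A_const q w"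
      if r: "0 < r" for x r
    proof -
      have "wmeas w (ball x r) / emeasure lebesgue (ball x r) *
          epowr (wmeas (\<lambda>y. w y powr (1 - conj_exp (ereal q))) (ball x r) / emeasure lebesgue (ball x
              r)) (q - 1) \<le> A_const q w"
        unfolding A_const_def if_not_P[OF False] using r by (intro SUP_upper2[of "(x, r)"]) auto
      then show ?thesis unfolding avw[OF r] e wmeas_pos_version_powr[OF wt] .
    qed
    have sg: "pos_locint ?sg"
    proof (rule pos_locintI)
      show "?sg \<in> borel_measurable lebesgue" using pos_version_measurable[OF wt] by measurable
      show "0 < ?sg x" for x using pos_version_pos[of w x] by simp
      fix x :: "real^'a" and r :: real assume r: "0 < r"
      have "epowr (wmeas ?sg (ball x r) / emeasure lebesgue (ball x r)) (q - 1) \<noteq> top"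
      proof
        assume "epowr (wmeas ?sg (ball x r) / emeasure lebesgue (ball x r)) (q - 1) = top"
        then have "top \<le> A_const q w"
          using prod[OF r, of x] avg_pos[OF loc r, of x] by (simp add: ennreal_mult_top ennreal_eq_0_iff)
        then show False using fin by simp
      qed
      then have "wmeas ?sg (ball x r) / emeasure lebesgue (ball x r) < top"
        by (metis epowr_less_top_iff less_top)
      then show "\<exists>A. wmeas ?sg (ball x r) \<le> ennreal A" by (rule average_finite_imp[OF _ r])
    qed
    obtain C where C: "A_const q w = ennreal C" "0 \<le> C" using fin by (cases "A_const q w") auto
    have "Aq q (pos_version w) C"
      unfolding Aq_def
    proof (intro conjI allI impI q1 loc sg)
      fix x :: "real^'a" and r :: real assume r: "0 < r"
      have "ennreal (avg (pos_version w) x r * avg ?sg x r powr (q - 1)) \<le> ennreal C"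
        using prod[OF r, of x] unfolding wmeas_div_emeasure[OF sg r] C(1) by (simp add: epowr_ennreal
            ennreal_mult')
      then show "avg (pos_version w) x r * avg ?sg x r powr (q - 1) \<le> C" using C(2) by simp
    qed
    then show ?thesis using False by auto
  qed
qed

lemma RH_class_pos_version:
  assumes w: "w \<in> RH_class s" and s: "1 \<le> s"
  shows "pos_locint (\<lambda>x. pos_version w x powr s)"
    and "\<exists>C>0. \<forall>x r. 0 < r \<longrightarrow> avg (\<lambda>x. pos_version w x powr s) x r powr (1 / s) \<le> C * avg (pos_version w) x r"
proof -
  have wt: "weight w" and fin: "RH_const s w < top" using w by (auto simp: RH_class_def)
  have loc: "pos_locint (pos_version w)" by (rule weight_pos_locint[OF wt])
  have avw: "wmeas w (ball x r) / emeasure lebesgue (ball x r) = ennreal (avg (pos_version w) x r)" if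
      "0 < r" for x r
    using wmeas_div_emeasure[OF loc that, of x] by (simp add: wmeas_pos_version[OF wt])
  obtain c where c: "c < top" "\<And>x r. 0 < r \<Longrightarrow> epowr (wmeas (\<lambda>y. w y powr s) (ball x r) / emeasure
      lebesgue (ball x r)) (1 / s)
        \<le> c * (wmeas w (ball x r) / emeasure lebesgue (ball x r))"
    using fin by (auto simp: RH_const_def Inf_less_iff)
  obtain c' where c': "c = ennreal c'" "0 \<le> c'" using c(1) by (cases c) auto
  have le: "epowr (wmeas (\<lambda>y. pos_version w y powr s) (ball x r) / emeasure lebesgue (ball x r)) (1 / s)
      \<le> ennreal (c' * avg (pos_version w) x r)"
    if r: "0 < r" for x r
    using c(2)[OF r, of x] c' unfolding avw[OF r] wmeas_pos_version_powr[OF wt] by (simp add: ennreal_mult')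
  show ws: "pos_locint (\<lambda>x. pos_version w x powr s)"
  proof (rule pos_locintI)
    show "(\<lambda>x. pos_version w x powr s) \<in> borel_measurable lebesgue" using pos_version_measurable[OF wt]
        by measurable
    show "0 < pos_version w x powr s" for x using pos_version_pos[of w x] by simp
    fix x :: "real^'a" and r :: real assume r: "0 < r"
    have "epowr (wmeas (\<lambda>y. pos_version w y powr s) (ball x r) / emeasure lebesgue (ball x r)) (1 / s) < top"
      using le[OF r, of x] by (rule le_less_trans) simp
    then have "wmeas (\<lambda>y. pos_version w y powr s) (ball x r) / emeasure lebesgue (ball x r) < top" by simp
    then show "\<exists>A. wmeas (\<lambda>y. pos_version w y powr s) (ball x r) \<le> ennreal A" by (rule
        average_finite_imp[OF _ r])
  qed
  show "\<exists>C>0. \<forall>x r. 0 < r \<longrightarrow> avg (\<lambda>x. pos_version w x powr s) x r powr (1 / s) \<le> C * avg (pos_version w) x r"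
  proof (intro exI[of _ "c' + 1"] conjI allI impI)
    show "0 < c' + 1" using c' by simp
    fix x r assume r: "0 < (r::real)"
    have "ennreal (avg (\<lambda>x. pos_version w x powr s) x r powr (1 / s)) \<le> ennreal (c' * avg (pos_version w) x r)"
      using le[OF r, of x] unfolding wmeas_div_emeasure[OF ws r] by (simp add: epowr_ennreal)
    then have "avg (\<lambda>x. pos_version w x powr s) x r powr (1 / s) \<le> c' * avg (pos_version w) x r"
      using c' by (subst (asm) ennreal_le_iff) auto
    also have "\<dots> \<le> (c' + 1) * avg (pos_version w) x r" by (intro mult_right_mono) auto
    finally show "avg (\<lambda>x. pos_version w x powr s) x r powr (1 / s) \<le> (c' + 1) * avg (pos_version w) x r" .
  qed
qed

section \<open>Power weights\<close>

lemma indicator_mono_subset: "A \<subseteq> B \<Longrightarrow> indicator A x \<le> (indicator B x :: ennreal)"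
  by (auto simp: indicator_def)

context morrey_weight
begin

lemma wmeas_w: "wmeas w (ball x t) = ennreal (mass w x t)"
  by (rule pos_locintD(4)[OF w])

text \<open>It vanishes at the origin, even for \<alpha> = 0 because \<open>0 powr 0 = 0\<close>.
  Hence \<open>pos_locint\<close> fails for it, and its masses are treated separately.\<close>

definition power_weight :: "real \<Rightarrow> real^'n \<Rightarrow> real" where
  "power_weight \<alpha> x = norm x powr \<alpha> * w x"

lemma power_weight_measurable [measurable]: "power_weight \<alpha> \<in> borel_measurable lebesgue"
proof -
  have [measurable]: "(\<lambda>x::real^'n. norm x) \<in> borel_measurable lebesgue"
    by (rule borel_imp_lebesgue_measurable) measurable
  show ?thesis unfolding power_weight_def by measurable
qed

lemma power_weight_nonneg: "0 \<le> power_weight \<alpha> x"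
  using w_pos[of x] by (simp add: power_weight_def)

lemma wmeas_power_weight_upper:
  assumes \<alpha>: "0 \<le> \<alpha>" and t: "0 < t"
  shows "wmeas (power_weight \<alpha>) (ball x t) \<le> ennreal ((2 * max (norm x) t) powr \<alpha> * mass w x t)"
proof -
  have "wmeas (power_weight \<alpha>) (ball x t) \<le> ennreal ((2 * max (norm x) t) powr \<alpha>) * wmeas w (ball x t)"
  proof (rule wmeas_mono_AE)
    show "AE y in lebesgue. y \<in> ball x t \<longrightarrow> power_weight \<alpha> y \<le> (2 * max (norm x) t) powr \<alpha> * w y"
    proof (rule AE_I2, rule impI)
      fix y assume "y \<in> ball x t"
      moreover have "norm y \<le> norm x + dist x y" unfolding dist_norm using norm_triangle_ineq4[of x "x -
          y"] by simp
      ultimately have "norm y \<le> 2 * max (norm x) t" by (simp add: max_def)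
      then show "power_weight \<alpha> y \<le> (2 * max (norm x) t) powr \<alpha> * w y"
        unfolding power_weight_def using \<alpha> w_pos[of y] by (intro mult_right_mono powr_mono2) auto
    qed
  qed (use w_pos in \<open>auto simp: less_imp_le\<close>)
  also have "\<dots> = ennreal ((2 * max (norm x) t) powr \<alpha> * mass w x t)"
    unfolding wmeas_w by (rule ennreal_mult'[symmetric]) simp
  finally show ?thesis .
qed

lemma wmeas_power_weight:
  assumes "0 \<le> \<alpha>" "0 < t"
  shows "wmeas (power_weight \<alpha>) (ball x t) = ennreal (mass (power_weight \<alpha>) x t)"
proof -
  have "wmeas (power_weight \<alpha>) (ball x t) < top" using wmeas_power_weight_upper[OF assms, of x] by (rule
      le_less_trans) simp
  then show ?thesis by (simp add: mass_def)
qed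

lemma mass_power_weight_upper:
  assumes "0 \<le> \<alpha>" "0 < t"
  shows "mass (power_weight \<alpha>) x t \<le> (2 * max (norm x) t) powr \<alpha> * mass w x t"
  by (rule mass_le[OF wmeas_power_weight_upper[OF assms]]) simp

definition C_lower :: "real \<Rightarrow> real" where
  "C_lower \<alpha> = 2 powr \<alpha> * (D * 8 powr K)"

lemma C_lower_pos: "0 < C_lower \<alpha>"
  using D by (simp add: C_lower_def)

text \<open>The ball \<open>B(x, t)\<close> contains a ball of radius \<open>t/4\<close> pushed away from the origin, on which
  \<open>\<bar>y\<bar>\<close> is comparable to \<open>max \<bar>x\<bar> t\<close>.\<close>

lemma mass_power_weight_lower:
  assumes \<alpha>: "0 \<le> \<alpha>" and t: "0 < t"
  shows "max (norm x) t powr \<alpha> * mass w x t \<le> C_lower \<alpha> * mass (power_weight \<alpha>) x t"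
proof -
  let ?m = "max (norm x) t"
  have m: "0 < ?m" using t by simp
  obtain e :: "real^'n" where e: "norm e = 1" "x = norm x *\<^sub>R e"
  proof (cases "x = 0")
    case True
    obtain e :: "real^'n" where "norm e = 1" using vector_choose_size[of 1] by auto
    then show ?thesis using that[of e] True by simp
  next
    case False
    then show ?thesis using that[of "x /\<^sub>R norm x"] by simp
  qed
  \<comment> \<open>Moving the centre outwards by 3t/4 gives |y| > |x| + t/2 on the ball of radius
    t/4, which still lies in the original one.\<close>
  define z where "z = x + (3 * t / 4) *\<^sub>R e"
  have dzx: "dist z x = 3 * t / 4" using e(1) t by (simp add: z_def dist_norm)
  have nz: "norm z = norm x + 3 * t / 4"
  proof -
    have "z = (norm x + 3 * t / 4) *\<^sub>R e" unfolding z_def scaleR_add_left using e(2) by simp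
    then have "norm z = \<bar>norm x + 3 * t / 4\<bar> * norm e" by simp
    also have "\<dots> = norm x + 3 * t / 4" using e(1) t by simp
    finally show ?thesis .
  qed
  have sub: "ball z (t / 4) \<subseteq> ball x t" "ball x t \<subseteq> ball z (2 * t)"
    using dzx t by (simp_all add: ball_subset_ball_iff dist_commute)
  have "mass w x t \<le> mass w z (2 * t)" by (rule mass_mono_w[OF sub(2)])
  also have "\<dots> \<le> D * (2 * t / (t / 4)) powr K * mass w z (t / 4)" using t by (intro dbl subset_ball) auto
  also have "2 * t / (t / 4) = 8" using t by simp
  finally have 1: "mass w x t \<le> D * 8 powr K * mass w z (t / 4)" .
  have "wmeas w (ball z (t / 4)) \<le> ennreal ((?m / 2) powr (- \<alpha>)) * wmeas (power_weight \<alpha>) (ball z (t / 4))"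
  proof (rule wmeas_mono_AE)
    show "AE y in lebesgue. y \<in> ball z (t / 4) \<longrightarrow> w y \<le> (?m / 2) powr (- \<alpha>) * power_weight \<alpha> y"
    proof (rule AE_I2, rule impI)
      fix y assume y: "y \<in> ball z (t / 4)"
      have "norm z \<le> norm y + dist z y" unfolding dist_norm using norm_triangle_ineq[of y "z - y"] by simp
      moreover have "dist z y < t / 4" using y by simp
      ultimately have "norm x / 2 \<le> norm y" "t / 2 \<le> norm y" using nz t norm_ge_zero[of x] by linarith+
      then have "?m / 2 \<le> norm y" by (simp add: max_def)
      then have "1 * (?m / 2) powr \<alpha> \<le> norm y powr \<alpha>" using m \<alpha> by (simp add: powr_mono2)
      then have "1 \<le> (?m / 2) powr (- \<alpha>) * norm y powr \<alpha>"
        using m by (simp add: powr_minus divide_simps)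
      then have "1 * w y \<le> ((?m / 2) powr (- \<alpha>) * norm y powr \<alpha>) * w y"
        using w_pos[of y] by (intro mult_right_mono) auto
      then show "w y \<le> (?m / 2) powr (- \<alpha>) * power_weight \<alpha> y" by (simp add: power_weight_def mult_ac)
    qed
  qed (use power_weight_nonneg in auto)
  also have "\<dots> \<le> ennreal ((?m / 2) powr (- \<alpha>)) * wmeas (power_weight \<alpha>) (ball x t)"
    by (intro mult_left_mono wmeas_mono sub) simp
  also have "\<dots> = ennreal ((?m / 2) powr (- \<alpha>) * mass (power_weight \<alpha>) x t)"
    unfolding wmeas_power_weight[OF \<alpha> t] by (rule ennreal_mult'[symmetric]) simp
  finally have 2: "mass w z (t / 4) \<le> (?m / 2) powr (- \<alpha>) * mass (power_weight \<alpha>) x t"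
    unfolding wmeas_w by (subst (asm) ennreal_le_iff) auto
  have "?m powr \<alpha> * mass w x t \<le> ?m powr \<alpha> * (D * 8 powr K * ((?m / 2) powr (- \<alpha>) * mass (power_weight \<alpha>) x t))"
  proof (rule mult_left_mono)
    have "D * 8 powr K * mass w z (t / 4) \<le> D * 8 powr K * ((?m / 2) powr (- \<alpha>) * mass (power_weight \<alpha>) x t)"
      using D by (intro mult_left_mono 2) auto
    then show "mass w x t \<le> D * 8 powr K * ((?m / 2) powr (- \<alpha>) * mass (power_weight \<alpha>) x t)" using 1 by
        linarith
  qed simp
  also have "\<dots> = (?m powr \<alpha> * (?m / 2) powr (- \<alpha>)) * (D * 8 powr K) * mass (power_weight \<alpha>) x t" by
      (simp only: mult_ac)
  also have "?m powr \<alpha> * (?m / 2) powr (- \<alpha>) = 2 powr \<alpha>"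
    unfolding powr_minus_divide powr_divide using m by simp
  finally show ?thesis by (simp add: C_lower_def)
qed

lemma mass_power_weight_pos:
  assumes "0 \<le> \<alpha>" "0 < t"
  shows "0 < mass (power_weight \<alpha>) x t"
proof -
  have "0 < max (norm x) t powr \<alpha> * mass w x t" using assms mass_w_pos[of t x] by (intro mult_pos_pos) auto
  also have "\<dots> \<le> C_lower \<alpha> * mass (power_weight \<alpha>) x t" by (rule mass_power_weight_lower[OF assms])
  finally show ?thesis using C_lower_pos[of \<alpha>] by (simp add: zero_less_mult_iff)
qed

text \<open>The summand 1 serves balls with |x| \<ge> 2t, the other summand the balls close to the
  origin.\<close>

definition C_in :: "real \<Rightarrow> real" where
  "C_in \<alpha> = 2 powr (\<alpha> * (1 + b)) *
     (1 + Ct powr b / (1 - (1 / 2) powr (l1 - \<beta> + k1 * b)) * (C_comp 3 * (3 powr \<beta> * (D * 4 powr K) powr b)))"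

text \<open>If |x| \<ge> 2t, then |y| is comparable with |x| on the ball. Any other ball lies in the
  ball of radius 3t about 0, where |y|^-\<alpha> may be unbounded; the sum over dyadic shells about
  0 converges by \<open>E2\<close>. The exponent \<beta> = \<alpha>(1 - b) is what is left of
  \<alpha> after the power b of the mass in the Morrey norm has absorbed \<alpha> b.\<close>

lemma morrey_bound_of_power_weight:
  assumes \<alpha>: "0 \<le> \<alpha>" "\<beta> = \<alpha> * (1 - b)" and h[measurable]: "h \<in> borel_measurable lebesgue" and h0: "\<And>x. 0 \<le> h x"
    and bound: "\<And>x t. 0 < t \<Longrightarrow> (\<integral>\<^sup>+y\<in>ball x t. ennreal (h y * power_weight \<alpha> y) \<partial>lebesgue) \<le> N * ennreal
        (t powr l1 * mass (power_weight \<alpha>) x t powr b)"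
  shows "morrey_bound h (ennreal (C_in \<alpha>) * N)" "0 < C_in \<alpha>"
proof -
  define g where "g = (1 / 2) powr (l1 - \<beta> + k1 * b)"
  have g: "0 < g" "g < 1" using E2 powr_less_mono2[of "l1 - \<beta> + k1 * b" "1 / 2" 1] by (auto simp: g_def)
  define A where "A = Ct powr b / (1 - g) * (C_comp 3 * (3 powr \<beta> * (D * 4 powr K) powr b))"
  have A: "0 < A" unfolding A_def using g Ct D C_comp_pos[of 3] by simp
  have C4_eq: "C_in \<alpha> = 2 powr (\<alpha> * (1 + b)) * (1 + A)" by (simp add: C_in_def A_def g_def)
  show C4: "0 < C_in \<alpha>" unfolding C4_eq using A by simp
  have upper: "(\<integral>\<^sup>+y\<in>ball x t. ennreal (h y * power_weight \<alpha> y) \<partial>lebesgue)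
      \<le> N * ennreal (2 powr (\<alpha> * b) * (max (norm x) t powr (\<alpha> * b) * (t powr l1 * mass w x t powr b)))"
    if t: "0 < t" for x t
  proof -
    have "mass (power_weight \<alpha>) x t powr b \<le> ((2 * max (norm x) t) powr \<alpha> * mass w x t) powr b"
      using b by (intro powr_mono2 mass_power_weight_upper \<alpha> t) auto
    also have "\<dots> = 2 powr (\<alpha> * b) * max (norm x) t powr (\<alpha> * b) * mass w x t powr b"
      by (simp only: powr_mult powr_powr)
    finally have "t powr l1 * mass (power_weight \<alpha>) x t powr b \<le> t powr l1 * (2 powr (\<alpha> * b) * max (norm
        x) t powr (\<alpha> * b) * mass w x t powr b)"
      by (rule mult_left_mono) simp
    then have "N * ennreal (t powr l1 * mass (power_weight \<alpha>) x t powr b)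
        \<le> N * ennreal (t powr l1 * (2 powr (\<alpha> * b) * max (norm x) t powr (\<alpha> * b) * mass w x t powr b))"
      by (rule mult_left_mono[OF ennreal_leI]) simp
    also have "t powr l1 * (2 powr (\<alpha> * b) * max (norm x) t powr (\<alpha> * b) * mass w x t powr b)
        = 2 powr (\<alpha> * b) * (max (norm x) t powr (\<alpha> * b) * (t powr l1 * mass w x t powr b))" by (simp
            only: mult_ac)
    finally show ?thesis using bound[OF t, of x] by (rule order_trans[rotated])
  qed
  have meas: "(\<lambda>y. ennreal (h y * power_weight \<alpha> y) * indicator (ball x t) y) \<in> borel_measurable
      lebesgue" for x t by measurable
  have scale: "ennreal (h y * w y) \<le> ennreal (c powr (- \<alpha>)) * ennreal (h y * power_weight \<alpha> y)"
    if c: "0 < c" "c \<le> norm y" for y c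
  proof -
    have "1 * c powr \<alpha> \<le> norm y powr \<alpha>" using c \<alpha> by (simp add: powr_mono2)
    then have "1 \<le> c powr (- \<alpha>) * norm y powr \<alpha>" using c by (simp add: powr_minus divide_simps)
    then have "1 * (h y * w y) \<le> (c powr (- \<alpha>) * norm y powr \<alpha>) * (h y * w y)"
      using h0[of y] w_pos[of y] by (intro mult_right_mono) auto
    also have "\<dots> = c powr (- \<alpha>) * (h y * power_weight \<alpha> y)" by (simp add: power_weight_def mult_ac)
    finally have "ennreal (h y * w y) \<le> ennreal (c powr (- \<alpha>) * (h y * power_weight \<alpha> y))" by (simp add:
        ennreal_leI)
    also have "\<dots> = ennreal (c powr (- \<alpha>)) * ennreal (h y * power_weight \<alpha> y)" by (rule ennreal_mult') simp
    finally show ?thesis .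
  qed
  have exponent: "- \<alpha> + \<alpha> * b = - \<beta>" unfolding \<alpha>(2) by (simp add: algebra_simps)
  have two: "\<alpha> + \<alpha> * b = \<alpha> * (1 + b)" by (simp add: distrib_left)
  have near: "(\<integral>\<^sup>+y\<in>ball x t. ennreal (h y * w y) \<partial>lebesgue) \<le> N * ennreal (2 powr (\<alpha> * (1 + b)) * Theta x t)"
    if t: "0 < t" and x: "2 * t \<le> norm x" for x t
  proof -
    have m: "max (norm x) t = norm x" "0 < norm x" using t x by auto
    have "(\<integral>\<^sup>+y\<in>ball x t. ennreal (h y * w y) \<partial>lebesgue)
      \<le> (\<integral>\<^sup>+y. ennreal ((norm x / 2) powr (- \<alpha>)) * (ennreal (h y * power_weight \<alpha> y) * indicator (ball x
          t) y) \<partial>lebesgue)"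
    proof (rule nn_integral_mono)
      fix y
      show "ennreal (h y * w y) * indicator (ball x t) y
          \<le> ennreal ((norm x / 2) powr (- \<alpha>)) * (ennreal (h y * power_weight \<alpha> y) * indicator (ball x t) y)"
      proof (cases "y \<in> ball x t")
        case True
        have "norm x \<le> norm y + dist x y" unfolding dist_norm using norm_triangle_ineq[of y "x - y"] by simp
        then have "norm x / 2 \<le> norm y" using True x by simp
        then show ?thesis using scale[of "norm x / 2" y] m True by simp
      qed simp
    qed
    also have "\<dots> = ennreal ((norm x / 2) powr (- \<alpha>)) * (\<integral>\<^sup>+y\<in>ball x t. ennreal (h y * power_weight \<alpha> y)
        \<partial>lebesgue)"
      by (rule nn_integral_cmult[OF meas])
    also have "\<dots> \<le> ennreal ((norm x / 2) powr (- \<alpha>)) * (N * ennreal (2 powr (\<alpha> * b) * (max (norm x) t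
        powr (\<alpha> * b) * (t powr l1 * mass w x t powr b))))"
      by (intro mult_left_mono upper t) simp
    also have "\<dots> = N * (ennreal ((norm x / 2) powr (- \<alpha>)) * ennreal (2 powr (\<alpha> * b) * (max (norm x) t
        powr (\<alpha> * b) * (t powr l1 * mass w x t powr b))))"
      by (rule mult.left_commute)
    also have "ennreal ((norm x / 2) powr (- \<alpha>)) * ennreal (2 powr (\<alpha> * b) * (max (norm x) t powr (\<alpha> *
        b) * (t powr l1 * mass w x t powr b)))
        = ennreal (2 powr (\<alpha> * (1 + b)) * Theta x t)"
    proof (rule ennreal_mult_cong)
      have "(norm x / 2) powr (- \<alpha>) = 2 powr \<alpha> * norm x powr (- \<alpha>)"
        unfolding powr_divide powr_minus_divide by simp
      then have "(norm x / 2) powr (- \<alpha>) * (2 powr (\<alpha> * b) * (max (norm x) t powr (\<alpha> * b) * (t powr l1 *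
          mass w x t powr b)))
        = (2 powr \<alpha> * 2 powr (\<alpha> * b)) * ((norm x powr (- \<alpha>) * norm x powr (\<alpha> * b)) * (t powr l1 * mass w
            x t powr b))"
        unfolding m(1) by (simp only: mult_ac)
      then show "(norm x / 2) powr (- \<alpha>) * (2 powr (\<alpha> * b) * (max (norm x) t powr (\<alpha> * b) * (t powr l1 *
          mass w x t powr b)))
        = 2 powr (\<alpha> * (1 + b)) * Theta x t"
        unfolding two Theta_def m(1) powr_add[symmetric] exponent .
    qed simp
    finally show ?thesis .
  qed
  have origin: "(\<integral>\<^sup>+y\<in>ball 0 T. ennreal (h y * w y) \<partial>lebesgue)
      \<le> N * ennreal (2 powr (\<alpha> * (1 + b)) * (Ct powr b / (1 - g)) * Theta 0 T)" if T: "0 < T" for T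
  proof -
    define t where "t i = T / 2 ^ i" for i :: nat
    have t: "0 < t i" "t i \<le> T" for i using T by (auto simp: t_def divide_le_eq)
    let ?E = "2 powr (\<alpha> * (1 + b)) * (Ct powr b * Theta 0 T)"
    have E: "0 \<le> ?E" using Theta_pos[OF T, of 0] by simp
    \<comment> \<open>The dyadic shells miss the origin itself, a null set.\<close>
    have ne: "AE y in lebesgue. y \<noteq> (0 :: real^'n)"
      using AE_not_in[of "{0 :: real^'n}" lebesgue] by (simp add: null_sets_def)
    have "(\<integral>\<^sup>+y\<in>ball 0 T. ennreal (h y * w y) \<partial>lebesgue)
      \<le> (\<integral>\<^sup>+y. (\<Sum>i. ennreal ((t i / 2) powr (- \<alpha>)) * (ennreal (h y * power_weight \<alpha> y) * indicator (ball
          0 (t i)) y)) \<partial>lebesgue)"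
    proof (rule nn_integral_mono_AE, use ne in eventually_elim)
      case (elim y)
      show "ennreal (h y * w y) * indicator (ball 0 T) y
        \<le> (\<Sum>i. ennreal ((t i / 2) powr (- \<alpha>)) * (ennreal (h y * power_weight \<alpha> y) * indicator (ball 0 (t
            i)) y))"
      proof (cases "y \<in> ball 0 T")
        case True
        obtain i where i: "t i \<le> 2 * norm y" "norm y < t i"
          using dyadic_shell_below[of "norm y" T] True elim unfolding t_def by auto
        have "ennreal (h y * w y) * indicator (ball 0 T) y \<le> ennreal ((t i / 2) powr (- \<alpha>)) * (ennreal
            (h y * power_weight \<alpha> y) * indicator (ball 0 (t i)) y)"
          using scale[of "t i / 2" y] i t[of i] True by simp
        also have "\<dots> \<le> (\<Sum>i. ennreal ((t i / 2) powr (- \<alpha>)) * (ennreal (h y * power_weight \<alpha> y) *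
            indicator (ball 0 (t i)) y))"
          by (rule ennreal_term_le_suminf)
        finally show ?thesis .
      qed simp
    qed
    also have "\<dots> = (\<Sum>i. ennreal ((t i / 2) powr (- \<alpha>)) * (\<integral>\<^sup>+y\<in>ball 0 (t i). ennreal (h y * power_weight
        \<alpha> y) \<partial>lebesgue))"
      by (simp add: nn_integral_suminf nn_integral_cmult)
    also have "\<dots> \<le> (\<Sum>i. N * ennreal (?E * g ^ i))"
    proof (intro suminf_le)
      fix i
      have "ennreal ((t i / 2) powr (- \<alpha>)) * (\<integral>\<^sup>+y\<in>ball 0 (t i). ennreal (h y * power_weight \<alpha> y) \<partial>lebesgue)
        \<le> ennreal ((t i / 2) powr (- \<alpha>)) * (N * ennreal (2 powr (\<alpha> * b) * (max (norm (0 :: real^'n)) (t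
            i) powr (\<alpha> * b) * (t i powr l1 * mass w 0 (t i) powr b))))"
        by (intro mult_left_mono upper t) simp
      also have "\<dots> = N * (ennreal ((t i / 2) powr (- \<alpha>)) * ennreal (2 powr (\<alpha> * b) * (max (norm (0 ::
          real^'n)) (t i) powr (\<alpha> * b) * (t i powr l1 * mass w 0 (t i) powr b))))"
        by (rule mult.left_commute)
      also have "\<dots> \<le> N * ennreal (?E * g ^ i)"
      proof (rule mult_left_mono)
        have m0: "max (norm (0 :: real^'n)) u = u" if "0 < u" for u using that by simp
        have "(t i / 2) powr (- \<alpha>) = 2 powr \<alpha> * t i powr (- \<alpha>)"
          unfolding powr_divide powr_minus_divide by simp
        then have "(t i / 2) powr (- \<alpha>) * (2 powr (\<alpha> * b) * (t i powr (\<alpha> * b) * (t i powr l1 * mass w 0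
            (t i) powr b)))
          = (2 powr \<alpha> * 2 powr (\<alpha> * b)) * ((t i powr (- \<alpha>) * t i powr (\<alpha> * b)) * t i powr l1 * mass w 0
              (t i) powr b)"
          by (simp only: mult_ac)
        also have "\<dots> = 2 powr (\<alpha> * (1 + b)) * (t i powr (l1 - \<beta>) * mass w 0 (t i) powr b)"
          unfolding two powr_add[symmetric] exponent by (simp add: algebra_simps)
        also have "\<dots> \<le> 2 powr (\<alpha> * (1 + b)) * (Ct powr b * (t i / T) powr ((l1 - \<beta>) + k1 * b) * (T powr
            (l1 - \<beta>) * mass w 0 T powr b))"
          using t[of i] T Ct b mass_w_pos[OF T, of 0] mass_w_pos[OF t(1), of 0]
          by (intro mult_left_mono powr_ratio_bound th) auto
        also have "(t i / T) powr ((l1 - \<beta>) + k1 * b) = g ^ i"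
        proof -
          have "t i / T = (1 / 2) ^ i" using T by (simp add: t_def power_divide)
          then have "(t i / T) powr ((l1 - \<beta>) + k1 * b) = ((1 / 2) powr real i) powr ((l1 - \<beta>) + k1 *
              b)" by (simp add: powr_realpow)
          also have "\<dots> = g powr real i" unfolding g_def powr_powr by (simp only: mult.commute)
          finally show ?thesis using g by (simp add: powr_realpow)
        qed
        also have "T powr (l1 - \<beta>) * mass w 0 T powr b = Theta 0 T"
          unfolding Theta_def m0[OF T] powr_diff powr_minus_divide by simp
        also have "2 powr (\<alpha> * (1 + b)) * (Ct powr b * g ^ i * Theta 0 T) = ?E * g ^ i" by (simp only: mult_ac)
        finally have le: "(t i / 2) powr (- \<alpha>) * (2 powr (\<alpha> * b) * (t i powr (\<alpha> * b) * (t i powr l1 *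
            mass w 0 (t i) powr b))) \<le> ?E * g ^ i" .
        show "ennreal ((t i / 2) powr (- \<alpha>)) * ennreal (2 powr (\<alpha> * b) * (max (norm (0 :: real^'n)) (t
            i) powr (\<alpha> * b) * (t i powr l1 * mass w 0 (t i) powr b))) \<le> ennreal (?E * g ^ i)"
          unfolding m0[OF t(1)[of i]] using ennreal_leI[OF le] by (subst ennreal_mult'[symmetric]) auto
      qed simp
      finally show "ennreal ((t i / 2) powr (- \<alpha>)) * (\<integral>\<^sup>+y\<in>ball 0 (t i). ennreal (h y * power_weight \<alpha>
          y) \<partial>lebesgue) \<le> N * ennreal (?E * g ^ i)" .
    qed auto
    also have "\<dots> = N * ennreal (?E / (1 - g))"
      unfolding ennreal_suminf_cmult using suminf_ennreal_geometric[OF E less_imp_le[OF g(1)] g(2)] by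
          (rule arg_cong)
    also have "?E / (1 - g) = 2 powr (\<alpha> * (1 + b)) * (Ct powr b / (1 - g)) * Theta 0 T" by simp
    finally show ?thesis .
  qed
  show "morrey_bound h (ennreal (C_in \<alpha>) * N)"
    unfolding morrey_bound_def
  proof (intro conjI allI impI h h0)
    fix x :: "real^'n" and t :: real assume t: "0 < t"
    have Tp: "0 < Theta x t" by (rule Theta_pos[OF t])
    have "(\<integral>\<^sup>+y\<in>ball x t. ennreal (h y * w y) \<partial>lebesgue) \<le> N * ennreal (C_in \<alpha> * Theta x t)"
    proof (cases "2 * t \<le> norm x")
      case True
      have "2 powr (\<alpha> * (1 + b)) * 1 * Theta x t \<le> C_in \<alpha> * Theta x t"
        unfolding C4_eq using A Tp by (intro mult_right_mono mult_left_mono) auto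
      then have "N * ennreal (2 powr (\<alpha> * (1 + b)) * Theta x t) \<le> N * ennreal (C_in \<alpha> * Theta x t)"
        by (intro mult_left_mono ennreal_leI) auto
      then show ?thesis using near[OF t True] by (rule order_trans[rotated])
    next
      case False
      have "ball x t \<subseteq> ball 0 (3 * t)" using False t by (simp add: ball_subset_ball_iff)
      then have "(\<integral>\<^sup>+y\<in>ball x t. ennreal (h y * w y) \<partial>lebesgue) \<le> (\<integral>\<^sup>+y\<in>ball 0 (3 * t). ennreal (h y * w
          y) \<partial>lebesgue)"
        by (intro nn_integral_mono mult_left_mono indicator_mono_subset) auto
      also have "\<dots> \<le> N * ennreal (2 powr (\<alpha> * (1 + b)) * (Ct powr b / (1 - g)) * Theta 0 (3 * t))"
        using t by (intro origin) simp
      also have "\<dots> \<le> N * ennreal (C_in \<alpha> * Theta x t)"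
      proof (intro mult_left_mono ennreal_leI)
        have "Theta 0 (3 * t) \<le> C_comp 3 * Theta 0 t" using t by (intro Theta_comp) auto
        also have "\<dots> \<le> C_comp 3 * (3 powr \<beta> * (D * 4 powr K) powr b * Theta x t)"
          using False t C_comp_pos[of 3] by (intro mult_left_mono Theta_origin) auto
        finally have "2 powr (\<alpha> * (1 + b)) * (Ct powr b / (1 - g)) * Theta 0 (3 * t)
          \<le> 2 powr (\<alpha> * (1 + b)) * (Ct powr b / (1 - g)) * (C_comp 3 * (3 powr \<beta> * (D * 4 powr K) powr b
              * Theta x t))"
          using g by (intro mult_left_mono) auto
        also have "\<dots> = 2 powr (\<alpha> * (1 + b)) * A * Theta x t" unfolding A_def by (simp only: mult_ac)
        also have "\<dots> \<le> C_in \<alpha> * Theta x t"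
          unfolding C4_eq using Tp by (intro mult_right_mono mult_left_mono) auto
        finally show "2 powr (\<alpha> * (1 + b)) * (Ct powr b / (1 - g)) * Theta 0 (3 * t) \<le> C_in \<alpha> * Theta x t" .
      qed simp
      finally show ?thesis .
    qed
    also have "\<dots> = ennreal (C_in \<alpha>) * N * ennreal (Theta x t)"
      using C4 by (subst ennreal_mult') (auto simp: mult_ac)
    finally show "(\<integral>\<^sup>+y\<in>ball x t. ennreal (h y * w y) \<partial>lebesgue) \<le> ennreal (C_in \<alpha>) * N * ennreal (Theta x t)" .
  qed
qed

definition C_out :: "real \<Rightarrow> real" where
  "C_out \<alpha> = 2 powr \<alpha> * C_lower \<alpha> powr b"

lemma C_out_pos: "0 < C_out \<alpha>"
  using C_lower_pos[of \<alpha>] by (simp add: C_out_def)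

text \<open>The integral is handled by |y| \<le> 2 max(|x|, t), the Morrey denominator by
  \<open>mass_power_weight_lower\<close>; the powers match because \<alpha> - \<beta> = \<alpha>
  b.\<close>

lemma power_weight_of_morrey_bound:
  assumes \<alpha>: "0 \<le> \<alpha>" "\<beta> = \<alpha> * (1 - b)" and [measurable]: "h \<in> borel_measurable lebesgue" and h0: "\<And>x. 0 \<le> h x"
    and t: "0 < t" and bound: "(\<integral>\<^sup>+y\<in>ball x t. ennreal (h y * w y) \<partial>lebesgue) \<le> N * ennreal (Theta x t)"
  shows "(\<integral>\<^sup>+y\<in>ball x t. ennreal (h y * power_weight \<alpha> y) \<partial>lebesgue) \<le> ennreal (C_out \<alpha>) * N * ennreal
      (t powr l1 * mass (power_weight \<alpha>) x t powr b)"
proof -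
  let ?m = "max (norm x) t"
  have m: "0 < ?m" using t by simp
  have "(\<integral>\<^sup>+y\<in>ball x t. ennreal (h y * power_weight \<alpha> y) \<partial>lebesgue)
    \<le> (\<integral>\<^sup>+y. ennreal ((2 * ?m) powr \<alpha>) * (ennreal (h y * w y) * indicator (ball x t) y) \<partial>lebesgue)"
  proof (rule nn_integral_mono)
    fix y
    show "ennreal (h y * power_weight \<alpha> y) * indicator (ball x t) y \<le> ennreal ((2 * ?m) powr \<alpha>) *
        (ennreal (h y * w y) * indicator (ball x t) y)"
    proof (cases "y \<in> ball x t")
      case True
      have "norm y \<le> norm x + dist x y" unfolding dist_norm using norm_triangle_ineq4[of x "x - y"] by simp
      then have "norm y \<le> 2 * ?m" using True by (simp add: max_def)
      then have "norm y powr \<alpha> * (h y * w y) \<le> (2 * ?m) powr \<alpha> * (h y * w y)"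
        using \<alpha> h0[of y] w_pos[of y] by (intro mult_right_mono powr_mono2) auto
      then have "ennreal (h y * power_weight \<alpha> y) \<le> ennreal ((2 * ?m) powr \<alpha> * (h y * w y))"
        by (intro ennreal_leI) (simp add: power_weight_def mult_ac)
      also have "\<dots> = ennreal ((2 * ?m) powr \<alpha>) * ennreal (h y * w y)" by (rule ennreal_mult') simp
      finally show ?thesis using True by simp
    qed simp
  qed
  also have "\<dots> = ennreal ((2 * ?m) powr \<alpha>) * (\<integral>\<^sup>+y\<in>ball x t. ennreal (h y * w y) \<partial>lebesgue)"
    by (rule nn_integral_cmult) measurable
  also have "\<dots> \<le> ennreal ((2 * ?m) powr \<alpha>) * (N * ennreal (Theta x t))"
    by (intro mult_left_mono bound) simp
  also have "\<dots> = N * (ennreal ((2 * ?m) powr \<alpha>) * ennreal (Theta x t))" by (rule mult.left_commute)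
  also have "\<dots> \<le> N * ennreal (C_out \<alpha> * (t powr l1 * mass (power_weight \<alpha>) x t powr b))"
  proof (rule mult_left_mono)
    have e: "\<alpha> + - \<beta> = \<alpha> * b" unfolding \<alpha>(2) by (simp add: algebra_simps)
    have "(2 * ?m) powr \<alpha> * Theta x t = 2 powr \<alpha> * ((?m powr \<alpha> * ?m powr (- \<beta>)) * (t powr l1 * mass w x
        t powr b))"
      unfolding Theta_def powr_mult by (simp only: mult_ac)
    also have "\<dots> = 2 powr \<alpha> * (t powr l1 * (?m powr \<alpha> * mass w x t) powr b)"
      unfolding powr_add[symmetric] e powr_mult powr_powr by (simp only: mult_ac)
    also have "\<dots> \<le> 2 powr \<alpha> * (t powr l1 * (C_lower \<alpha> * mass (power_weight \<alpha>) x t) powr b)"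
      using b by (intro mult_left_mono powr_mono2 mass_power_weight_lower \<alpha> t) auto
    also have "\<dots> = C_out \<alpha> * (t powr l1 * mass (power_weight \<alpha>) x t powr b)"
      unfolding C_out_def powr_mult by (simp only: mult_ac)
    finally have le: "(2 * ?m) powr \<alpha> * Theta x t \<le> C_out \<alpha> * (t powr l1 * mass (power_weight \<alpha>) x t powr b)" .
    show "ennreal ((2 * ?m) powr \<alpha>) * ennreal (Theta x t) \<le> ennreal (C_out \<alpha> * (t powr l1 * mass
        (power_weight \<alpha>) x t powr b))"
      using ennreal_leI[OF le] by (subst ennreal_mult'[symmetric]) auto
  qed simp
  also have "\<dots> = ennreal (C_out \<alpha>) * N * ennreal (t powr l1 * mass (power_weight \<alpha>) x t powr b)"
    using C_out_pos[of \<alpha>] by (subst ennreal_mult') (auto simp: mult_ac)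
  finally show ?thesis .
qed

end

section \<open>The main theorem\<close>

text \<open>The denominator \<open>d\<close> is positive and finite, so it can be moved across an
  inequality even when the norm or N is infinite.\<close>

lemma morrey_norm_bounds:
  fixes v f :: "real^'n \<Rightarrow> real" and l1 l2 :: real
  assumes p: "0 < p"
    and v: "\<And>x r. 0 < r \<Longrightarrow> 0 < mass v x r" "\<And>x r. 0 < r \<Longrightarrow> wmeas v (ball x r) = ennreal (mass v x r)"
  defines "I \<equiv> \<lambda>x r. \<integral>\<^sup>+y\<in>ball x r. ennreal (\<bar>f y\<bar> powr p * v y) \<partial>lebesgue"
    and "d \<equiv> \<lambda>x r. ennreal (r powr l1 * mass v x r powr (l2 / real CARD('n)))"
  shows "0 < r \<Longrightarrow> I x r \<le> epowr (morrey_norm p (l1, l2) v f) p * d x r"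
    and "(\<And>x r. 0 < r \<Longrightarrow> I x r \<le> N * d x r) \<Longrightarrow> morrey_norm p (l1, l2) v f \<le> epowr N (1 / p)"
proof -
  have den: "ennreal (r powr l1) * epowr (wmeas v (ball x r)) (l2 / real CARD('n)) = d x r" if "0 < r" for x r
    using v[OF that, of x] by (simp add: d_def epowr_ennreal ennreal_mult')
  have norm_eq: "morrey_norm p (l1, l2) v f = (SUP (x, r) \<in> UNIV \<times> {0<..}. epowr (I x r / d x r) (1 / p))"
    unfolding morrey_norm_def I_def by (intro SUP_cong refl) (use den in auto)
  have d: "0 < d x r" "d x r < top" if "0 < r" for x r
    using v(1)[OF that, of x] that by (auto simp: d_def)
  show "I x r \<le> epowr (morrey_norm p (l1, l2) v f) p * d x r" if r: "0 < r"
  proof -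
    have "epowr (I x r / d x r) (1 / p) \<le> morrey_norm p (l1, l2) v f"
      unfolding norm_eq using r by (intro SUP_upper2[of "(x, r)"]) auto
    then have "I x r / d x r \<le> epowr (morrey_norm p (l1, l2) v f) p" using p by (simp add: epowr_le_iff)
    then have "I x r / d x r * d x r \<le> epowr (morrey_norm p (l1, l2) v f) p * d x r" by (rule
        mult_right_mono) simp
    moreover have "I x r / d x r * d x r = I x r"
      using d[OF r, of x] by (simp add: ennreal_divide_times)
    ultimately show ?thesis by simp
  qed
  show "morrey_norm p (l1, l2) v f \<le> epowr N (1 / p)" if bound: "\<And>x r. 0 < r \<Longrightarrow> I x r \<le> N * d x r"
    unfolding norm_eq
  proof (rule SUP_least)
    fix i :: "(real^'n) \<times> real" assume i: "i \<in> UNIV \<times> {0<..}"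
    obtain x r where xr: "i = (x, r)" by (cases i)
    have r: "0 < r" using i xr by simp
    have "I x r / d x r \<le> N * d x r / d x r" by (intro divide_right_mono_ennreal bound r)
    also have "\<dots> = N" using d[OF r, of x] by (simp add: ennreal_mult_divide_eq)
    finally have "epowr (I x r / d x r) (1 / p) \<le> epowr N (1 / p)" using p by (intro epowr_mono) auto
    then show "(case i of (x, r) \<Rightarrow> epowr (I x r / d x r) (1 / p)) \<le> epowr N (1 / p)" unfolding xr prod.case .
  qed
qed

lemma morrey_norm_cong_AE:
  assumes "AE x in lebesgue. v x = v' x"
  shows "morrey_norm p l v f = morrey_norm p l v' f"
proof -
  have "wmeas v E = wmeas v' E" for E by (rule wmeas_cong_AE[OF assms])
  moreover have "(\<integral>\<^sup>+y\<in>E. ennreal (\<bar>f y\<bar> powr p * v y) \<partial>lebesgue) = (\<integral>\<^sup>+y\<in>E. ennreal (\<bar>f y\<bar> powr p * v'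
      y) \<partial>lebesgue)" for E
    by (rule nn_integral_cong_AE, use assms in eventually_elim) simp
  ultimately show ?thesis unfolding morrey_norm_def by simp
qed

text \<open>Supplies doubling in the case q = 1, as \<open>Aq\<close> is tied to exponents above 1.
  For the exponent 2 the dual weight is simply 1/w, which an A_1 weight bounds on each ball.\<close>

lemma A1_imp_A2:
  assumes w: "A1 w C"
  shows "Aq 2 w C"
proof -
  note loc = A1D(1)[OF w]
  have [measurable]: "w \<in> borel_measurable lebesgue" using loc by (simp add: pos_locintD)
  have w_pos: "0 < w x" for x using loc by (simp add: pos_locintD)
  have C: "0 < C" by (rule A1D(2)[OF w])
  have e: "dual_weight 2 w = (\<lambda>x. w x powr (- 1))" by simp
  have le: "AE y in lebesgue. y \<in> ball x r \<longrightarrow> w y powr (- 1) \<le> (C / avg w x r) * 1" if r: "0 < r" for x r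
  proof -
    have "(C / avg w x r) powr 1 = C / avg w x r" using C by simp
    then show ?thesis using A1_powr_minus_le[OF w r, of 1 x] by (simp only: zero_le_one mult_1_right)
  qed
  have dual: "pos_locint (\<lambda>x. w x powr (- 1))"
  proof (rule pos_locint_cong_bound[OF pos_locint_one])
    show "0 < w x powr (- 1)" for x using w_pos[of x] by simp
    show "\<exists>c\<ge>0. AE y in lebesgue. y \<in> ball x r \<longrightarrow> w y powr (- 1) \<le> c * 1" if r: "0 < r" for x r
      using le[OF r, of x] C by (intro exI[of _ "C / avg w x r"]) simp
  qed measurable
  show ?thesis
    unfolding Aq_def e
  proof (intro conjI allI impI loc dual)
    fix x :: "real^'a" and r :: real assume r: "0 < r"
    have p: "0 < avg w x r" by (rule avg_pos[OF loc r])
    have "avg (\<lambda>x. w x powr (- 1)) x r \<le> (C / avg w x r) * avg (\<lambda>_. 1) x r"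
      using C by (intro avg_mono_AE[OF pos_locint_one le[OF r] _ r]) simp
    then show "avg w x r * avg (\<lambda>x. w x powr (- 1)) x r powr (2 - 1) \<le> C"
      using p by (simp add: avg_one[OF r] field_simps)
  qed simp
qed

section \<open>Reverse Hoelder exponents\<close>

text \<open>The supremum \<sigma>_w may be infinite and need not be attained. A condition that holds
  in a neighbourhood of its conjugate holds for the conjugate of some admissible \<sigma>: close to
  \<sigma>_w if this is finite, and otherwise large, as the conjugate then tends to 1.\<close>

lemma RH_exponent_approx:
  fixes w :: "real^'n \<Rightarrow> real"
  assumes s: "ereal s < RH_sup w" "1 \<le> s" and P: "eventually P (nhds (conj_exp (RH_sup w)))"
  shows "\<exists>\<sigma>. s < \<sigma> \<and> 1 < \<sigma> \<and> w \<in> RH_class \<sigma> \<and> P (\<sigma> / (\<sigma> - 1))"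
proof -
  let ?S = "{s. 1 < s \<and> w \<in> RH_class s}"
  have pick: "\<exists>\<sigma>\<in>?S. y < \<sigma>" if "ereal y < RH_sup w" for y
    using that unfolding RH_sup_def by (auto simp: less_SUP_iff)
  obtain \<delta> where \<delta>: "0 < \<delta>" "\<And>t. dist t (conj_exp (RH_sup w)) < \<delta> \<Longrightarrow> P t"
    using P unfolding eventually_nhds_metric by blast
  show ?thesis
  proof (cases "RH_sup w")
    case PInf
    obtain \<sigma> where \<sigma>: "\<sigma> \<in> ?S" "max s (1 + 1 / \<delta>) < \<sigma>" using pick[of "max s (1 + 1 / \<delta>)"] unfolding PInf
        by (auto simp del: ereal_max)
    have "\<sigma> / (\<sigma> - 1) - 1 = 1 / (\<sigma> - 1)" using \<sigma>(1) by (simp add: field_simps)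
    moreover have "1 / (\<sigma> - 1) < \<delta>" "0 < 1 / (\<sigma> - 1)" using \<sigma> \<delta>(1) by (auto simp: field_simps)
    ultimately have "dist (\<sigma> / (\<sigma> - 1)) (conj_exp (RH_sup w)) < \<delta>"
      by (simp add: dist_real_def PInf conj_exp_def)
    then show ?thesis using \<sigma> \<delta>(2) by auto
  next
    case (real R)
    then have R: "s < R" using s by simp
    have c: "conj_exp (RH_sup w) = R / (R - 1)" by (simp add: real conj_exp_def)
    have "isCont (\<lambda>t. t / (t - 1)) R" using R s(2) by (intro continuous_intros) auto
    then have "eventually (\<lambda>t. dist (t / (t - 1)) (R / (R - 1)) < \<delta>) (at R)"
      using \<delta>(1) by (auto simp: isCont_def tendsto_iff)
    then obtain e where e: "0 < e" "\<And>t. t \<noteq> R \<Longrightarrow> dist t R < e \<Longrightarrow> dist (t / (t - 1)) (R / (R - 1)) < \<delta>"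
      unfolding eventually_at by auto
    obtain \<sigma> where \<sigma>: "\<sigma> \<in> ?S" "max s (R - e) < \<sigma>" using pick[of "max s (R - e)"] R e(1) unfolding real
        less_ereal.simps(1) by auto
    have "ereal \<sigma> \<le> RH_sup w" unfolding RH_sup_def using \<sigma>(1) by (intro Sup_upper) auto
    then have "\<sigma> \<le> R" using real by simp
    then have "dist (\<sigma> / (\<sigma> - 1)) (R / (R - 1)) < \<delta>"
      using e(2)[of \<sigma>] \<sigma>(2) \<delta>(1) by (cases "\<sigma> = R") (auto simp: dist_real_def)
    then show ?thesis using \<sigma> \<delta>(2) unfolding c by auto
  next
    case MInf
    then show ?thesis using s(1) by simp
  qed
qed

text \<open>Jensen's inequality on the small ball, enlargement of the ball for w^\<sigma>, and the
  reverse Hoelder inequality on the large ball. The volume ratio enters with the exponents 1 and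
  -1/\<sigma>.\<close>

lemma RH_reverse_doubling:
  fixes w :: "real^'n \<Rightarrow> real"
  assumes w: "pos_locint w" and ws: "pos_locint (\<lambda>x. w x powr \<sigma>)" and \<sigma>: "1 < \<sigma>" and C: "0 < C"
    and RH: "\<And>x r. 0 < r \<Longrightarrow> avg (\<lambda>x. w x powr \<sigma>) x r powr (1 / \<sigma>) \<le> C * avg w x r"
    and r: "0 < r" "r \<le> R"
  shows "mass w x r \<le> C * (r / R) powr (real CARD('n) * (1 - 1 / \<sigma>)) * mass w x R"
proof -
  let ?n = "real CARD('n)"
  have R: "0 < R" using r by simp
  have root: "(\<lambda>x. (w x powr \<sigma>) powr (1 / \<sigma>)) = w"
    using \<sigma> pos_locintD(2)[OF w] by (auto simp: powr_powr less_imp_le)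
  have "avg w x r \<le> avg (\<lambda>x. w x powr \<sigma>) x r powr (1 / \<sigma>)"
    using avg_powr_le[OF ws, of "1 / \<sigma>" r x] \<sigma> r unfolding root by simp
  also have "\<dots> \<le> ((R / r) ^ CARD('n) * avg (\<lambda>x. w x powr \<sigma>) x R) powr (1 / \<sigma>)"
    using \<sigma> r R by (intro powr_mono2 avg_subset[OF ws]) (auto simp: subset_ball)
  also have "\<dots> = (R / r) powr (?n / \<sigma>) * avg (\<lambda>x. w x powr \<sigma>) x R powr (1 / \<sigma>)"
    using r R by (simp add: powr_mult powr_powr flip: powr_realpow)
  also have "\<dots> \<le> (R / r) powr (?n / \<sigma>) * (C * avg w x R)"
    by (intro mult_left_mono RH R) simp
  finally have "avg w x r * vol x r \<le> (R / r) powr (?n / \<sigma>) * (C * avg w x R) * vol x r"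
    using vol_pos[OF r(1), of x] by (intro mult_right_mono) auto
  moreover have "vol x r = (r / R) powr ?n * vol x R"
    using vol_scale[OF R r(1), of x x] r R by (simp add: powr_realpow)
  ultimately have "mass w x r \<le> C * ((R / r) powr (?n / \<sigma>) * (r / R) powr ?n) * mass w x R"
    unfolding mass_avg[OF r(1)] mass_avg[OF R] by (simp add: mult_ac)
  also have "(R / r) powr (?n / \<sigma>) = (r / R) powr (- (?n / \<sigma>))"
    using r R unfolding powr_minus powr_divide by simp
  also have "(r / R) powr (- (?n / \<sigma>)) * (r / R) powr ?n = (r / R) powr (?n * (1 - 1 / \<sigma>))"
    unfolding powr_add[symmetric] by (simp add: algebra_simps)
  finally show ?thesis .
qed

text \<open>Jensen's inequality for the power s/\<sigma> of w^\<sigma>.\<close>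

lemma RH_smaller_exponent:
  fixes w :: "real^'n \<Rightarrow> real"
  assumes w: "pos_locint w" and ws: "pos_locint (\<lambda>x. w x powr \<sigma>)" and s: "1 \<le> s" "s < \<sigma>" and C: "0 < C"
    and RH: "\<And>x r. 0 < r \<Longrightarrow> avg (\<lambda>x. w x powr \<sigma>) x r powr (1 / \<sigma>) \<le> C * avg w x r"
  shows "pos_locint (\<lambda>x. w x powr s)"
    and "0 < r \<Longrightarrow> avg (\<lambda>x. w x powr s) x r \<le> C powr s * avg w x r powr s"
proof -
  have root: "(\<lambda>x. (w x powr \<sigma>) powr (s / \<sigma>)) = (\<lambda>x. w x powr s)" using s by (simp add: powr_powr)
  show "pos_locint (\<lambda>x. w x powr s)"
    using pos_locint_powr_le[OF ws, of "s / \<sigma>"] s unfolding root by simp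
  assume r: "0 < r"
  have "avg (\<lambda>x. w x powr s) x r \<le> avg (\<lambda>x. w x powr \<sigma>) x r powr (s / \<sigma>)"
    using avg_powr_le[OF ws, of "s / \<sigma>" r x] s r unfolding root by simp
  also have "\<dots> = (avg (\<lambda>x. w x powr \<sigma>) x r powr (1 / \<sigma>)) powr s" unfolding powr_powr by simp
  also have "\<dots> \<le> (C * avg w x r) powr s" using s by (intro powr_mono2 RH r) auto
  finally show "avg (\<lambda>x. w x powr s) x r \<le> C powr s * avg w x r powr s" unfolding powr_mult .
qed

text \<open>With c = p_- and P = p_+, the single parameter \<eta> = p_-/p_+ gives one formula for
  finite and infinite p_+; every exponent derived from p_+ is expressed through it.\<close>

lemma conj_exp_div:
  assumes P: "ereal a < P" and a: "0 < a" and c: "0 < c"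
  defines "\<eta> \<equiv> (if P = \<infinity> then 0 else c / real_of_ereal P)"
  shows "conj_exp (P / ereal a) = 1 / (1 - \<eta> * (a / c))" "\<eta> * (a / c) < 1" "0 \<le> \<eta>"
    "real_of_ereal (ereal a / P) = \<eta> * (a / c)"
proof -
  consider "P = \<infinity>" | R where "P = ereal R" "a < R" using P by (cases P) auto
  then have "conj_exp (P / ereal a) = 1 / (1 - \<eta> * (a / c)) \<and> \<eta> * (a / c) < 1 \<and> 0 \<le> \<eta> \<and>
    real_of_ereal (ereal a / P) = \<eta> * (a / c)"
  proof cases
    case 1
    then show ?thesis using a by (simp add: \<eta>_def conj_exp_def)
  next
    case 2
    have R: "0 < R" using 2 a by simp
    have e: "\<eta> * (a / c) = a / R" using 2 c by (simp add: \<eta>_def)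
    have "conj_exp (P / ereal a) = (R / a) / (R / a - 1)" using 2 a by (simp add: conj_exp_def)
    also have "\<dots> = 1 / (1 - a / R)" using 2 a R by (simp add: field_simps)
    finally show ?thesis using 2 a R c unfolding e by (auto simp: \<eta>_def)
  qed
  then show "conj_exp (P / ereal a) = 1 / (1 - \<eta> * (a / c))" "\<eta> * (a / c) < 1" "0 \<le> \<eta>"
    "real_of_ereal (ereal a / P) = \<eta> * (a / c)" by auto
qed

theorem theorem4p4:
  fixes p_minus p0 p l1 l2 \<theta> \<alpha> :: real
    and p_plus :: ereal
    and F :: "((real^'n \<Rightarrow> real) \<times> (real^'n \<Rightarrow> real)) set"
    and w :: "real^'n \<Rightarrow> real"
  assumes "0 < p_minus" "p_minus \<le> p0" "ereal p0 < p_plus"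
    and F: "\<And>f g. (f, g) \<in> F \<Longrightarrow>
      f \<in> borel_measurable lebesgue \<and> g \<in> borel_measurable lebesgue \<and> (\<forall>x. 0 \<le> f x \<and> 0 \<le> g x)"
    and hyp: "\<exists>\<Phi> :: ennreal \<Rightarrow> ennreal \<Rightarrow> real. (\<forall>a b. 0 < \<Phi> a b) \<and>
      (\<forall>(f, g) \<in> F. \<forall>u \<in> A_class (p0 / p_minus) \<inter> RH_class (conj_exp (p_plus / ereal p0)).
        Lp_norm p0 u g \<le>
          ennreal (\<Phi> (A_const (p0 / p_minus) u) (RH_const (conj_exp (p_plus / ereal p0)) u))
            * Lp_norm p0 u f)"
    and p: "p_minus < p \<or> (p0 = p_minus \<and> p = p_minus)" "ereal p < p_plus"
    and w: "w \<in> A_class (p / p_minus)" "ereal (conj_exp (p_plus / ereal p)) < RH_sup w"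
    and l: "0 \<le> l2" "l2 \<le> real CARD('n)"
      "0 < l1 * conj_exp (RH_sup w) + l2"
      "l1 * conj_exp (RH_sup w) + l2
         < real CARD('n) * (1 - real_of_ereal (ereal p / p_plus) * conj_exp (RH_sup w))"
    and \<theta>: "0 \<le> \<theta>" "0 < l1 + l2 * \<theta>"
      "\<exists>c::real. \<forall>r R. 0 < r \<and> r < R \<longrightarrow>
        wmeas w (ball 0 r) / wmeas w (ball 0 R) \<le> ennreal (c * (r / R) powr (real CARD('n) * \<theta>))"
    and \<alpha>: "0 \<le> \<alpha>" "l2 < real CARD('n) \<Longrightarrow>
        \<alpha> < real CARD('n) / (real CARD('n) - l2) * (l1 + l2 * \<theta>)"
  shows "\<exists>C::real. 0 < C \<and>
    (\<forall>(f, g) \<in> F. morrey_norm p (l1, l2) (\<lambda>x. norm x powr \<alpha> * w x) g \<le>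
       ennreal C * morrey_norm p (l1, l2) (\<lambda>x. norm x powr \<alpha> * w x) f)"
proof -
  let ?n = "real CARD('n)"
  define q where "q = p / p_minus"
  define q0 where "q0 = p0 / p_minus"
  define \<eta> where "\<eta> = (if p_plus = \<infinity> then 0 else p_minus / real_of_ereal p_plus)"
  define s where "s = 1 / (1 - \<eta> * q)"
  define s0 where "s0 = 1 / (1 - \<eta> * q0)"
  have pp: "0 < p" "0 < p0" using assms(1,2) p(1) by auto
  have q: "1 \<le> q" "1 \<le> q0" "q = 1 \<Longrightarrow> q0 = 1" using assms(1,2) p(1) by (auto simp: q_def q0_def)
  have s_eq: "conj_exp (p_plus / ereal p) = s" "\<eta> * q < 1" "0 \<le> \<eta>" "real_of_ereal (ereal p / p_plus) = \<eta> * q"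
    using conj_exp_div[OF p(2) pp(1) assms(1)] unfolding s_def q_def \<eta>_def by auto
  have s0_eq: "conj_exp (p_plus / ereal p0) = s0" "\<eta> * q0 < 1"
    using conj_exp_div[OF assms(3) pp(2) assms(1)] unfolding s0_def q0_def \<eta>_def by auto
  have "0 \<le> \<eta> * q" "0 \<le> \<eta> * q0" using s_eq(3) q by auto
  then have s1: "1 \<le> s" "1 \<le> s0" using s_eq(2) s0_eq(2) by (auto simp: s_def s0_def pos_le_divide_eq)
  have wt: "weight w" using w(1) by (simp add: A_class_def)
  define W0 where "W0 = pos_version w"
  have W0: "pos_locint W0" unfolding W0_def by (rule weight_pos_locint[OF wt])
  obtain Cw where Cw: "if q = 1 then A1 W0 Cw else Aq q W0 Cw"
    using A_class_pos_version[OF w(1)] q(1) unfolding q_def W0_def by blast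
  \<comment> \<open>This exponent serves for doubling; in the case q = 1 it is 2.\<close>
  obtain q2 where q2: "1 < q2" "Aq q2 W0 Cw"
  proof (cases "q = 1")
    case True
    then have "Aq 2 W0 Cw" using Cw by (intro A1_imp_A2) simp
    then show ?thesis by (intro that[of 2]) auto
  next
    case False
    then show ?thesis using that[of q] q Cw by simp
  qed

  \<comment> \<open>Both conditions on \<lambda> are strict and continuous in the conjugate of
    \<sigma>_w, so they persist for a nearby admissible exponent.\<close>
  have "eventually (\<lambda>t. 0 < l1 * t + l2) (nhds (conj_exp (RH_sup w)))"
    by (rule order_tendstoD(1)[OF _ l(3)]) (intro tendsto_intros filterlim_ident)
  moreover have "eventually (\<lambda>t. 0 < ?n * (1 - \<eta> * q * t) - (l1 * t + l2)) (nhds (conj_exp (RH_sup w)))"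
  proof (rule order_tendstoD(1))
    show "0 < ?n * (1 - \<eta> * q * conj_exp (RH_sup w)) - (l1 * conj_exp (RH_sup w) + l2)"
      using l(4) unfolding s_eq(4) by simp
  qed (intro tendsto_intros filterlim_ident)
  ultimately have "eventually (\<lambda>t. 0 < l1 * t + l2 \<and> 0 < ?n * (1 - \<eta> * q * t) - (l1 * t + l2)) (nhds
      (conj_exp (RH_sup w)))"
    by (rule eventually_conj)
  from RH_exponent_approx[OF _ s1(1) this] w(2)[unfolded s_eq(1)]
  obtain \<sigma> where \<sigma>: "s < \<sigma>" "1 < \<sigma>" "w \<in> RH_class \<sigma>" "0 < l1 * (\<sigma> / (\<sigma> - 1)) + l2"
    "0 < ?n * (1 - \<eta> * q * (\<sigma> / (\<sigma> - 1))) - (l1 * (\<sigma> / (\<sigma> - 1)) + l2)" by blast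
  have ws\<sigma>: "pos_locint (\<lambda>x. W0 x powr \<sigma>)"
    unfolding W0_def using \<sigma> by (intro RH_class_pos_version(1)) auto
  obtain Cs where Cs: "0 < Cs" "\<And>x r. 0 < r \<Longrightarrow> avg (\<lambda>x. W0 x powr \<sigma>) x r powr (1 / \<sigma>) \<le> Cs * avg W0 x r"
    using RH_class_pos_version(2)[OF \<sigma>(3)] \<sigma>(2) unfolding W0_def by auto
  \<comment> \<open>The conjugate of \<sigma>; n/\<tau> = n(1 - 1/\<sigma>) is the rate of reverse
    doubling.\<close>
  define \<tau> where "\<tau> = \<sigma> / (\<sigma> - 1)"
  have \<tau>: "0 < \<tau>" "1 - 1 / \<sigma> = 1 / \<tau>" using \<sigma>(2) by (auto simp: \<tau>_def field_simps)
  define b where "b = l2 / ?n"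
  have n0: "0 < ?n" by simp
  have b: "0 \<le> b" "b \<le> 1" using l n0 by (auto simp: b_def)
  define \<beta> where "\<beta> = \<alpha> * (1 - b)"
  obtain c where c: "\<And>r R. 0 < r \<Longrightarrow> r < R \<Longrightarrow>
      wmeas w (ball 0 r) / wmeas w (ball 0 R) \<le> ennreal (c * (r / R) powr (?n * \<theta>))" using \<theta>(3) by blast

  interpret M: morrey_weight W0 "max 1 Cw" "?n * q2" "max 1 Cs" "?n / \<tau>" "Cs powr s" s "max 1 c" "?n * \<theta>" l1 b \<beta>
  proof
    show "pos_locint W0" by (rule W0)
    show "mass W0 y R \<le> max 1 Cw * (R / r) powr (?n * q2) * mass W0 x r" if "ball x r \<subseteq> ball y R" "0 <
        r" "0 < R" for x r y R
      using Aq_doubling_mass[OF q2(2) that] by (rule order_trans) (intro mult_right_mono, auto)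
    show "mass W0 x r \<le> max 1 Cs * (r / R) powr (?n / \<tau>) * mass W0 x R" if "0 < r" "r \<le> R" for x r R
    proof -
      have "mass W0 x r \<le> Cs * (r / R) powr (?n * (1 - 1 / \<sigma>)) * mass W0 x R"
        by (rule RH_reverse_doubling[OF W0 ws\<sigma> \<sigma>(2) Cs that])
      also have "?n * (1 - 1 / \<sigma>) = ?n / \<tau>" unfolding \<tau>(2) by simp
      also have "Cs * (r / R) powr (?n / \<tau>) * mass W0 x R \<le> max 1 Cs * (r / R) powr (?n / \<tau>) * mass W0 x R"
        by (intro mult_right_mono) auto
      finally show ?thesis .
    qed
    show "pos_locint (\<lambda>x. W0 x powr s)" by (rule RH_smaller_exponent(1)[OF W0 ws\<sigma> s1(1) \<sigma>(1) Cs])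
    show "avg (\<lambda>x. W0 x powr s) x r \<le> Cs powr s * avg W0 x r powr s" if "0 < r" for x r
      by (rule RH_smaller_exponent(2)[OF W0 ws\<sigma> s1(1) \<sigma>(1) Cs that])
    show "mass W0 0 r \<le> max 1 c * (r / R) powr (?n * \<theta>) * mass W0 0 R" if r: "0 < r" "r \<le> R" for r R
    \<comment> \<open>The hypothesis concerns r < R; equality is covered by \<open>max 1 c\<close>
      being at least 1.\<close>
    proof (cases "r = R")
      case True
      have "1 * mass W0 0 r \<le> max 1 c * mass W0 0 r" by (intro mult_right_mono) auto
      then show ?thesis using True r by simp
    next
      case False
      then have rR: "r < R" "0 < R" using r by auto
      have wm: "wmeas w (ball 0 t) = ennreal (mass W0 0 t)" for t
        using pos_locintD(4)[OF W0, of 0 t] by (simp add: W0_def wmeas_pos_version[OF wt])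
      have R0: "0 < mass W0 0 R" by (rule mass_pos[OF W0 rR(2)])
      have "ennreal (mass W0 0 r / mass W0 0 R) = wmeas w (ball 0 r) / wmeas w (ball 0 R)"
        unfolding wm using R0 by (simp add: divide_ennreal)
      also have "\<dots> \<le> ennreal (c * (r / R) powr (?n * \<theta>))" by (rule c[OF r(1) rR(1)])
      also have "\<dots> \<le> ennreal (max 1 c * (r / R) powr (?n * \<theta>))" by (intro ennreal_leI mult_right_mono) auto
      finally have "mass W0 0 r / mass W0 0 R \<le> max 1 c * (r / R) powr (?n * \<theta>)"
        by (subst (asm) ennreal_le_iff) auto
      then show ?thesis using R0 by (simp add: pos_divide_le_eq)
    qed
    \<comment> \<open>The lower condition on \<lambda>, divided by \<tau>.\<close>
    show "0 < l1 + ?n / \<tau> * b"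
    proof -
      have "0 < (l1 * \<tau> + l2) / \<tau>" using \<sigma>(4) \<tau>(1) unfolding \<tau>_def[symmetric] by simp
      also have "\<dots> = l1 + ?n / \<tau> * b" using \<tau>(1) n0 by (simp add: b_def field_simps)
      finally show ?thesis .
    qed
    \<comment> \<open>The condition on \<alpha> multiplied by 1 - l2/n. For l2 = n it reads 0 < l1 +
      l2 \<theta>, whatever \<alpha> is.\<close>
    show "\<beta> < l1 + ?n * \<theta> * b"
    proof -
      have e: "?n * \<theta> * b = l2 * \<theta>" using n0 by (simp add: b_def)
      show ?thesis
      proof (cases "l2 < ?n")
        case True
        have "\<alpha> * ((?n - l2) / ?n) < ?n / (?n - l2) * (l1 + l2 * \<theta>) * ((?n - l2) / ?n)"
          using \<alpha>(2)[OF True] True n0 by (intro mult_strict_right_mono) auto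
        also have "\<dots> = l1 + l2 * \<theta>" using True n0 by simp
        also have "(?n - l2) / ?n = 1 - b" using n0 by (simp add: b_def field_simps)
        finally show ?thesis unfolding e \<beta>_def .
      next
        case False
        then have "b = 1" using l(2) n0 by (simp add: b_def)
        then show ?thesis using \<theta>(2) unfolding e \<beta>_def by simp
      qed
    qed
    \<comment> \<open>The upper condition on \<lambda> multiplied by s/\<tau>, combined with s(1 -
      \<eta> q) = 1.\<close>
    show "0 < ?n * (1 - s) - s * l1 + ?n / \<tau> * (s * (1 - b))"
    proof -
      have s_inv: "s * (1 - \<eta> * q) = 1" using s_eq(2) by (simp add: s_def)
      have "0 < s / \<tau> * (?n * (1 - \<eta> * q * \<tau>) - (l1 * \<tau> + l2))"
        using \<sigma>(5) \<tau>(1) s1(1) unfolding \<tau>_def[symmetric] by (intro mult_pos_pos) auto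
      also have "\<dots> = (s * ?n - s * l2) / \<tau> - ?n * (s * (\<eta> * q)) - s * l1"
        using \<tau>(1) by (simp add: field_simps)
      also have "s * (\<eta> * q) = s - 1" using s_inv by (simp add: right_diff_distrib)
      also have "(s * ?n - s * l2) / \<tau> = ?n / \<tau> * (s * (1 - b))"
        using \<tau>(1) n0 by (simp add: b_def field_simps)
      finally show ?thesis by (simp add: right_diff_distrib)
    qed
  qed (use s1 \<theta> b \<alpha> q2 Cs in \<open>auto simp: \<beta>_def\<close>)

  define FG where "FG = (\<lambda>(f, g). (\<lambda>x. f x powr p_minus, \<lambda>x. g x powr p_minus)) ` F"
  have FG: "F' \<in> borel_measurable lebesgue \<and> G' \<in> borel_measurable lebesgue \<and> (\<forall>x. 0 \<le> F' x \<and> 0 \<le> G' x)"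
    if FG': "(F', G') \<in> FG" for F' G'
  proof -
    obtain f g where fg: "(f, g) \<in> F" "F' = (\<lambda>x. f x powr p_minus)" "G' = (\<lambda>x. g x powr p_minus)"
      using FG' by (auto simp: FG_def)
    have [measurable]: "f \<in> borel_measurable lebesgue" "g \<in> borel_measurable lebesgue" using F[OF fg(1)] by auto
    show ?thesis unfolding fg(2,3) by simp
  qed
  obtain \<Phi> :: "ennreal \<Rightarrow> ennreal \<Rightarrow> real" where \<Phi>: "\<And>a b. 0 < \<Phi> a b"
    "\<And>f g u. (f, g) \<in> F \<Longrightarrow> u \<in> A_class q0 \<inter> RH_class s0 \<Longrightarrow>
        Lp_norm p0 u g \<le> ennreal (\<Phi> (A_const q0 u) (RH_const s0 u)) * Lp_norm p0 u f"
    using hyp unfolding q0_def[symmetric] s0_eq(1) by blast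
  \<comment> \<open>For a fixed weight the value of \<open>\<Phi>\<close> is just a positive number;
    its power p0 is the constant between the integrals.\<close>
  have hyp0: "\<exists>C\<ge>0. \<forall>(F, G) \<in> FG. (\<integral>\<^sup>+x. ennreal (G x powr q0 * v x) \<partial>lebesgue)
      \<le> ennreal C * (\<integral>\<^sup>+x. ennreal (F x powr q0 * v x) \<partial>lebesgue)" if v: "A_RH q0 s0 v" for v
  proof -
    have mem: "v \<in> A_class q0 \<inter> RH_class s0" by (rule A_RH_class_membership[OF v q(2) s1(2)])
    define C where "C = \<Phi> (A_const q0 v) (RH_const s0 v)"
    have C: "0 < C" unfolding C_def by (rule \<Phi>(1))
    have "(\<integral>\<^sup>+x. ennreal (G' x powr q0 * v x) \<partial>lebesgue) \<le> ennreal (C powr p0) * (\<integral>\<^sup>+x. ennreal (F' x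
        powr q0 * v x) \<partial>lebesgue)"
      if FG': "(F', G') \<in> FG" for F' G'
    proof -
      obtain f g where fg: "(f, g) \<in> F" "F' = (\<lambda>x. f x powr p_minus)" "G' = (\<lambda>x. g x powr p_minus)"
        using FG' by (auto simp: FG_def)
      have e: "(h x powr p_minus) powr q0 = \<bar>h x\<bar> powr p0" if "0 \<le> h x" for h :: "real^'n \<Rightarrow> real" and x
        using that assms(1) by (simp add: powr_powr q0_def)
      have "epowr (\<integral>\<^sup>+x. ennreal (\<bar>g x\<bar> powr p0 * v x) \<partial>lebesgue) (1 / p0)
          \<le> ennreal C * epowr (\<integral>\<^sup>+x. ennreal (\<bar>f x\<bar> powr p0 * v x) \<partial>lebesgue) (1 / p0)"
        using \<Phi>(2)[OF fg(1) mem] unfolding Lp_norm_def C_def .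
      then have "(\<integral>\<^sup>+x. ennreal (\<bar>g x\<bar> powr p0 * v x) \<partial>lebesgue)
          \<le> epowr (ennreal C * epowr (\<integral>\<^sup>+x. ennreal (\<bar>f x\<bar> powr p0 * v x) \<partial>lebesgue) (1 / p0)) p0"
        using pp by (simp add: epowr_le_iff)
      also have "\<dots> = ennreal (C powr p0) * (\<integral>\<^sup>+x. ennreal (\<bar>f x\<bar> powr p0 * v x) \<partial>lebesgue)"
        using pp C by (simp add: epowr_mult epowr_epowr epowr_ennreal)
      finally show ?thesis using F[OF fg(1)] unfolding fg(2,3) by (simp add: e)
    qed
    then show ?thesis by (intro exI[of _ "C powr p0"]) auto
  qed
  have ext: "\<exists>C\<ge>0. \<forall>(F, G) \<in> FG. (\<integral>\<^sup>+x. ennreal (G x powr q * u x) \<partial>lebesgue)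
      \<le> ennreal C * (\<integral>\<^sup>+x. ennreal (F x powr q * u x) \<partial>lebesgue)" if u: "A_RH q s u" for u
    by (rule limited_range_extrapolation[OF q s_eq(3,2) s0_eq(2) FG hyp0[unfolded s0_def] u[unfolded s_def]])
  obtain C where C: "0 < C" "\<forall>(F, G) \<in> FG. \<forall>N. M.morrey_bound (\<lambda>x. F x powr q) N \<longrightarrow>
      (\<forall>x r. 0 < r \<longrightarrow> (\<integral>\<^sup>+z\<in>ball x r. ennreal (G z powr q * W0 z) \<partial>lebesgue) \<le> ennreal C * N * ennreal
          (M.Theta x r))"
    using M.morrey_transfer[OF q(1) Cw FG ext] by blast
  define V where "V = M.power_weight \<alpha>"
  have V_AE: "AE x in lebesgue. norm x powr \<alpha> * w x = V x"
    using pos_version_AE[OF wt] by eventually_elim (simp only: V_def M.power_weight_def, simp only: W0_def)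
  have V: "0 < mass V x r" "wmeas V (ball x r) = ennreal (mass V x r)" if "0 < r" for x r
    unfolding V_def using M.mass_power_weight_pos[OF \<alpha>(1) that] M.wmeas_power_weight[OF \<alpha>(1) that] by auto
  define K where "K = (M.C_out \<alpha> * C * M.C_in \<alpha>) powr (1 / p)"
  have C4: "0 < M.C_in \<alpha>"
    by (rule M.morrey_bound_of_power_weight(2)[OF \<alpha>(1) \<beta>_def, of "\<lambda>_. 0" 0]) simp_all
  have K0: "0 < M.C_out \<alpha> * C * M.C_in \<alpha>" using C4 C(1) M.C_out_pos[of \<alpha>] by simp
  have "morrey_norm p (l1, l2) V g \<le> ennreal K * morrey_norm p (l1, l2) V f" if fg: "(f, g) \<in> F" for f g
  proof -
    have [measurable]: "f \<in> borel_measurable lebesgue" "g \<in> borel_measurable lebesgue"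
      and f0: "\<And>x. 0 \<le> f x" and g0: "\<And>x. 0 \<le> g x" using F[OF fg] by auto
    define N where "N = epowr (morrey_norm p (l1, l2) V f) p"
    have mem: "((\<lambda>x. f x powr p_minus), (\<lambda>x. g x powr p_minus)) \<in> FG" using fg by (force simp: FG_def)
    have e: "(h x powr p_minus) powr q = \<bar>h x\<bar> powr p" if "0 \<le> h x" for h :: "real^'n \<Rightarrow> real" and x
      using that assms(1) by (simp add: powr_powr q_def)
    have "M.morrey_bound (\<lambda>x. \<bar>f x\<bar> powr p) (ennreal (M.C_in \<alpha>) * N)"
    proof (rule M.morrey_bound_of_power_weight(1)[OF \<alpha>(1) \<beta>_def])
      show "(\<integral>\<^sup>+y\<in>ball x t. ennreal (\<bar>f y\<bar> powr p * M.power_weight \<alpha> y) \<partial>lebesgue) \<le> N * ennreal (t powr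
          l1 * mass (M.power_weight \<alpha>) x t powr b)"
        if "0 < t" for x t
        using morrey_norm_bounds(1)[OF pp(1) V that, of f x l1 l2] unfolding N_def V_def b_def .
    qed auto
    then have mb: "M.morrey_bound (\<lambda>x. (f x powr p_minus) powr q) (ennreal (M.C_in \<alpha>) * N)" using f0 by
        (simp add: e)
    have "(\<integral>\<^sup>+z\<in>ball x r. ennreal (\<bar>g z\<bar> powr p * W0 z) \<partial>lebesgue) \<le> ennreal C * (ennreal (M.C_in \<alpha>) *
        N) * ennreal (M.Theta x r)"
      if "0 < r" for x r
    proof -
      have "(\<integral>\<^sup>+z\<in>ball x r. ennreal ((g z powr p_minus) powr q * W0 z) \<partial>lebesgue) \<le> ennreal C * (ennreal
          (M.C_in \<alpha>) * N) * ennreal (M.Theta x r)"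
        using C(2) mem mb that by fast
      then show ?thesis using g0 by (simp add: e)
    qed
    then have g_bound: "(\<integral>\<^sup>+y\<in>ball x r. ennreal (\<bar>g y\<bar> powr p * V y) \<partial>lebesgue)
        \<le> ennreal (M.C_out \<alpha>) * (ennreal C * (ennreal (M.C_in \<alpha>) * N)) * ennreal (r powr l1 * mass V x r
            powr (l2 / ?n))"
      if "0 < r" for x r
      using that unfolding V_def b_def[symmetric]
      by (intro M.power_weight_of_morrey_bound[OF \<alpha>(1) \<beta>_def]) auto
    have "morrey_norm p (l1, l2) V g \<le> epowr (ennreal (M.C_out \<alpha>) * (ennreal C * (ennreal (M.C_in \<alpha>) *
        N))) (1 / p)"
      by (rule morrey_norm_bounds(2)[OF pp(1) V g_bound])
    also have "ennreal (M.C_out \<alpha>) * (ennreal C * (ennreal (M.C_in \<alpha>) * N)) = ennreal (M.C_out \<alpha> * C *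
        M.C_in \<alpha>) * N"
      using M.C_out_pos[of \<alpha>] C(1) C4 by (simp add: ennreal_mult mult.assoc)
    also have "epowr (ennreal (M.C_out \<alpha> * C * M.C_in \<alpha>) * N) (1 / p) = ennreal K * morrey_norm p (l1, l2) V f"
      using pp K0 by (simp add: epowr_mult epowr_ennreal less_imp_le K_def N_def epowr_epowr)
    finally show ?thesis .
  qed
  moreover have "0 < K" using K0 unfolding K_def by (metis less_irrefl powr_gt_zero)
  ultimately show ?thesis unfolding morrey_norm_cong_AE[OF V_AE] by blast
qed

end
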